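(* Let $X$ be an affine Poisson variety over $k$ with a deformation quantization of $\mathcal O_X$ given by $\alpha^X=\epsilon\alpha_1^X+\epsilon^2\alpha_2^X+\cdots$, let $Y\subset X$ be a subvariety and $E$ a vector bundle on $Y$, viewed as a coherent $\mathcal O_X$-module. Let $\mathfrak g^n=Hom_k(\mathcal O_X^{\otimes n}\otimes E,E)$ and define operations on $\mathfrak g[[\epsilon]]$ by (1) $\ell_0(1):=-\alpha^X\otimes id_E\in\mathfrak g^2[[\epsilon]]$, i.e. $(a,b,e)\mapsto-\alpha^X(a,b)e$; (2) $\ell_1(\alpha)(a_1,\ldots,a_{k+1},e):=d_{Hoch}\alpha(a_1,\ldots,a_{k+1},e)+\sum_{j=1}^{k}(-1)^j\alpha(a_1,\ldots,\alpha^X(a_j,a_{j+1}),a_{j+2},\ldots,a_{k+1},e)$ for $\alpha$ of degree $k$; (3) $\ell_2(\alpha_1,\alpha_2):=[\alpha_1,\alpha_2]_G$. Then $(\mathfrak g[[\epsilon]],\ell_0,\ell_1,\ell_2)$ is a curved dg Lie algebra, and it reduces to the classical relative Hochschild complex (the dg Lie algebra with differential $d_{Hoch}$ and bracket $[\cdot,\cdot]_G$) when the Poisson structure on $X$ is trivial. It governs the noncommutative deformations of $E$ in the following sense: for $\alpha=\epsilon\alpha_1+\epsilon^2\alpha_2+\cdots\in\epsilon\,\mathfrak g^1[[\epsilon]]$, the formula $a\star e=ae+\epsilon\alpha_1(a,e)+\epsilon^2\alpha_2(a,e)+\cdots$ defines an associative module action on $E[[\epsilon]]$ of the deformation quantization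 of $\mathcal O_X$ if and only if $$\ell_0(1)+\ell_1(\alpha)+\tfrac12\ell_2(\alpha,\alpha)=0,$$ and two such solutions $\alpha,\alpha'$ define gauge equivalent module actions if and only if they are gauge equivalent as solutions of this Maurer–Cartan equation.
   Context: $k$ is the ground field, containing the rational numbers. A deformation quantization of $\mathcal O_X$ is an associative $k[[\epsilon]]$-bilinear product on $\mathcal O_X[[\epsilon]]$ of the form $a\star b=ab+\alpha^X(a,b)$ with $\alpha^X=\epsilon\alpha_1^X+\epsilon^2\alpha_2^X+\cdots$, the $\alpha_i^X$ bidifferential operators and $\alpha_1^X(a,b)=\frac12P(da,db)$, $P$ the Poisson bivector of $X$. The Hochschild differential is, for $\alpha\in\mathfrak g^k$, $$d_{Hoch}\alpha(a_1,\ldots,a_{k+1},e)=a_1\alpha(a_2,\ldots,a_{k+1},e)+\sum_{i=1}^k(-1)^i\alpha(a_1,\ldots,a_ia_{i+1},\ldots,a_{k+1},e)+(-1)^{k+1}\alpha(a_1,\ldots,a_k,a_{k+1}e),$$ and for $\alpha_1\in\mathfrak g^k,\alpha_2\in\mathfrak g^l$, $[\alpha_1,\alpha_2]_G=\alpha_1\circ\alpha_2-(-1)^{kl}\alpha_2\circ\alpha_1$ with $\alpha_1\circ\alpha_2(a_1,\ldots,a_{k+l},e)=\alpha_1(a_1,\ldots,a_k,\alpha_2(a_{k+1},\ldots,a_{k+l},e))$. All are extended $k[[\epsilon]]$-linearly. A curved dg Lie algebra is a graded Lie algebra $(A,\ell_2)$ with a degree $1$ derivation $\ell_1$ of $\ell_2$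 and an element $\ell_0(1)\in A^2$ such that $\ell_1(\ell_0(1))=0$ and $\ell_1(\ell_1(\beta))=\ell_2(\ell_0(1),\beta)$ for all $\beta$. Two module actions $\star,\star'$ are gauge equivalent if there is $\phi=id+\epsilon\phi_1+\epsilon^2\phi_2+\cdots\in\mathfrak g^0[[\epsilon]]$ with $\phi(a\star e)=a\star'\phi(e)$ for all $a,e$. Two Maurer–Cartan solutions $\alpha,\alpha'$ are gauge equivalent if there are $a(t)\in\epsilon\,\mathfrak g^1[t][[\epsilon]]$ and $b(t)\in\epsilon\,\mathfrak g^0[t][[\epsilon]]$ (polynomial in $t$ at each order in $\epsilon$) with $a(0)=\alpha$, $a(1)=\alpha'$, $a(t)$ a solution of the Maurer–Cartan equation for all $t$, and $\frac{da}{dt}+\ell_1(b(t))+\ell_2(b(t),a(t))=0$.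
   Formalization: The gauge equation is taken as da/dt+ℓ_1(b)+ℓ_2(a,b)=0, since with ℓ_2(b,a) the last claim is false; the exact reduction to the classical complex is stated for P=0 with α^X=0, and only modulo ε² for P=0 with an arbitrary quantization, where exact reduction fails. *)

theory Defs
  imports
    "HOL-Library.Function_Algebras"
    "HOL-Computational_Algebra.Polynomial"
    "HOL-Computational_Algebra.Formal_Power_Series"
begin

unbundle fps_syntax

section \<open>The geometric data\<close>

text \<open>
  An affine variety over a field k is given by its coordinate ring, a reduced finitely
  generated k-algebra (irreducibility is not required). The ring is the type of class
  \<open>comm_ring_1\<close>, and \<open>\<iota>\<close> is the structure map from k.
\<close>

locale affine_variety =
  fixes \<iota> :: "'k::field_char_0 \<Rightarrow> 'a::comm_ring_1"
  assumes hom_one: "\<iota> 1 = 1"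
    and hom_add: "\<iota> (c + d) = \<iota> c + \<iota> d"
    and hom_mult: "\<iota> (c * d) = \<iota> c * \<iota> d"
    and finitely_generated:
      "\<exists>S. finite S \<and>
        (\<forall>B. range \<iota> \<subseteq> B \<and> S \<subseteq> B \<and> (\<forall>x\<in>B. \<forall>y\<in>B. x + y \<in> B \<and> x * y \<in> B) \<longrightarrow> B = UNIV)"
    and reduced: "(x :: 'a) ^ n = 0 \<Longrightarrow> x = 0"

definition k_on_A :: "('k \<Rightarrow> 'a) \<Rightarrow> 'k \<Rightarrow> 'a::comm_ring_1 \<Rightarrow> 'a" where
  "k_on_A \<iota> c a = \<iota> c * a"

definition k_on_E :: "('k \<Rightarrow> 'a) \<Rightarrow> ('a \<Rightarrow> 'e \<Rightarrow> 'e) \<Rightarrow> 'k \<Rightarrow> 'e \<Rightarrow> 'e" where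
  "k_on_E \<iota> act c e = act (\<iota> c) e"

text \<open>
  The Poisson bivector enters through the biderivation \<open>P a b\<close>, the value of the bivector
  on da and db.
\<close>

locale affine_poisson_variety = affine_variety \<iota>
  for \<iota> :: "'k::field_char_0 \<Rightarrow> 'a::comm_ring_1" +
  fixes P :: "'a \<Rightarrow> 'a \<Rightarrow> 'a"
  assumes poisson_linear: "module_hom (k_on_A \<iota>) (k_on_A \<iota>) (P a)"
    and poisson_antisym: "P a b = - P b a"
    and poisson_leibniz: "P a (b * c) = P a b * c + b * P a c"
    and poisson_jacobi: "P a (P b c) + P b (P c a) + P c (P a b) = 0"

text \<open>
  Grothendieck's differential operators: \<open>diff_op m D\<close> says that \<open>D\<close>, assumed k-linear, has
  order less than \<open>m\<close>.
\<close>

primrec diff_op :: "nat \<Rightarrow> ('a::comm_ring_1 \<Rightarrow> 'a) \<Rightarrow> bool" where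
  "diff_op 0 D \<longleftrightarrow> (\<forall>x. D x = 0)"
| "diff_op (Suc m) D \<longleftrightarrow> (\<forall>f. diff_op m (\<lambda>x. D (f * x) - f * D x))"

definition bidiff_op :: "('k::field_char_0 \<Rightarrow> 'a::comm_ring_1) \<Rightarrow> ('a \<Rightarrow> 'a \<Rightarrow> 'a) \<Rightarrow> bool" where
  "bidiff_op \<iota> B \<longleftrightarrow>
     (\<forall>a. module_hom (k_on_A \<iota>) (k_on_A \<iota>) (\<lambda>b. B a b)) \<and>
     (\<forall>b. module_hom (k_on_A \<iota>) (k_on_A \<iota>) (\<lambda>a. B a b)) \<and>
     (\<exists>m. (\<forall>a. diff_op m (\<lambda>b. B a b)) \<and> (\<forall>b. diff_op m (\<lambda>a. B a b)))"

text \<open>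
  \<open>eps_app F x\<close> applies a power series of additive maps to a power series of arguments. For a
  bilinear \<open>B\<close>, the term \<open>eps_app (eps_app (fps_const B) x) y\<close> is its extension to power
  series, bilinear over k[[\<open>\<epsilon>\<close>]]. Zero and sums of functions are the pointwise ones
  of \<^theory>\<open>HOL-Library.Function_Algebras\<close>.
\<close>

definition eps_app :: "('x::zero \<Rightarrow> 'y::comm_monoid_add) fps \<Rightarrow> 'x fps \<Rightarrow> 'y fps" where
  "eps_app F x = Abs_fps (\<lambda>n. \<Sum>i\<le>n. (F $ i) (x $ (n - i)))"

definition eps_scale :: "('k::zero \<Rightarrow> 'x::ab_group_add \<Rightarrow> 'x) \<Rightarrow> 'k fps \<Rightarrow> 'x fps \<Rightarrow> 'x fps" where
  "eps_scale s c x = eps_app (eps_app (fps_const s) c) x"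

definition star :: "('a \<Rightarrow> 'a \<Rightarrow> 'a) fps \<Rightarrow> 'a::comm_ring_1 fps \<Rightarrow> 'a fps \<Rightarrow> 'a fps" where
  "star \<alpha>X a b = a * b + eps_app (eps_app \<alpha>X a) b"

definition deformation_quantization ::
    "('k::field_char_0 \<Rightarrow> 'a::comm_ring_1) \<Rightarrow> ('a \<Rightarrow> 'a \<Rightarrow> 'a) \<Rightarrow> ('a \<Rightarrow> 'a \<Rightarrow> 'a) fps \<Rightarrow> bool" where
  "deformation_quantization \<iota> P \<alpha>X \<longleftrightarrow>
     \<alpha>X $ 0 = 0 \<and>
     (\<forall>i. bidiff_op \<iota> (\<alpha>X $ i)) \<and>
     (\<forall>a b. (\<alpha>X $ 1) a b = \<iota> (1/2) * P a b) \<and>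
     (\<forall>a b c. star \<alpha>X (star \<alpha>X a b) c = star \<alpha>X a (star \<alpha>X b c))"

text \<open>A closed subvariety is given by its radical ideal.\<close>

definition closed_subvariety :: "'a::comm_ring_1 set \<Rightarrow> bool" where
  "closed_subvariety I \<longleftrightarrow> module.subspace (*) I \<and> (\<forall>x n. x ^ n \<in> I \<longrightarrow> x \<in> I)"

definition prime_ideal :: "'a::comm_ring_1 set \<Rightarrow> bool" where
  "prime_ideal Q \<longleftrightarrow>
     module.subspace (*) Q \<and> 1 \<notin> Q \<and> (\<forall>x y. x * y \<in> Q \<longrightarrow> x \<in> Q \<or> y \<in> Q)"

text \<open>
  \<open>E_f\<close> is free of finite rank over \<open>(A/I)_f\<close>, with fractions cleared: a basis of \<open>E_f\<close> may be
  taken in the image of \<open>E\<close> because \<open>f\<close> is invertible.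
\<close>

definition free_on_basic_open ::
    "('a::comm_ring_1 \<Rightarrow> 'e::ab_group_add \<Rightarrow> 'e) \<Rightarrow> 'a set \<Rightarrow> 'a \<Rightarrow> bool" where
  "free_on_basic_open act I f \<longleftrightarrow>
     (\<exists>bs :: 'e list.
        (\<forall>e. \<exists>N c. act (f ^ N) e = (\<Sum>i<length bs. act (c i) (bs ! i))) \<and>
        (\<forall>c. (\<Sum>i<length bs. act (c i) (bs ! i)) = 0 \<longrightarrow>
             (\<forall>i<length bs. \<exists>N. f ^ N * c i \<in> I)))"

text \<open>A module over \<open>A\<close> that is supported on the subscheme of \<open>I\<close> and locally free of finite rank there.\<close>

definition vector_bundle_on ::
    "'a::comm_ring_1 set \<Rightarrow> ('a \<Rightarrow> 'e::ab_group_add \<Rightarrow> 'e) \<Rightarrow> bool" where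
  "vector_bundle_on I act \<longleftrightarrow>
     module act \<and>
     (\<forall>a\<in>I. \<forall>e. act a e = 0) \<and>
     (\<forall>Q. prime_ideal Q \<and> I \<subseteq> Q \<longrightarrow> (\<exists>f. f \<notin> Q \<and> free_on_basic_open act I f))"


section \<open>Curved dg Lie algebras\<close>

text \<open>
  A graded module is a family of submodules \<open>G n\<close> of an ambient module, graded by n \<open>\<ge>\<close> 0. The
  operations act on homogeneous elements and take the degrees of their arguments as parameters.
\<close>

locale graded_lie_algebra = module scale
  for scale :: "'r::comm_ring_1 \<Rightarrow> 'x::ab_group_add \<Rightarrow> 'x" +
  fixes G :: "nat \<Rightarrow> 'x set"
    and br :: "nat \<Rightarrow> nat \<Rightarrow> 'x \<Rightarrow> 'x \<Rightarrow> 'x"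
  assumes G_subspace: "subspace (G n)"
    and br_closed: "x \<in> G m \<Longrightarrow> y \<in> G n \<Longrightarrow> br m n x y \<in> G (m + n)"
    and br_add: "x \<in> G m \<Longrightarrow> x' \<in> G m \<Longrightarrow> y \<in> G n \<Longrightarrow> br m n (x + x') y = br m n x y + br m n x' y"
    and br_scale: "x \<in> G m \<Longrightarrow> y \<in> G n \<Longrightarrow> br m n (scale c x) y = scale c (br m n x y)"
    and br_antisym: "x \<in> G m \<Longrightarrow> y \<in> G n \<Longrightarrow> br m n x y = - scale ((- 1) ^ (m * n)) (br n m y x)"
    and br_jacobi: "x \<in> G m \<Longrightarrow> y \<in> G n \<Longrightarrow> z \<in> G p \<Longrightarrow>
      br m (n + p) x (br n p y z) =
        br (m + n) p (br m n x y) z + scale ((- 1) ^ (m * n)) (br n (m + p) y (br m p x z))"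

locale graded_lie_algebra_derivation = graded_lie_algebra scale G br
  for scale :: "'r::comm_ring_1 \<Rightarrow> 'x::ab_group_add \<Rightarrow> 'x"
    and G :: "nat \<Rightarrow> 'x set"
    and br :: "nat \<Rightarrow> nat \<Rightarrow> 'x \<Rightarrow> 'x \<Rightarrow> 'x" +
  fixes d :: "nat \<Rightarrow> 'x \<Rightarrow> 'x"
  assumes d_closed: "x \<in> G n \<Longrightarrow> d n x \<in> G (n + 1)"
    and d_add: "x \<in> G n \<Longrightarrow> y \<in> G n \<Longrightarrow> d n (x + y) = d n x + d n y"
    and d_scale: "x \<in> G n \<Longrightarrow> d n (scale c x) = scale c (d n x)"
    and d_derivation: "x \<in> G m \<Longrightarrow> y \<in> G n \<Longrightarrow>
      d (m + n) (br m n x y) = br (m + 1) n (d m x) y + scale ((- 1) ^ m) (br m (n + 1) x (d n y))"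

locale dg_lie_algebra = graded_lie_algebra_derivation scale G br d
  for scale :: "'r::comm_ring_1 \<Rightarrow> 'x::ab_group_add \<Rightarrow> 'x"
    and G :: "nat \<Rightarrow> 'x set"
    and br :: "nat \<Rightarrow> nat \<Rightarrow> 'x \<Rightarrow> 'x \<Rightarrow> 'x"
    and d :: "nat \<Rightarrow> 'x \<Rightarrow> 'x" +
  assumes d_squared: "x \<in> G n \<Longrightarrow> d (n + 1) (d n x) = 0"

locale curved_dg_lie_algebra = graded_lie_algebra_derivation scale G br d
  for scale :: "'r::comm_ring_1 \<Rightarrow> 'x::ab_group_add \<Rightarrow> 'x"
    and G :: "nat \<Rightarrow> 'x set"
    and br :: "nat \<Rightarrow> nat \<Rightarrow> 'x \<Rightarrow> 'x \<Rightarrow> 'x"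
    and d :: "nat \<Rightarrow> 'x \<Rightarrow> 'x" +
  fixes curv :: 'x
  assumes curv_degree: "curv \<in> G 2"
    and d_curv: "d 2 curv = 0"
    and d_squared_curv: "x \<in> G n \<Longrightarrow> d (n + 1) (d n x) = br 2 n curv x"


section \<open>The relative Hochschild complex\<close>

text \<open>
  A multilinear map on n elements of \<open>A\<close> and one of \<open>E\<close> is a function that takes the list of
  the n ring elements; it is normalised to vanish on lists of any other length.
\<close>

type_synonym ('a, 'e) cochain = "'a list \<Rightarrow> 'e \<Rightarrow> 'e"

definition cochains ::
    "('k::field_char_0 \<Rightarrow> 'a::comm_ring_1) \<Rightarrow> ('a \<Rightarrow> 'e::ab_group_add \<Rightarrow> 'e) \<Rightarrow> nat \<Rightarrow>
     ('a, 'e) cochain set" where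
  "cochains \<iota> act n =
     {\<alpha>. (\<forall>as e. length as \<noteq> n \<longrightarrow> \<alpha> as e = 0) \<and>
         (\<forall>as. length as = n \<longrightarrow> module_hom (k_on_E \<iota> act) (k_on_E \<iota> act) (\<lambda>e. \<alpha> as e)) \<and>
         (\<forall>as e i. length as = n \<and> i < n \<longrightarrow>
            module_hom (k_on_A \<iota>) (k_on_E \<iota> act) (\<lambda>x. \<alpha> (as[i := x]) e))}"

definition k_on_cochain ::
    "('k \<Rightarrow> 'a) \<Rightarrow> ('a \<Rightarrow> 'e \<Rightarrow> 'e) \<Rightarrow> 'k \<Rightarrow> ('a, 'e) cochain \<Rightarrow> ('a, 'e) cochain" where
  "k_on_cochain \<iota> act c \<alpha> = (\<lambda>as e. k_on_E \<iota> act c (\<alpha> as e))"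

text \<open>\<open>contract B j\<close> replaces the entries number j and j + 1 (counted from 1) by their \<open>B\<close>-product.\<close>

definition contract :: "('a \<Rightarrow> 'a \<Rightarrow> 'a) \<Rightarrow> nat \<Rightarrow> 'a list \<Rightarrow> 'a list" where
  "contract B j as = take (j - 1) as @ B (as ! (j - 1)) (as ! j) # drop (j + 1) as"

definition inner_sum ::
    "('k::field_char_0 \<Rightarrow> 'a::comm_ring_1) \<Rightarrow> ('a \<Rightarrow> 'e::ab_group_add \<Rightarrow> 'e) \<Rightarrow> nat \<Rightarrow>
     ('a \<Rightarrow> 'a \<Rightarrow> 'a) \<Rightarrow> ('a, 'e) cochain \<Rightarrow> ('a, 'e) cochain" where
  "inner_sum \<iota> act k B \<alpha> = (\<lambda>as e.
     if length as = k + 1 then \<Sum>j = 1..k. k_on_E \<iota> act ((- 1) ^ j) (\<alpha> (contract B j as) e) else 0)"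

definition d_Hoch ::
    "('k::field_char_0 \<Rightarrow> 'a::comm_ring_1) \<Rightarrow> ('a \<Rightarrow> 'e::ab_group_add \<Rightarrow> 'e) \<Rightarrow> nat \<Rightarrow>
     ('a, 'e) cochain \<Rightarrow> ('a, 'e) cochain" where
  "d_Hoch \<iota> act k \<alpha> = (\<lambda>as e.
     if length as = k + 1 then
       act (hd as) (\<alpha> (tl as) e)
       + inner_sum \<iota> act k (*) \<alpha> as e
       + k_on_E \<iota> act ((- 1) ^ (k + 1)) (\<alpha> (butlast as) (act (last as) e))
     else 0)"

definition circ ::
    "nat \<Rightarrow> nat \<Rightarrow> ('a, 'e::ab_group_add) cochain \<Rightarrow> ('a, 'e) cochain \<Rightarrow> ('a, 'e) cochain" where
  "circ k l \<alpha> \<beta> = (\<lambda>as e. if length as = k + l then \<alpha> (take k as) (\<beta> (drop k as) e) else 0)"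

definition gerst ::
    "('k::field_char_0 \<Rightarrow> 'a::comm_ring_1) \<Rightarrow> ('a \<Rightarrow> 'e::ab_group_add \<Rightarrow> 'e) \<Rightarrow> nat \<Rightarrow> nat \<Rightarrow>
     ('a, 'e) cochain \<Rightarrow> ('a, 'e) cochain \<Rightarrow> ('a, 'e) cochain" where
  "gerst \<iota> act k l \<alpha> \<beta> = circ k l \<alpha> \<beta> - k_on_cochain \<iota> act ((- 1) ^ (k * l)) (circ l k \<beta> \<alpha>)"

definition eps_cochains ::
    "('k::field_char_0 \<Rightarrow> 'a::comm_ring_1) \<Rightarrow> ('a \<Rightarrow> 'e::ab_group_add \<Rightarrow> 'e) \<Rightarrow> nat \<Rightarrow>
     ('a, 'e) cochain fps set" where
  "eps_cochains \<iota> act n = {\<alpha>. \<forall>i. \<alpha> $ i \<in> cochains \<iota> act n}"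

definition ell0 ::
    "('a \<Rightarrow> 'e::ab_group_add \<Rightarrow> 'e) \<Rightarrow> ('a \<Rightarrow> 'a \<Rightarrow> 'a::comm_ring_1) fps \<Rightarrow> ('a, 'e) cochain fps" where
  "ell0 act \<alpha>X = Abs_fps (\<lambda>i as e.
     if length as = 2 then - act ((\<alpha>X $ i) (as ! 0) (as ! 1)) e else 0)"

definition ell1 ::
    "('k::field_char_0 \<Rightarrow> 'a::comm_ring_1) \<Rightarrow> ('a \<Rightarrow> 'e::ab_group_add \<Rightarrow> 'e) \<Rightarrow>
     ('a \<Rightarrow> 'a \<Rightarrow> 'a) fps \<Rightarrow> nat \<Rightarrow> ('a, 'e) cochain fps \<Rightarrow> ('a, 'e) cochain fps" where
  "ell1 \<iota> act \<alpha>X k \<alpha> =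
     eps_app (fps_const (d_Hoch \<iota> act k)) \<alpha>
     + eps_app (eps_app (fps_const (inner_sum \<iota> act k)) \<alpha>X) \<alpha>"

definition ell2 ::
    "('k::field_char_0 \<Rightarrow> 'a::comm_ring_1) \<Rightarrow> ('a \<Rightarrow> 'e::ab_group_add \<Rightarrow> 'e) \<Rightarrow> nat \<Rightarrow> nat \<Rightarrow>
     ('a, 'e) cochain fps \<Rightarrow> ('a, 'e) cochain fps \<Rightarrow> ('a, 'e) cochain fps" where
  "ell2 \<iota> act k l \<alpha> \<beta> = eps_app (eps_app (fps_const (gerst \<iota> act k l)) \<alpha>) \<beta>"

definition maurer_cartan ::
    "('k::field_char_0 \<Rightarrow> 'a::comm_ring_1) \<Rightarrow> ('a \<Rightarrow> 'e::ab_group_add \<Rightarrow> 'e) \<Rightarrow>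
     ('a \<Rightarrow> 'a \<Rightarrow> 'a) fps \<Rightarrow> ('a, 'e) cochain fps \<Rightarrow> bool" where
  "maurer_cartan \<iota> act \<alpha>X \<alpha> \<longleftrightarrow>
     ell0 act \<alpha>X + ell1 \<iota> act \<alpha>X 1 \<alpha>
     + eps_scale (k_on_cochain \<iota> act) (fps_const (1/2)) (ell2 \<iota> act 1 1 \<alpha> \<alpha>) = 0"


section \<open>Module actions and gauge equivalence\<close>

definition module_action ::
    "('a::comm_ring_1 \<Rightarrow> 'e::ab_group_add \<Rightarrow> 'e) \<Rightarrow> ('a, 'e) cochain fps \<Rightarrow> 'a fps \<Rightarrow> 'e fps \<Rightarrow> 'e fps" where
  "module_action act \<alpha> a e =
     eps_app (eps_app (fps_const act) a) e
     + eps_app (eps_app (Abs_fps (\<lambda>i x. (\<alpha> $ i) [x])) a) e"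

text \<open>
  Unitality is not part of the definition. When the star product has the unit 1 it is automatic
  for the actions above: 1 acts idempotently and as the identity modulo \<open>\<epsilon>\<close>.
\<close>

definition assoc_module_action ::
    "('k::field_char_0 \<Rightarrow> 'a::comm_ring_1) \<Rightarrow> ('a \<Rightarrow> 'e::ab_group_add \<Rightarrow> 'e) \<Rightarrow>
     ('a \<Rightarrow> 'a \<Rightarrow> 'a) fps \<Rightarrow> ('a fps \<Rightarrow> 'e fps \<Rightarrow> 'e fps) \<Rightarrow> bool" where
  "assoc_module_action \<iota> act \<alpha>X m \<longleftrightarrow>
     (\<forall>a. module_hom (eps_scale (k_on_E \<iota> act)) (eps_scale (k_on_E \<iota> act)) (\<lambda>e. m a e)) \<and>
     (\<forall>e. module_hom (eps_scale (k_on_A \<iota>)) (eps_scale (k_on_E \<iota> act)) (\<lambda>a. m a e)) \<and>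
     (\<forall>a b e. m (star \<alpha>X a b) e = m a (m b e))"

definition gauge_equiv_actions ::
    "('k::field_char_0 \<Rightarrow> 'a::comm_ring_1) \<Rightarrow> ('a \<Rightarrow> 'e::ab_group_add \<Rightarrow> 'e) \<Rightarrow>
     ('a fps \<Rightarrow> 'e fps \<Rightarrow> 'e fps) \<Rightarrow> ('a fps \<Rightarrow> 'e fps \<Rightarrow> 'e fps) \<Rightarrow> bool" where
  "gauge_equiv_actions \<iota> act m m' \<longleftrightarrow>
     (\<exists>\<phi>. \<phi> \<in> eps_cochains \<iota> act 0 \<and> (\<forall>e. (\<phi> $ 0) [] e = e) \<and>
        (\<forall>a e. eps_app (Abs_fps (\<lambda>i. (\<phi> $ i) [])) (m a e)
             = m' a (eps_app (Abs_fps (\<lambda>i. (\<phi> $ i) [])) e)))"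

text \<open>
  Power series in \<open>\<epsilon>\<close> whose coefficients are polynomials in t with values in a k-vector space
  have type \<open>'x poly fps\<close>; the next two functions give the value and the t-derivative at a
  point t of k.
\<close>

definition value_at ::
    "('k::field_char_0 \<Rightarrow> 'x::ab_group_add \<Rightarrow> 'x) \<Rightarrow> 'x poly fps \<Rightarrow> 'k \<Rightarrow> 'x fps" where
  "value_at s p t = Abs_fps (\<lambda>i. \<Sum>j\<le>degree (p $ i). s (t ^ j) (coeff (p $ i) j))"

definition deriv_at ::
    "('k::field_char_0 \<Rightarrow> 'x::ab_group_add \<Rightarrow> 'x) \<Rightarrow> 'x poly fps \<Rightarrow> 'k \<Rightarrow> 'x fps" where
  "deriv_at s p t =
     Abs_fps (\<lambda>i. \<Sum>j = 1..degree (p $ i). s (of_nat j * t ^ (j - 1)) (coeff (p $ i) j))"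

text \<open>
  The gauge equation da/dt + \<open>\<ell>\<^sub>1\<close>(b) + \<open>\<ell>\<^sub>2\<close>(b, a) = 0 follows the
  L-infinity sign rule, in which the binary operation is graded symmetric after the degree shift:
  it is \<open>\<ell>\<^sub>2\<close> up to the sign \<open>(-1)^(|x|+1)\<close> on a first argument x, so that it agrees
  with \<open>\<ell>\<^sub>2\<close> on (a, a) and its value at (b, a) is \<open>\<ell>\<^sub>2(a, b) = - \<ell>\<^sub>2(b, a)\<close>
  in terms of the Gerstenhaber bracket. With the Gerstenhaber bracket in the order (b, a) the flow
  would not preserve the Maurer-Cartan equation.
\<close>

definition gauge_equiv_mc ::
    "('k::field_char_0 \<Rightarrow> 'a::comm_ring_1) \<Rightarrow> ('a \<Rightarrow> 'e::ab_group_add \<Rightarrow> 'e) \<Rightarrow>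
     ('a \<Rightarrow> 'a \<Rightarrow> 'a) fps \<Rightarrow> ('a, 'e) cochain fps \<Rightarrow> ('a, 'e) cochain fps \<Rightarrow> bool" where
  "gauge_equiv_mc \<iota> act \<alpha>X \<alpha> \<alpha>' \<longleftrightarrow>
     (\<exists>(a :: ('a, 'e) cochain poly fps) (b :: ('a, 'e) cochain poly fps).
        a $ 0 = 0 \<and> (\<forall>i j. coeff (a $ i) j \<in> cochains \<iota> act 1) \<and>
        b $ 0 = 0 \<and> (\<forall>i j. coeff (b $ i) j \<in> cochains \<iota> act 0) \<and>
        value_at (k_on_cochain \<iota> act) a 0 = \<alpha> \<and>
        value_at (k_on_cochain \<iota> act) a 1 = \<alpha>' \<and>
        (\<forall>t. maurer_cartan \<iota> act \<alpha>X (value_at (k_on_cochain \<iota> act) a t)) \<and>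
        (\<forall>t. deriv_at (k_on_cochain \<iota> act) a t
             + ell1 \<iota> act \<alpha>X 0 (value_at (k_on_cochain \<iota> act) b t)
             + ell2 \<iota> act 1 0 (value_at (k_on_cochain \<iota> act) a t)
                             (value_at (k_on_cochain \<iota> act) b t) = 0))"

end

(*
Cochains of all degrees form a convolution algebra, graded by the number of ring arguments. Let m
be the module structure of E, seen as a 1-cochain, and let D insert the star product into
consecutive arguments with alternating signs. D is a derivation, and D^2 = 0 is associativity of
the star product. Then l_1 = [m, -] + D and l_0(1) = m m + D m, so the curved dg Lie identities hold
in any graded associative algebra with such data. The Maurer-Cartan equation for alpha reads
M M + D M = 0 with M = m + alpha, which says that M is an associative action. Identities over
k[[epsilon]] reduce to coefficients, because an additive map that commutes with multiplication by
epsilon is determined by its values on constants.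

Gauge: a transformation phi from M to M' is joined to 1 by Phi(t) = 1 + t (phi - 1), and
M(t) = Phi M Phi^-1 flows along b = Phi' Phi^-1. Conversely, solve Phi' = b Phi with Phi(0) = 1 order
by order in epsilon; W = Phi M(0) - M(t) Phi satisfies W' = b W and W(0) = 0, and since b has no
constant term in epsilon, W = 0. At t = 1 this is the gauge equivalence of the actions.
*)
theory Submission
  imports Defs
begin

section \<open>Maps that commute with multiplication by \<open>\<epsilon>\<close>\<close>

text \<open>Two choices remove most of the index work. A cochain is any function of a list of
  arbitrary length that is additive in the module argument, and the product splits the list in all
  possible ways. This gives a type of class \<open>ring\<close>, whose noncommutative algebra the
  simplifier can do, and power series over it form a ring again. Degree and multilinearity are
  membership in the sets \<open>C n\<close>, which enter where signs, scalars or linearity in the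
  ring entries matter. Both series variables use the same type: a path is a power series in
  \<epsilon> whose coefficients are power series in t of finite support.

  The obstacle in the gauge part is that the definition quantifies over values t in k, while the
  flow argument needs identities of polynomials. The two agree because k has characteristic zero,
  which also permits integration in t. Polynomiality in t at each order survives inversion and
  integration because the order zero term is the constant unit for \<Phi> and zero for b, so each
  new coefficient is a finite expression in earlier ones.\<close>

text \<open>Multiplication by \<epsilon>, written without \<open>fps_X\<close> because the
  coefficients may be module elements or functions.\<close>

definition eps_shift :: "'x::zero fps \<Rightarrow> 'x fps" where
  "eps_shift x = Abs_fps (\<lambda>n. case n of 0 \<Rightarrow> 0 | Suc m \<Rightarrow> x $ m)"

lemma eps_shift_nth [simp]: "eps_shift x $ 0 = 0" "eps_shift x $ Suc n = x $ n"
  by (simp_all add: eps_shift_def)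

definition eps_linear :: "('x::ab_group_add fps \<Rightarrow> 'y::ab_group_add fps) \<Rightarrow> bool" where
  "eps_linear T \<longleftrightarrow> (\<forall>x y. T (x + y) = T x + T y) \<and> (\<forall>x. T (eps_shift x) = eps_shift (T x))"

lemma fps_eq_const_plus_shift: "x = fps_const (x $ 0) + eps_shift (fps_shift 1 x)"
  for x :: "'x::ab_group_add fps"
proof (rule fps_ext)
  fix n show "x $ n = (fps_const (x $ 0) + eps_shift (fps_shift 1 x)) $ n"
    by (cases n) auto
qed

text \<open>No continuity is required: after the constant term is split off, the rest is a multiple
  of \<epsilon>, whose image enters coefficient n + 1 only through coefficient n of the image of the
  shifted series. Identities in several variables follow by freeing one variable at a time.\<close>

lemma eps_linear_eqI:
  assumes T: "eps_linear T" and T': "eps_linear T'"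
    and eq: "\<And>i. T (fps_const (x $ i)) = T' (fps_const (x $ i))"
  shows "T x = T' x"
proof (rule fps_ext)
  fix n
  show "T x $ n = T' x $ n" using eq
  proof (induction n arbitrary: x)
    case (0 x)
    have "S x $ 0 = S (fps_const (x $ 0)) $ 0" if "eps_linear S" for S :: "'a fps \<Rightarrow> 'b fps"
      using that unfolding eps_linear_def
      by (subst fps_eq_const_plus_shift) simp
    with 0 T T' show ?case by metis
  next
    case (Suc n x)
    have "S x $ Suc n = S (fps_const (x $ 0)) $ Suc n + S (fps_shift 1 x) $ n"
      if "eps_linear S" for S :: "'a fps \<Rightarrow> 'b fps"
      using that unfolding eps_linear_def
      by (subst fps_eq_const_plus_shift) simp
    moreover have "T (fps_shift 1 x) $ n = T' (fps_shift 1 x) $ n"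
      by (rule Suc.IH) (simp add: Suc.prems)
    ultimately show ?case using Suc.prems T T' by metis
  qed
qed

lemma eps_linear_id: "eps_linear (\<lambda>x. x)"
  by (simp add: eps_linear_def)

lemma eps_linear_compose: "eps_linear S \<Longrightarrow> eps_linear T \<Longrightarrow> eps_linear (\<lambda>x. S (T x))"
  by (simp add: eps_linear_def)

lemma eps_shift_add: "eps_shift (x + y) = eps_shift x + eps_shift y"
  for x :: "'x::ab_group_add fps"
proof (rule fps_ext)
  fix n show "eps_shift (x + y) $ n = (eps_shift x + eps_shift y) $ n" by (cases n) auto
qed

lemma eps_linear_add: "eps_linear S \<Longrightarrow> eps_linear T \<Longrightarrow> eps_linear (\<lambda>x. S x + T x)"
  by (simp add: eps_linear_def eps_shift_add)

lemma eps_linear_zero: "eps_linear (\<lambda>x. 0)"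
proof -
  have "eps_shift (0 :: 'b fps) $ n = 0" for n by (cases n) auto
  then show ?thesis by (auto simp: eps_linear_def intro!: fps_ext)
qed

section \<open>Extension of additive and biadditive maps to power series in \<epsilon>\<close>

lemma sum_fun_apply: "(\<Sum>i\<in>S. f i) x = (\<Sum>i\<in>S. f i x)"
  for f :: "'i \<Rightarrow> 'b \<Rightarrow> 'c::ab_group_add"
  by (induction S rule: infinite_finite_induct) auto

definition additive_map :: "('x::ab_group_add \<Rightarrow> 'y::ab_group_add) \<Rightarrow> bool" where
  "additive_map f \<longleftrightarrow> (\<forall>x y. f (x + y) = f x + f y)"

lemma additive_map_zero: "additive_map f \<Longrightarrow> f 0 = 0"
  unfolding additive_map_def by (metis add_cancel_right_right)

lemma additive_map_minus:
  assumes "additive_map f"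
  shows "f (- x) = - f x"
proof -
  have "f (x + - x) = f x + f (- x)" using assms unfolding additive_map_def by blast
  then show ?thesis using additive_map_zero[OF assms] by (simp add: add_eq_0_iff)
qed

lemma additive_map_diff:
  assumes "additive_map f"
  shows "f (x - y) = f x - f y"
proof -
  have "f (x + - y) = f x + f (- y)" using assms unfolding additive_map_def by blast
  then show ?thesis using additive_map_minus[OF assms] by simp
qed

lemma additive_map_sum: "additive_map f \<Longrightarrow> f (\<Sum>i\<in>S. g i) = (\<Sum>i\<in>S. f (g i))"
  by (induction S rule: infinite_finite_induct) (auto simp: additive_map_zero additive_map_def)

lemma eps_app_nth: "eps_app F x $ n = (\<Sum>i\<le>n. (F $ i) (x $ (n - i)))"
  by (simp add: eps_app_def)

lemma sum_atMost_rev: "(\<Sum>i\<le>n. f i (n - i)) = (\<Sum>i\<le>n. f (n - i) i)"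
  for f :: "nat \<Rightarrow> nat \<Rightarrow> 'x::comm_monoid_add"
  by (rule sum.reindex_bij_witness[where i="(-) n" and j="(-) n"]) auto

lemma eps_app_const_right:
  assumes "\<And>i. additive_map (F $ i)"
  shows "eps_app F (fps_const c) = Abs_fps (\<lambda>n. (F $ n) c)"
proof (rule fps_ext)
  fix n
  have "eps_app F (fps_const c) $ n = (\<Sum>i\<le>n. if i = n then (F $ n) c else 0)"
    unfolding eps_app_nth using assms
    by (intro sum.cong) (auto simp: additive_map_zero)
  then show "eps_app F (fps_const c) $ n = Abs_fps (\<lambda>n. (F $ n) c) $ n" by simp
qed

lemma eps_app_const_left:
  fixes f :: "'x::zero \<Rightarrow> 'y::ab_group_add"
  shows "eps_app (fps_const f) x = Abs_fps (\<lambda>n. f (x $ n))"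
proof (rule fps_ext)
  fix n
  have "eps_app (fps_const f) x $ n = (\<Sum>i\<le>n. if i = 0 then f (x $ n) else 0)"
    unfolding eps_app_nth by (intro sum.cong) auto
  then show "eps_app (fps_const f) x $ n = Abs_fps (\<lambda>n. f (x $ n)) $ n" by simp
qed

lemma eps_app_const2_nth:
  fixes f :: "'x::zero \<Rightarrow> 'z::zero \<Rightarrow> 'y::ab_group_add"
  shows "eps_app (eps_app (fps_const f) x) y $ n = (\<Sum>i\<le>n. f (x $ i) (y $ (n - i)))"
  by (simp add: eps_app_const_left eps_app_nth)

lemma eps_app_add_left:
  fixes F G :: "('x::zero \<Rightarrow> 'y::ab_group_add) fps"
  shows "eps_app (F + G) x = eps_app F x + eps_app G x"
  by (rule fps_ext) (simp add: eps_app_nth sum.distrib)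

lemma eps_app_shift_left:
  fixes F :: "('x::zero \<Rightarrow> 'y::ab_group_add) fps"
  shows "eps_app (eps_shift F) x = eps_shift (eps_app F x)"
proof (rule fps_ext)
  fix n show "eps_app (eps_shift F) x $ n = eps_shift (eps_app F x) $ n"
    by (cases n) (simp_all add: eps_app_nth sum.atMost_Suc_shift del: sum.atMost_Suc)
qed

lemma eps_linear_eps_app_left: "eps_linear (\<lambda>F. eps_app F x)"
  by (simp add: eps_linear_def eps_app_add_left eps_app_shift_left)

lemma eps_linear_eps_app:
  assumes "\<And>i. additive_map (F $ i)"
  shows "eps_linear (eps_app F)"
  unfolding eps_linear_def
proof safe
  fix x y show "eps_app F (x + y) = eps_app F x + eps_app F y"
    using assms by (intro fps_ext) (simp add: eps_app_nth additive_map_def sum.distrib)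
next
  fix x show "eps_app F (eps_shift x) = eps_shift (eps_app F x)"
  proof (rule fps_ext)
    fix n show "eps_app F (eps_shift x) $ n = eps_shift (eps_app F x) $ n"
    proof (cases n)
      case 0
      then show ?thesis using assms by (simp add: eps_app_nth additive_map_zero)
    next
      case (Suc m)
      have "eps_app F (eps_shift x) $ n = (\<Sum>i\<le>m. (F $ i) (eps_shift x $ (Suc m - i)))"
        using assms by (simp add: Suc eps_app_nth additive_map_zero)
      also have "\<dots> = (\<Sum>i\<le>m. (F $ i) (x $ (m - i)))"
        by (intro sum.cong) (auto simp: Suc_diff_le)
      finally show ?thesis by (simp add: Suc eps_app_nth)
    qed
  qed
qed

text \<open>Additivity in the first slot is that of f as a map into functions, so that
  \<open>eps_app F x\<close>, a series of functions, can again be applied by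
  \<open>eps_app\<close>.\<close>

definition biadditive :: "('x::ab_group_add \<Rightarrow> 'y::ab_group_add \<Rightarrow> 'z::ab_group_add) \<Rightarrow> bool" where
  "biadditive f \<longleftrightarrow> additive_map f \<and> (\<forall>x. additive_map (f x))"

lemma eps_linear_bi_left:
  assumes "\<And>i. biadditive (F $ i)"
  shows "eps_linear (\<lambda>x. eps_app (eps_app F x) y)"
  by (rule eps_linear_compose[OF eps_linear_eps_app_left eps_linear_eps_app])
    (use assms in \<open>simp add: biadditive_def\<close>)

lemma eps_linear_bi_right:
  assumes "\<And>i. biadditive (F $ i)"
  shows "eps_linear (\<lambda>y. eps_app (eps_app F x) y)"
proof (rule eps_linear_eps_app)
  fix i
  have "additive_map ((F $ j) z)" for j z using assms by (simp add: biadditive_def)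
  then show "additive_map (eps_app F x $ i)"
    by (simp add: additive_map_def eps_app_nth sum_fun_apply sum.distrib)
qed

lemma eps_app_bi_const:
  assumes "\<And>i. biadditive (F $ i)"
  shows "eps_app (eps_app F (fps_const x)) (fps_const y) = Abs_fps (\<lambda>n. (F $ n) x y)"
  using assms
  by (subst (1 2) eps_app_const_right) (auto simp: biadditive_def additive_map_def eps_app_const_right)

lemma biadditive_zero: "biadditive 0"
  by (simp add: biadditive_def additive_map_def fun_eq_iff)

lemma biadditive_module: "module s \<Longrightarrow> biadditive s"
  by (auto simp: biadditive_def additive_map_def module_def fun_eq_iff)

lemma eps_linear_mult_left: "eps_linear (\<lambda>x. x * y)"
  and eps_linear_mult_right: "eps_linear (\<lambda>x. y * x)" for y :: "'x::ring fps"
proof -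
  have 1: "eps_app (eps_app (fps_const (*)) x) z = x * z" for x z :: "'x fps"
    by (intro fps_ext) (simp add: eps_app_const2_nth fps_mult_nth atLeast0AtMost)
  have bi: "\<And>i. biadditive (fps_const ((*) :: 'x \<Rightarrow> 'x \<Rightarrow> 'x) $ i)"
    by (auto simp: biadditive_zero biadditive_def additive_map_def fun_eq_iff algebra_simps)
  show "eps_linear (\<lambda>x. x * y)" "eps_linear (\<lambda>x. y * x)"
    using eps_linear_bi_left[OF bi] eps_linear_bi_right[OF bi] by (simp_all add: 1)
qed

lemma biadditive_fps_const: "biadditive f \<Longrightarrow> biadditive (fps_const f $ i)"
  by (simp add: biadditive_zero)

section \<open>Scalars that are power series in \<epsilon>\<close>

lemma eps_scale_nth: "eps_scale s c x $ n = (\<Sum>i\<le>n. s (c $ i) (x $ (n - i)))"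
  by (simp add: eps_scale_def eps_app_const2_nth)

lemma eps_linear_eps_scale:
  assumes "module s"
  shows "eps_linear (\<lambda>c. eps_scale s c x)" and "eps_linear (\<lambda>x. eps_scale s c x)"
  unfolding eps_scale_def using biadditive_fps_const[OF biadditive_module[OF assms]]
  by (auto intro!: eps_linear_bi_left eps_linear_bi_right)

lemma eps_scale_const_const:
  assumes "module s"
  shows "eps_scale s (fps_const c) (fps_const x) = fps_const (s c x)"
  unfolding eps_scale_def using biadditive_fps_const[OF biadditive_module[OF assms]]
  by (subst eps_app_bi_const) (auto intro!: fps_ext)

lemma module_eps_scale:
  assumes s: "module s"
  shows "module (eps_scale s)"
proof
  interpret s: module s by (fact s)
  note lin = eps_linear_eps_scale[OF s]
  fix a b :: "'a fps" and x y :: "'b fps"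
  show "eps_scale s a (x + y) = eps_scale s a x + eps_scale s a y"
    using lin(2) by (simp add: eps_linear_def)
  show "eps_scale s (a + b) x = eps_scale s a x + eps_scale s b x"
    using lin(1) by (simp add: eps_linear_def)
  show "eps_scale s 1 x = x"
  proof (rule eps_linear_eqI[OF lin(2) eps_linear_id])
    fix i show "eps_scale s 1 (fps_const (x $ i)) = fps_const (x $ i)"
      using eps_scale_const_const[OF s, of 1] by simp
  qed
  \<comment> \<open>The associativity law is linear in three series. They are freed from being
    constants in the order b, x, a.\<close>
  have 1: "eps_scale s (fps_const c) (eps_scale s b (fps_const z)) = eps_scale s (fps_const c * b) (fps_const z)"
    for c z
    by (rule eps_linear_eqI[where x = b])
      (auto intro: eps_linear_compose[OF lin(2) lin(1)] eps_linear_compose[OF lin(1) eps_linear_mult_right]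
        simp: eps_scale_const_const[OF s])
  have 2: "eps_scale s (fps_const c) (eps_scale s b x) = eps_scale s (fps_const c * b) x" for c
    by (rule eps_linear_eqI[where x = x]) (auto intro: eps_linear_compose lin simp: 1)
  show "eps_scale s a (eps_scale s b x) = eps_scale s (a * b) x"
    by (rule eps_linear_eqI[where x = a])
      (auto intro: lin eps_linear_compose[OF lin(1) eps_linear_mult_left] simp: 2)
qed

section \<open>The convolution ring of cochains\<close>

text \<open>Unfolded, this is the sum over all splittings \<open>as = bs @ cs\<close> of
  \<open>\<alpha> bs (\<beta> cs e)\<close>. The recursion moves the head of the list into the left
  block, so inductions generalise over \<alpha> and apply the hypothesis to the curried
  cochain.\<close>

primrec convolve :: "('a, 'e::ab_group_add) cochain \<Rightarrow> ('a, 'e) cochain \<Rightarrow> 'a list \<Rightarrow> 'e \<Rightarrow> 'e" where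
  "convolve \<alpha> \<beta> [] = (\<lambda>e. \<alpha> [] (\<beta> [] e))"
| "convolve \<alpha> \<beta> (x # as) = (\<lambda>e. \<alpha> [] (\<beta> (x # as) e) + convolve (\<lambda>bs. \<alpha> (x # bs)) \<beta> as e)"

text \<open>Unfolded, this is the sum over j of (-1)^j times \<alpha> at
  \<open>contract B j as\<close>. The minus sign before the recursive call records that a
  contraction in the tail sits one place further right.\<close>

fun inner_alternating :: "('a \<Rightarrow> 'a \<Rightarrow> 'a) \<Rightarrow> ('a, 'e::ab_group_add) cochain \<Rightarrow> ('a, 'e) cochain" where
  "inner_alternating B \<alpha> (x # y # as) =
     (\<lambda>e. - \<alpha> (B x y # as) e - inner_alternating B (\<lambda>bs. \<alpha> (x # bs)) (y # as) e)"
| "inner_alternating B \<alpha> as = (\<lambda>e. 0)"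

lemma convolve_add_left:
  "convolve (\<lambda>as e. \<alpha> as e + \<alpha>' as e) \<beta> as e = convolve \<alpha> \<beta> as e + convolve \<alpha>' \<beta> as e"
  by (induction as arbitrary: \<alpha> \<alpha>') simp_all

lemma convolve_add_right:
  assumes "\<And>as. additive_map (\<alpha> as)"
  shows "convolve \<alpha> (\<lambda>as e. \<beta> as e + \<beta>' as e) as e = convolve \<alpha> \<beta> as e + convolve \<alpha> \<beta>' as e"
  using assms by (induction as arbitrary: \<alpha>) (simp_all add: additive_map_def)

lemma additive_convolve:
  assumes "\<And>as. additive_map (\<alpha> as)" and "\<And>as. additive_map (\<beta> as)"
  shows "additive_map (convolve \<alpha> \<beta> as)"
  using assms by (induction as arbitrary: \<alpha>) (simp_all add: additive_map_def)

lemma convolve_additive_left: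
  assumes "additive_map f"
  shows "convolve (\<lambda>bs e. f (\<beta> bs e)) \<gamma> as e = f (convolve \<beta> \<gamma> as e)"
  using assms by (induction as arbitrary: \<beta>) (simp_all add: additive_map_def)

text \<open>Both sides run over the splittings of the list into three blocks. Additivity of \<alpha>
  lets \<open>\<alpha> []\<close> pass through the inner sum.\<close>

lemma convolve_assoc:
  assumes "\<And>as. additive_map (\<alpha> as)"
  shows "convolve (convolve \<alpha> \<beta>) \<gamma> as e = convolve \<alpha> (convolve \<beta> \<gamma>) as e"
  using assms
proof (induction as arbitrary: \<alpha> e)
  case Nil
  then show ?case by simp
next
  case (Cons x as)
  have "convolve (\<lambda>bs. convolve \<alpha> \<beta> (x # bs)) \<gamma> as e =
      \<alpha> [] (convolve (\<lambda>bs. \<beta> (x # bs)) \<gamma> as e) + convolve (convolve (\<lambda>bs. \<alpha> (x # bs)) \<beta>) \<gamma> as e"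
    using convolve_additive_left[of "\<alpha> []" "\<lambda>bs. \<beta> (x # bs)"] Cons.prems
    by (simp add: convolve_add_left)
  also have "convolve (convolve (\<lambda>bs. \<alpha> (x # bs)) \<beta>) \<gamma> as e =
      convolve (\<lambda>bs. \<alpha> (x # bs)) (convolve \<beta> \<gamma>) as e"
    using Cons.prems by (intro Cons.IH)
  finally show ?case
    using Cons.prems[of "[]"] by (simp add: additive_map_def)
qed

text \<open>If \<alpha> lives on lists of length k, a single splitting survives. This is how the
  composition \<open>circ\<close> appears as the ring product.\<close>

lemma convolve_homogeneous:
  assumes "\<And>as e. length as \<noteq> k \<Longrightarrow> \<alpha> as e = 0"
  shows "convolve \<alpha> \<beta> as e = (if k \<le> length as then \<alpha> (take k as) (\<beta> (drop k as) e) else 0)"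
  using assms
proof (induction as arbitrary: \<alpha> k)
  case Nil
  then show ?case by simp
next
  case (Cons x as)
  show ?case
  proof (cases k)
    case 0
    have "convolve (\<lambda>bs. \<alpha> (x # bs)) \<beta> as e = 0"
      \<comment> \<open>For k = 0 the curried cochain vanishes identically, so it may be assigned
        any degree; one above the length of \<open>as\<close> selects the zero branch.\<close>
      by (subst Cons.IH[where k = "Suc (length as)"]) (use Cons.prems 0 in auto)
    with 0 show ?thesis by simp
  next
    case (Suc l)
    have "convolve (\<lambda>bs. \<alpha> (x # bs)) \<beta> as e =
        (if l \<le> length as then \<alpha> (x # take l as) (\<beta> (drop l as) e) else 0)"
      by (rule Cons.IH) (use Cons.prems Suc in auto)
    with Suc Cons.prems[of "[]"] show ?thesis by simp
  qed
qed

lemma inner_alternating_degree_0: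
  assumes "\<And>x bs e. \<alpha> (x # bs) e = 0"
  shows "inner_alternating B \<alpha> as e = 0"
  using assms by (induction B \<alpha> as rule: inner_alternating.induct) simp_all

lemma inner_alternating_add:
  "inner_alternating B (\<lambda>as e. \<alpha> as e + \<beta> as e) as e =
   inner_alternating B \<alpha> as e + inner_alternating B \<beta> as e"
  by (induction B \<alpha> as arbitrary: \<beta> rule: inner_alternating.induct) simp_all

lemma inner_alternating_minus:
  "inner_alternating B (\<lambda>as e. - \<alpha> as e) as e = - inner_alternating B \<alpha> as e"
  by (induction B \<alpha> as rule: inner_alternating.induct) simp_all

lemma inner_alternating_diff:
  "inner_alternating B (\<lambda>as e. \<alpha> as e - \<beta> as e) as e =
   inner_alternating B \<alpha> as e - inner_alternating B \<beta> as e"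
  using inner_alternating_add[of B \<alpha> "\<lambda>as e. - \<beta> as e"] by (simp add: inner_alternating_minus)

lemma additive_inner_alternating:
  assumes "\<And>as. additive_map (\<alpha> as)"
  shows "additive_map (inner_alternating B \<alpha> as)"
  using assms
  by (induction B \<alpha> as rule: inner_alternating.induct) (simp_all add: additive_map_def)

lemma inner_alternating_additive_left:
  assumes "additive_map f"
  shows "inner_alternating B (\<lambda>bs e. f (\<alpha> bs e)) as e = f (inner_alternating B \<alpha> as e)"
  by (induction B \<alpha> as rule: inner_alternating.induct)
    (simp_all add: additive_map_minus[OF assms] additive_map_diff[OF assms] additive_map_zero[OF assms])

text \<open>One step of the recursion for a product of two contraction operators, with two different
  B so that they can be coefficients of a star product. The first line is an associator, the second
  collects disjoint contractions, and the last term is left to induction.\<close>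

lemma inner_alternating_square:
  "inner_alternating B (inner_alternating B' \<alpha>) (x # y # z # as) e =
     \<alpha> (B' (B x y) z # as) e - \<alpha> (B' x (B y z) # as) e
     + inner_alternating B' (\<lambda>bs. \<alpha> (B x y # bs)) (z # as) e
     - inner_alternating B (\<lambda>bs. \<alpha> (B' x y # bs)) (z # as) e
     + inner_alternating B (inner_alternating B' (\<lambda>bs. \<alpha> (x # bs))) (y # z # as) e"
  by (simp add: inner_alternating_diff inner_alternating_minus)

text \<open>A contracted entry falls either into the left or into the right block of a splitting; in
  the second case the contraction has moved past the left block, whence the sign by the parity of
  its length.\<close>

lemma inner_alternating_convolve:
  assumes "\<And>as. additive_map (\<alpha> as)"
  shows "inner_alternating B (convolve \<alpha> \<beta>) as e =
    convolve (inner_alternating B \<alpha>) \<beta> as e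
    + convolve (\<lambda>bs e. if even (length bs) then \<alpha> bs e else - \<alpha> bs e) (inner_alternating B \<beta>) as e"
  using assms
proof (induction as arbitrary: \<alpha> e rule: induct_list012)
  case 1
  then show ?case by (simp add: additive_map_zero)
next
  case (2 x)
  then show ?case by (simp add: additive_map_zero)
next
  case (3 x y as)
  let ?t = "\<lambda>\<alpha> bs e. if even (length bs) then \<alpha> bs e else - \<alpha> bs e"
  have neg: "convolve (\<lambda>bs e. - \<gamma> bs e) \<delta> cs u = - convolve \<gamma> \<delta> cs u" for \<gamma> \<delta> :: "('a, 'b) cochain" and cs u
    by (induction cs arbitrary: \<gamma>) simp_all
  have IH: "inner_alternating B (convolve (\<lambda>bs. \<alpha> (x # bs)) \<beta>) (y # as) e =
      convolve (inner_alternating B (\<lambda>bs. \<alpha> (x # bs))) \<beta> (y # as) e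
      + convolve (?t (\<lambda>bs. \<alpha> (x # bs))) (inner_alternating B \<beta>) (y # as) e"
    using 3(3) by (intro 3(2))
  \<comment> \<open>Currying shortens the left block by one and therefore flips its parity
    sign.\<close>
  have t: "convolve (\<lambda>bs. ?t \<alpha> (x # bs)) \<gamma> cs u = - convolve (?t (\<lambda>bs. \<alpha> (x # bs))) \<gamma> cs u"
    for \<gamma> cs u
  proof -
    have "(\<lambda>bs. ?t \<alpha> (x # bs)) = (\<lambda>bs e. - ?t (\<lambda>bs. \<alpha> (x # bs)) bs e)"
      by (auto simp: fun_eq_iff)
    then show ?thesis by (simp only: neg)
  qed
  have "inner_alternating B (convolve \<alpha> \<beta>) (x # y # as) e =
      - \<alpha> [] (\<beta> (B x y # as) e) - convolve (\<lambda>bs. \<alpha> (B x y # bs)) \<beta> as e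
      - \<alpha> [] (inner_alternating B (\<lambda>bs. \<beta> (x # bs)) (y # as) e)
      - inner_alternating B (convolve (\<lambda>bs. \<alpha> (x # bs)) \<beta>) (y # as) e"
    using 3(3)[of "[]"] inner_alternating_additive_left[of "\<alpha> []" B "\<lambda>bs. \<beta> (x # bs)"]
    by (simp add: inner_alternating_add)
  moreover have "convolve (inner_alternating B \<alpha>) \<beta> (x # y # as) e =
      - convolve (\<lambda>bs. \<alpha> (B x y # bs)) \<beta> as e
      - convolve (inner_alternating B (\<lambda>bs. \<alpha> (x # bs))) \<beta> (y # as) e"
    using convolve_add_left[of "\<lambda>bs e. - \<alpha> (B x y # bs) e"
        "\<lambda>bs e. - inner_alternating B (\<lambda>bs. \<alpha> (x # bs)) (y # bs) e" \<beta> as e]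
    by (simp add: neg)
  moreover have "convolve (?t \<alpha>) (inner_alternating B \<beta>) (x # y # as) e =
      - \<alpha> [] (\<beta> (B x y # as) e) - \<alpha> [] (inner_alternating B (\<lambda>bs. \<beta> (x # bs)) (y # as) e)
      - convolve (?t (\<lambda>bs. \<alpha> (x # bs))) (inner_alternating B \<beta>) (y # as) e"
    using t[of "inner_alternating B \<beta>" "y # as" e] 3(3)[of "[]"]
    by (simp del: convolve.simps(2) add: convolve.simps(2)[of "?t \<alpha>"] additive_map_diff additive_map_minus)
  ultimately show ?case using IH by (simp del: convolve.simps inner_alternating.simps)
qed

text \<open>Additivity in the module argument is what distributivity and associativity of
  \<open>convolve\<close> ask for. No degree or linearity in the ring entries is imposed, so the
  type is closed under all operations without side conditions.\<close>

typedef (overloaded) ('a, 'e) cochain_ring =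
  "{\<alpha> :: ('a, 'e::ab_group_add) cochain. \<forall>as. additive_map (\<alpha> as)}"
  morphisms app Abs_cochain_ring
  by (rule exI[of _ "\<lambda>as e. 0"]) (simp add: additive_map_def)

setup_lifting type_definition_cochain_ring

lemma additive_app: "additive_map (app x as)"
  using app[of x] by simp

lemma app_Abs: "(\<And>as. additive_map (\<alpha> as)) \<Longrightarrow> app (Abs_cochain_ring \<alpha>) = \<alpha>"
  by (simp add: Abs_cochain_ring_inverse)

instantiation cochain_ring :: (type, ab_group_add) ring
begin

lift_definition zero_cochain_ring :: "('a, 'b) cochain_ring" is "\<lambda>as e. 0"
  by (simp add: additive_map_def)

lift_definition plus_cochain_ring ::
  "('a, 'b) cochain_ring \<Rightarrow> ('a, 'b) cochain_ring \<Rightarrow> ('a, 'b) cochain_ring"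
  is "\<lambda>\<alpha> \<beta> as e. \<alpha> as e + \<beta> as e"
  by (simp add: additive_map_def)

lift_definition uminus_cochain_ring :: "('a, 'b) cochain_ring \<Rightarrow> ('a, 'b) cochain_ring"
  is "\<lambda>\<alpha> as e. - \<alpha> as e"
  by (simp add: additive_map_def)

lift_definition minus_cochain_ring ::
  "('a, 'b) cochain_ring \<Rightarrow> ('a, 'b) cochain_ring \<Rightarrow> ('a, 'b) cochain_ring"
  is "\<lambda>\<alpha> \<beta> as e. \<alpha> as e - \<beta> as e"
  by (simp add: additive_map_def)

lift_definition times_cochain_ring ::
  "('a, 'b) cochain_ring \<Rightarrow> ('a, 'b) cochain_ring \<Rightarrow> ('a, 'b) cochain_ring"
  is convolve
  by (simp add: additive_convolve)

instance
proof
  fix a b c :: "('a, 'b) cochain_ring"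
  show "a * b * c = a * (b * c)"
    by transfer (simp add: convolve_assoc fun_eq_iff)
  show "(a + b) * c = a * c + b * c"
    by transfer (simp add: convolve_add_left fun_eq_iff)
  show "a * (b + c) = a * b + a * c"
    by transfer (simp add: convolve_add_right fun_eq_iff)
qed (transfer; simp add: fun_eq_iff)+

end

lemma cochain_ring_eqI: "(\<And>as e. app x as e = app y as e) \<Longrightarrow> x = y"
  by transfer (simp add: fun_eq_iff)

lemma app_simps [simp]:
  "app 0 as e = 0" "app (x + y) as e = app x as e + app y as e"
  "app (- x) as e = - app x as e" "app (x - y) as e = app x as e - app y as e"
  "app x as 0 = 0"
  by (transfer; simp add: additive_map_zero)+

lemma app_add_arg: "app x as (e + f) = app x as e + app x as f"
  using additive_app unfolding additive_map_def by blast

lemma app_sum: "app (\<Sum>i\<in>S. f i) as e = (\<Sum>i\<in>S. app (f i) as e)"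
  by (induction S rule: infinite_finite_induct) simp_all

lemma app_times: "app (x * y) = convolve (app x) (app y)"
  by transfer simp

lift_definition inner_op :: "('a \<Rightarrow> 'a \<Rightarrow> 'a) \<Rightarrow> ('a, 'e::ab_group_add) cochain_ring \<Rightarrow> ('a, 'e) cochain_ring"
  is inner_alternating
  by (simp add: additive_inner_alternating)

text \<open>The parity automorphism by length of the list: with it the Leibniz rule for contractions
  holds for inhomogeneous elements.\<close>

lift_definition grading :: "('a, 'e::ab_group_add) cochain_ring \<Rightarrow> ('a, 'e) cochain_ring"
  is "\<lambda>\<alpha> as e. if even (length as) then \<alpha> as e else - \<alpha> as e"
  by (simp add: additive_map_def)

lemma inner_op_times: "inner_op B (x * y) = inner_op B x * y + grading x * inner_op B y"
  by transfer (simp add: inner_alternating_convolve fun_eq_iff)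

lemma additive_inner_op: "additive_map (inner_op B)"
  unfolding additive_map_def by transfer (simp add: inner_alternating_add fun_eq_iff)

section \<open>Multilinear cochains inside the convolution ring\<close>

locale relative_cochains =
  fixes \<iota> :: "'k::field_char_0 \<Rightarrow> 'a::comm_ring_1" and act :: "'a \<Rightarrow> 'e::ab_group_add \<Rightarrow> 'e"
  assumes \<iota>_one: "\<iota> 1 = 1"
    and \<iota>_add: "\<iota> (c + d) = \<iota> c + \<iota> d"
    and \<iota>_mult: "\<iota> (c * d) = \<iota> c * \<iota> d"
    and module_act: "module act"
begin

sublocale act: module act by (fact module_act)

lemma module_k_on_A: "module (k_on_A \<iota>)"
  by standard (auto simp: k_on_A_def \<iota>_one \<iota>_add \<iota>_mult algebra_simps)

lemma module_k_on_E: "module (k_on_E \<iota> act)"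
  by standard (auto simp: k_on_E_def \<iota>_one \<iota>_add \<iota>_mult act.scale_right_distrib act.scale_left_distrib)

lemma module_k_on_cochain: "module (k_on_cochain \<iota> act)"
proof -
  interpret E: module "k_on_E \<iota> act" by (rule module_k_on_E)
  show ?thesis
    by standard
      (auto simp: k_on_cochain_def fun_eq_iff E.scale_right_distrib E.scale_left_distrib)
qed

sublocale kE: module "k_on_E \<iota> act" by (rule module_k_on_E)
sublocale kA: module "k_on_A \<iota>" by (rule module_k_on_A)

abbreviation hom_E :: "('e \<Rightarrow> 'e) \<Rightarrow> bool" where
  "hom_E \<equiv> module_hom (k_on_E \<iota> act) (k_on_E \<iota> act)"

abbreviation hom_AE :: "('a \<Rightarrow> 'e) \<Rightarrow> bool" where
  "hom_AE \<equiv> module_hom (k_on_A \<iota>) (k_on_E \<iota> act)"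

lemma hom_AE_iff: "hom_AE f \<longleftrightarrow> (\<forall>x y. f (x + y) = f x + f y) \<and> (\<forall>c x. f (k_on_A \<iota> c x) = k_on_E \<iota> act c (f x))"
  by (simp add: module_hom_iff module_k_on_A module_k_on_E)

lemma hom_E_iff: "hom_E f \<longleftrightarrow> (\<forall>x y. f (x + y) = f x + f y) \<and> (\<forall>c x. f (k_on_E \<iota> act c x) = k_on_E \<iota> act c (f x))"
  by (simp add: module_hom_iff module_k_on_E)

text \<open>Membership in \<open>cochains\<close> in curried form, matching the recursions of
  \<open>convolve\<close> and \<open>inner_alternating\<close>, so that closure properties are
  inductions on the degree.\<close>

primrec multilinear :: "nat \<Rightarrow> ('a, 'e) cochain \<Rightarrow> bool" where
  "multilinear 0 \<alpha> \<longleftrightarrow> (\<forall>as e. as \<noteq> [] \<longrightarrow> \<alpha> as e = 0) \<and> hom_E (\<alpha> [])"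
| "multilinear (Suc n) \<alpha> \<longleftrightarrow> (\<forall>e. \<alpha> [] e = 0) \<and> (\<forall>x. multilinear n (\<lambda>as. \<alpha> (x # as))) \<and>
     (\<forall>as e. hom_AE (\<lambda>x. \<alpha> (x # as) e))"

lemma multilinear_iff: "multilinear n \<alpha> \<longleftrightarrow> \<alpha> \<in> cochains \<iota> act n"
proof (induction n arbitrary: \<alpha>)
  case 0
  then show ?case by (auto simp: cochains_def)
next
  case (Suc n)
  show ?case
  proof
    assume \<alpha>: "multilinear (Suc n) \<alpha>"
    then have tl: "(\<lambda>as. \<alpha> (x # as)) \<in> cochains \<iota> act n" for x
      using Suc.IH by simp
    show "\<alpha> \<in> cochains \<iota> act (Suc n)"
      unfolding cochains_def mem_Collect_eq
    proof (intro conjI allI impI)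
      fix as :: "'a list" and e assume "length as \<noteq> Suc n"
      with \<alpha> tl show "\<alpha> as e = 0" by (cases as) (auto simp: cochains_def)
    next
      fix as :: "'a list" assume "length as = Suc n"
      with tl show "hom_E (\<lambda>e. \<alpha> as e)" by (cases as) (auto simp: cochains_def)
    next
      fix as :: "'a list" and e i assume i: "length as = Suc n \<and> i < Suc n"
      then obtain x bs where as: "as = x # bs" "length bs = n" by (cases as) auto
      show "hom_AE (\<lambda>x. \<alpha> (as[i := x]) e)"
        using \<alpha> i tl[of x] as by (cases i) (auto simp: cochains_def)
    qed
  next
    assume \<alpha>: "\<alpha> \<in> cochains \<iota> act (Suc n)"
    then have zero: "\<alpha> as e = 0" if "length as \<noteq> Suc n" for as e
      using that by (auto simp: cochains_def)
    have entry: "hom_AE (\<lambda>y. \<alpha> ((x # as)[i := y]) e)" if "length as = n" "i < Suc n" for x as e i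
      using \<alpha> that unfolding cochains_def mem_Collect_eq by (metis length_Cons)
    have "(\<lambda>as. \<alpha> (x # as)) \<in> cochains \<iota> act n" for x
      unfolding cochains_def mem_Collect_eq
    proof (intro conjI allI impI)
      fix as :: "'a list" assume "length as = n"
      then show "hom_E (\<lambda>e. \<alpha> (x # as) e)" using \<alpha> by (auto simp: cochains_def)
    next
      fix as :: "'a list" and e i assume "length as = n \<and> i < n"
      then show "hom_AE (\<lambda>y. \<alpha> (x # as[i := y]) e)" using entry[of as "Suc i" x e] by simp
    qed (simp add: zero)
    moreover have "hom_AE (\<lambda>x. \<alpha> (x # as) e)" for as e
    proof (cases "length as = n")
      case True
      then show ?thesis using entry[of as 0] by simp
    next
      case False
      then show ?thesis by (simp add: zero hom_AE_iff)
    qed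
    ultimately show "multilinear (Suc n) \<alpha>" by (simp add: zero Suc.IH)
  qed
qed

lemma multilinear_hom: "multilinear n \<alpha> \<Longrightarrow> hom_E (\<alpha> as)"
proof (induction n arbitrary: \<alpha> as)
  case 0
  then show ?case by (cases as) (auto simp: hom_E_iff)
next
  case (Suc n)
  have "hom_E (\<alpha> (x # bs))" for x bs
    using Suc.IH[of "\<lambda>as. \<alpha> (x # as)"] Suc.prems by simp
  with Suc.prems show ?case by (cases as) (simp_all add: hom_E_iff)
qed

lemma multilinear_length: "multilinear n \<alpha> \<Longrightarrow> length as \<noteq> n \<Longrightarrow> \<alpha> as e = 0"
  by (auto simp: multilinear_iff cochains_def)

lemma multilinear_linear:
  assumes "multilinear n \<alpha>" and "multilinear n \<beta>"
  shows "multilinear n (\<lambda>as e. k_on_E \<iota> act c (\<alpha> as e) + k_on_E \<iota> act d (\<beta> as e))"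
  using assms
proof (induction n arbitrary: \<alpha> \<beta>)
  case 0
  then show ?case
    by (simp add: hom_E_iff kE.scale_right_distrib mult.commute)
next
  case (Suc n)
  then show ?case
    by (simp add: hom_AE_iff kE.scale_right_distrib mult.commute)
qed

text \<open>In degree 0 the product is composition with the k-linear map \<open>\<alpha> []\<close>.
  In positive degree \<open>\<alpha> []\<close> vanishes and the head of the list always belongs to
  \<alpha>, so currying reduces the degree; linearity in the head is read off from the single
  surviving splitting.\<close>

lemma multilinear_convolve:
  assumes "multilinear m \<alpha>" and "multilinear n \<beta>"
  shows "multilinear (m + n) (convolve \<alpha> \<beta>)"
  using assms(1)
proof (induction m arbitrary: \<alpha>)
  case 0
  then have zero: "\<alpha> [] 0 = 0"
    by (intro additive_map_zero) (simp add: hom_E_iff additive_map_def)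
  have "multilinear n (\<lambda>as e. \<alpha> [] (\<beta> as e))"
    using assms(2)
  proof (induction n arbitrary: \<beta>)
    case 0
    then show ?case using \<open>multilinear 0 \<alpha>\<close> zero by (auto simp: hom_E_iff)
  next
    case (Suc n)
    then show ?case
      using \<open>multilinear 0 \<alpha>\<close> zero by (simp add: hom_E_iff hom_AE_iff)
  qed
  moreover have "convolve \<alpha> \<beta> as e = \<alpha> [] (\<beta> as e)" for as e
    using 0 by (subst convolve_homogeneous[of 0]) auto
  ultimately show ?case by (simp add: fun_eq_iff)
next
  case (Suc m)
  have "hom_AE (\<lambda>x. convolve (\<lambda>bs. \<alpha> (x # bs)) \<beta> as e)" for as e
  proof -
    have "convolve (\<lambda>bs. \<alpha> (x # bs)) \<beta> as e =
        (if m \<le> length as then \<alpha> (x # take m as) (\<beta> (drop m as) e) else 0)" for x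
      using Suc.prems by (intro convolve_homogeneous multilinear_length[of m "\<lambda>bs. \<alpha> (x # bs)"]) simp_all
    then show ?thesis using Suc.prems by (simp add: hom_AE_iff)
  qed
  then show ?case using Suc by simp
qed

definition bilinear_on_A :: "('a \<Rightarrow> 'a \<Rightarrow> 'a) \<Rightarrow> bool" where
  "bilinear_on_A B \<longleftrightarrow>
     (\<forall>a. module_hom (k_on_A \<iota>) (k_on_A \<iota>) (\<lambda>b. B a b)) \<and>
     (\<forall>b. module_hom (k_on_A \<iota>) (k_on_A \<iota>) (\<lambda>a. B a b))"

text \<open>The parameter x stands for a list entry that currying has moved into the cochain, where
  the recursion no longer contracts it.\<close>

lemma inner_alternating_hom:
  assumes "\<And>bs e. hom_AE (\<lambda>x. F x bs e)"
  shows "hom_AE (\<lambda>x. inner_alternating B (F x) as e)"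
  using assms
proof (induction as arbitrary: F rule: induct_list012)
  case (3 x y as)
  have "hom_AE (\<lambda>z. inner_alternating B (\<lambda>bs. F z (x # bs)) (y # as) e)"
    by (rule 3(2)) (rule 3(3))
  then show ?case using 3(3) by (simp add: hom_AE_iff kE.scale_right_diff_distrib)
qed (simp_all add: hom_AE_iff)

lemma multilinear_inner_alternating:
  assumes B: "bilinear_on_A B" and "multilinear n \<alpha>"
  shows "multilinear (Suc n) (inner_alternating B \<alpha>)"
  using assms(2)
proof (induction n arbitrary: \<alpha>)
  case 0
  then have "inner_alternating B \<alpha> as e = 0" for as e
    by (intro inner_alternating_degree_0) simp
  then have "inner_alternating B \<alpha> = (\<lambda>as e. 0)" by (simp add: fun_eq_iff)
  then show ?case by (simp add: hom_E_iff hom_AE_iff)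
next
  case (Suc n)
  have IH: "multilinear (Suc n) (inner_alternating B (\<lambda>as. \<alpha> (x # as)))" for x
    using Suc by simp
  \<comment> \<open>\<open>\<beta> x\<close> is \<alpha> with \<open>B x\<close> applied to its
    first entry. It keeps the degree of \<alpha>, so both terms of the recursion for
    \<open>inner_alternating\<close> are multilinear of the same degree.\<close>
  define \<beta> where "\<beta> = (\<lambda>x as e. case as of [] \<Rightarrow> 0 | y # bs \<Rightarrow> \<alpha> (B x y # bs) e)"
  have \<beta>: "multilinear (Suc n) (\<beta> x)" for x
    using Suc.prems B by (simp add: \<beta>_def hom_AE_iff bilinear_on_A_def module_hom_iff)
  have step: "inner_alternating B \<alpha> (x # as) e =
      k_on_E \<iota> act (- 1) (\<beta> x as e) + k_on_E \<iota> act (- 1) (inner_alternating B (\<lambda>as. \<alpha> (x # as)) as e)"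
    for x as e by (cases as) (simp_all add: \<beta>_def)
  have 1: "multilinear (Suc n) (\<lambda>as e. inner_alternating B \<alpha> (x # as) e)" for x
    unfolding step by (rule multilinear_linear[OF \<beta> IH])
  have 2: "hom_AE (\<lambda>x. inner_alternating B \<alpha> (x # as) e)" for as e
  proof -
    have "hom_AE (\<lambda>x. \<beta> x as e)"
      using Suc.prems B by (cases as) (simp_all add: \<beta>_def hom_AE_iff bilinear_on_A_def module_hom_iff)
    moreover have "hom_AE (\<lambda>x. inner_alternating B (\<lambda>as. \<alpha> (x # as)) as e)"
      by (rule inner_alternating_hom) (use Suc.prems in simp)
    ultimately show ?thesis
      unfolding step by (simp add: hom_AE_iff kE.scale_right_distrib kE.scale_right_diff_distrib)
  qed
  show ?case by (subst multilinear.simps) (use 1 2 in simp)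
qed

end

section \<open>Curved dg Lie algebras from graded associative rings\<close>

text \<open>Signs as a case distinction on parity: graded identities split into finitely many cases,
  each an identity of the noncommutative ring that \<open>algebra_simps\<close> decides.\<close>

definition sgn_power :: "nat \<Rightarrow> 'x::ab_group_add \<Rightarrow> 'x" where
  "sgn_power n x = (if even n then x else - x)"

text \<open>
  The graded commutator with \<open>m\<close> plus a derivation \<open>D\<close> of square zero is a curved differential
  whose curvature is \<open>m\<^sup>2 + D m\<close>. The ring is not assumed to have a unit, because \<open>E\<close> may be
  zero; \<open>\<kappa> 1\<close> acts as one on the homogeneous elements.
\<close>

locale graded_ring_model =
  fixes scale :: "'c::comm_ring_1 \<Rightarrow> 'x::ab_group_add \<Rightarrow> 'x"
    and r :: "'r::ring \<Rightarrow> 'x"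
    and C :: "nat \<Rightarrow> 'r set"
    and \<kappa> :: "'c \<Rightarrow> 'r"
    and br :: "nat \<Rightarrow> nat \<Rightarrow> 'x \<Rightarrow> 'x \<Rightarrow> 'x"
    and m :: 'r
    and D :: "'r \<Rightarrow> 'r"
    and d :: "nat \<Rightarrow> 'x \<Rightarrow> 'x"
  assumes module_scale: "module scale"
    and r_add: "r (x + y) = r x + r y"
    and r_scale: "x \<in> C n \<Longrightarrow> r (\<kappa> c * x) = scale c (r x)"
    and C_zero: "0 \<in> C n"
    and C_add: "x \<in> C n \<Longrightarrow> y \<in> C n \<Longrightarrow> x + y \<in> C n"
    and C_scale: "x \<in> C n \<Longrightarrow> \<kappa> c * x \<in> C n"
    and C_mult: "x \<in> C p \<Longrightarrow> y \<in> C n \<Longrightarrow> x * y \<in> C (p + n)"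
    and \<kappa>_comm: "x \<in> C n \<Longrightarrow> x * \<kappa> c = \<kappa> c * x"
    and \<kappa>_minus_one: "x \<in> C n \<Longrightarrow> \<kappa> (- 1) * x = - x"
    and br_r: "x \<in> C p \<Longrightarrow> y \<in> C n \<Longrightarrow> br p n (r x) (r y) = r (x * y - sgn_power (p * n) (y * x))"
    and m_mem: "m \<in> C 1"
    and D_mem: "x \<in> C n \<Longrightarrow> D x \<in> C (n + 1)"
    and D_add: "D (x + y) = D x + D y"
    and D_scale: "x \<in> C n \<Longrightarrow> D (\<kappa> c * x) = \<kappa> c * D x"
    and D_mult: "x \<in> C p \<Longrightarrow> y \<in> C n \<Longrightarrow> D (x * y) = D x * y + sgn_power p (x * D y)"
    and D_D: "x \<in> C n \<Longrightarrow> D (D x) = 0"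
    and d_r: "x \<in> C n \<Longrightarrow> d n (r x) = r (m * x - sgn_power n (x * m) + D x)"
begin

sublocale scale: module scale by (fact module_scale)

lemma additive_r: "additive_map r" by (simp add: additive_map_def r_add)

lemma additive_D: "additive_map D" by (simp add: additive_map_def D_add)

lemmas r_simps = r_add additive_map_minus[OF additive_r] additive_map_diff[OF additive_r]
  additive_map_zero[OF additive_r]

lemmas D_simps = D_add additive_map_minus[OF additive_D] additive_map_diff[OF additive_D]
  additive_map_zero[OF additive_D]

lemma C_minus: "x \<in> C n \<Longrightarrow> - x \<in> C n"
  using C_scale[of x n "- 1"] by (simp add: \<kappa>_minus_one)

lemma C_diff: "x \<in> C n \<Longrightarrow> y \<in> C n \<Longrightarrow> x - y \<in> C n"
  using C_add[of x n "- y"] by (simp add: C_minus)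

lemma C_sgn: "x \<in> C n \<Longrightarrow> sgn_power p x \<in> C n"
  by (simp add: sgn_power_def C_minus)

lemma scale_sgn: "scale ((- 1) ^ p) v = sgn_power p v"
  by (simp add: sgn_power_def)

lemma \<kappa>_left_comm: "x \<in> C n \<Longrightarrow> x * (\<kappa> c * y) = \<kappa> c * (x * y)"
  by (metis \<kappa>_comm mult.assoc)

lemma commutator_mem: "x \<in> C p \<Longrightarrow> y \<in> C n \<Longrightarrow> x * y - sgn_power q (y * x) \<in> C (p + n)"
  using C_mult[of x p y n] C_mult[of y n x p] by (simp add: C_diff C_sgn add.commute)

lemma differential_mem: "x \<in> C n \<Longrightarrow> m * x - sgn_power q (x * m) + D x \<in> C (n + 1)"
  using commutator_mem[OF m_mem, of x n q] by (simp add: C_add D_mem[of x n, simplified] add.commute)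

lemma graded_lie: "graded_lie_algebra scale (\<lambda>n. r ` C n) br"
proof
  show "scale.subspace (r ` C n)" for n
  proof (rule scale.subspaceI)
    show "0 \<in> r ` C n" using C_zero[of n] r_simps(4) by force
    show "x + y \<in> r ` C n" if "x \<in> r ` C n" "y \<in> r ` C n" for x y
      using that C_add[of _ n] by (auto simp flip: r_add)
    show "scale c x \<in> r ` C n" if "x \<in> r ` C n" for c x
      using that C_scale by (auto simp flip: r_scale)
  qed
next
  fix x y p n assume "x \<in> r ` C p" "y \<in> r ` C n"
  then show "br p n x y \<in> r ` C (p + n)" by (auto simp: br_r commutator_mem)
next
  fix x x' y p n assume "x \<in> r ` C p" "x' \<in> r ` C p" "y \<in> r ` C n"
  then show "br p n (x + x') y = br p n x y + br p n x' y"
    by (auto simp: br_r C_add simp flip: r_add) (simp add: sgn_power_def algebra_simps)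
next
  fix x y p n c assume "x \<in> r ` C p" "y \<in> r ` C n"
  then obtain a b where a: "a \<in> C p" "x = r a" and b: "b \<in> C n" "y = r b" by auto
  have "br p n (r (\<kappa> c * a)) (r b) = r (\<kappa> c * (a * b - sgn_power (p * n) (b * a)))"
    unfolding br_r[OF C_scale[OF a(1)] b(1)]
    by (simp add: sgn_power_def algebra_simps \<kappa>_left_comm[OF b(1)])
  then show "br p n (scale c x) y = scale c (br p n x y)"
    using a b by (simp add: r_scale br_r r_scale[OF commutator_mem])
next
  fix x y p n assume "x \<in> r ` C p" "y \<in> r ` C n"
  then show "br p n x y = - scale ((- 1) ^ (p * n)) (br n p y x)"
    by (auto simp: br_r scale_sgn sgn_power_def mult.commute r_simps)
next
  fix x y z p n q assume "x \<in> r ` C p" "y \<in> r ` C n" "z \<in> r ` C q"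
  then obtain a b c where a: "a \<in> C p" "x = r a" and b: "b \<in> C n" "y = r b" and c: "c \<in> C q" "z = r c"
    by auto
  show "br p (n + q) x (br n q y z) =
        br (p + n) q (br p n x y) z + scale ((- 1) ^ (p * n)) (br n (p + q) y (br p q x z))"
    unfolding a(2) b(2) c(2) br_r[OF a(1) b(1)] br_r[OF a(1) c(1)] br_r[OF b(1) c(1)]
      br_r[OF a(1) commutator_mem[OF b(1) c(1)]] br_r[OF b(1) commutator_mem[OF a(1) c(1)]]
      br_r[OF commutator_mem[OF a(1) b(1)] c(1)]
    by (cases "even p"; cases "even n"; cases "even q")
      (simp_all add: scale_sgn sgn_power_def r_simps algebra_simps)
qed

text \<open>The commutator with m is an inner derivation of degree 1 and D is a derivation of degree
  1 of the product, hence of the commutator; d is their sum.\<close>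

lemma derivation: "graded_lie_algebra_derivation scale (\<lambda>n. r ` C n) br d"
proof (intro graded_lie_algebra_derivation.intro graded_lie graded_lie_algebra_derivation_axioms.intro)
  fix x n assume "x \<in> r ` C n"
  then show "d n x \<in> r ` C (n + 1)" by (auto simp: d_r differential_mem[simplified])
next
  fix x y n assume "x \<in> r ` C n" "y \<in> r ` C n"
  then show "d n (x + y) = d n x + d n y"
    by (auto simp: d_r C_add simp flip: r_add) (simp add: sgn_power_def algebra_simps D_simps)
next
  fix x n c assume "x \<in> r ` C n"
  then show "d n (scale c x) = scale c (d n x)"
    by (auto simp: d_r C_scale D_scale simp flip: r_scale[OF differential_mem] r_scale)
      (simp add: sgn_power_def algebra_simps \<kappa>_left_comm[OF m_mem])
next
  fix x y p n assume "x \<in> r ` C p" "y \<in> r ` C n"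
  then obtain a b where a: "a \<in> C p" "x = r a" and b: "b \<in> C n" "y = r b"
    by auto
  have 1: "d p (r a) = r (m * a - sgn_power p (a * m) + D a)" "d n (r b) = r (m * b - sgn_power n (b * m) + D b)"
    using a b by (auto simp: d_r)
  show "d (p + n) (br p n x y) = br (p + 1) n (d p x) y + scale ((- 1) ^ p) (br p (n + 1) x (d n y))"
    unfolding a(2) b(2) 1 br_r[OF differential_mem[OF a(1)] b(1)] br_r[OF a(1) differential_mem[OF b(1)]]
      br_r[OF a(1) b(1)] d_r[OF commutator_mem[OF a(1) b(1)]]
    by (cases "even p"; cases "even n")
      (simp_all add: D_mult[OF a(1) b(1)] D_mult[OF b(1) a(1)] scale_sgn sgn_power_def r_simps D_simps algebra_simps)
qed

text \<open>Expanding d twice gives [m,[m,x]] + [m,Dx] + D[m,x] + D(Dx); the last term vanishes and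
  the others combine to the commutator of m m + D m with x. For the curvature itself, the terms m (D
  m) and (D m) m from the commutator cancel those of D (m m), as in the Bianchi identity.\<close>

lemma curved: "curved_dg_lie_algebra scale (\<lambda>n. r ` C n) br d (r (m * m + D m))"
proof (intro curved_dg_lie_algebra.intro derivation curved_dg_lie_algebra_axioms.intro)
  have mm: "m * m + D m \<in> C 2"
    using C_add[OF C_mult[OF m_mem m_mem] D_mem[OF m_mem]] by (simp add: numeral_2_eq_2)
  show "r (m * m + D m) \<in> r ` C 2" using mm by blast
  show "d 2 (r (m * m + D m)) = 0"
    unfolding d_r[OF mm] using D_mult[OF m_mem m_mem] D_D[OF m_mem]
    by (simp add: sgn_power_def D_simps algebra_simps r_simps)
  fix x n assume "x \<in> r ` C n"
  then obtain a where a: "a \<in> C n" "x = r a" by auto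
  show "d (n + 1) (d n x) = br 2 n (r (m * m + D m)) x"
    unfolding a(2) d_r[OF a(1)] d_r[OF differential_mem[OF a(1)]] br_r[OF mm a(1)]
    by (cases "even n")
      (simp_all add: D_mult[OF m_mem a(1)] D_mult[OF a(1) m_mem] D_D[OF a(1)] sgn_power_def D_simps algebra_simps)
qed

end

lemma (in curved_dg_lie_algebra) flat_imp_dg:
  assumes "curv = 0"
  shows "dg_lie_algebra scale G br d"
proof (intro dg_lie_algebra.intro dg_lie_algebra_axioms.intro)
  show "graded_lie_algebra_derivation scale G br d" ..
  fix x n assume x: "x \<in> G n"
  have "0 \<in> G 2" using G_subspace subspace_0 by blast
  then have "br 2 n (0 + 0) x = br 2 n 0 x + br 2 n 0 x" using x by (intro br_add)
  then show "d (n + 1) (d n x) = 0" using d_squared_curv[OF x] assms by simp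
qed

section \<open>The relative Hochschild complex as a graded ring\<close>

context relative_cochains
begin

definition C :: "nat \<Rightarrow> ('a, 'e) cochain_ring set" where
  "C n = {x. app x \<in> cochains \<iota> act n}"

lemma C_iff: "x \<in> C n \<longleftrightarrow> multilinear n (app x)"
  by (simp add: C_def multilinear_iff)

lemma C_hom: "x \<in> C n \<Longrightarrow> hom_E (app x as)"
  by (simp add: C_iff multilinear_hom)

lemma C_length: "x \<in> C n \<Longrightarrow> length as \<noteq> n \<Longrightarrow> app x as e = 0"
  by (simp add: C_iff multilinear_length)

lemma app_Abs_cochain:
  assumes "\<alpha> \<in> cochains \<iota> act n"
  shows "app (Abs_cochain_ring \<alpha>) = \<alpha>"
proof (rule app_Abs)
  show "additive_map (\<alpha> as)" for as
    using multilinear_hom[of n \<alpha> as] assms by (simp add: multilinear_iff additive_map_def hom_E_iff)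
qed

lemma Abs_cochain_mem: "\<alpha> \<in> cochains \<iota> act n \<Longrightarrow> Abs_cochain_ring \<alpha> \<in> C n"
  by (simp add: C_def app_Abs_cochain)

lemma app_C: "app ` C n = cochains \<iota> act n"
  using app_Abs_cochain Abs_cochain_mem unfolding C_def by (auto simp: image_iff) metis

text \<open>Scalars are placed in the ring as cochains of degree 0: scaling becomes left
  multiplication, and k-linearity becomes commutation with these elements.\<close>

definition scalar :: "'k \<Rightarrow> ('a, 'e) cochain_ring" where
  "scalar c = Abs_cochain_ring (\<lambda>as e. if as = [] then k_on_E \<iota> act c e else 0)"

lemma app_scalar: "app (scalar c) = (\<lambda>as e. if as = [] then k_on_E \<iota> act c e else 0)"
  unfolding scalar_def by (rule app_Abs) (simp add: additive_map_def kE.scale_right_distrib)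

lemma scalar_times: "app (scalar c * x) as e = k_on_E \<iota> act c (app x as e)"
  unfolding app_times by (subst convolve_homogeneous[of 0]) (auto simp: app_scalar)

lemma app_times_homogeneous:
  "x \<in> C n \<Longrightarrow> app (x * y) as e = (if n \<le> length as then app x (take n as) (app y (drop n as) e) else 0)"
  unfolding app_times by (rule convolve_homogeneous) (simp add: C_length)

text \<open>The scalar on the right acts on e before x does, so this is the k-linearity of x in the
  module argument.\<close>

lemma times_scalar: "x \<in> C n \<Longrightarrow> x * scalar c = scalar c * x"
  using C_hom[of x n]
  by (intro cochain_ring_eqI)
    (auto simp: app_times_homogeneous scalar_times app_scalar C_length hom_E_iff)

lemma scalar_add: "scalar (c + d) = scalar c + scalar d"
  by (rule cochain_ring_eqI) (simp add: app_scalar kE.scale_left_distrib)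

lemma scalar_mult: "scalar c * scalar d = scalar (c * d)"
  by (rule cochain_ring_eqI) (simp add: scalar_times app_scalar)

lemma scalar_one_times: "scalar 1 * x = x"
  by (rule cochain_ring_eqI) (simp add: scalar_times)

lemma scalar_minus_one_times: "scalar (- 1) * x = - x"
  by (rule cochain_ring_eqI) (simp add: scalar_times)

lemma additive_scalar: "additive_map scalar"
  by (simp add: additive_map_def scalar_add)

lemma C_linear:
  assumes "x \<in> C n" and "y \<in> C n"
  shows "scalar c * x + scalar d * y \<in> C n"
proof -
  have "app (scalar c * x + scalar d * y) = (\<lambda>as e. k_on_E \<iota> act c (app x as e) + k_on_E \<iota> act d (app y as e))"
    by (simp add: fun_eq_iff scalar_times)
  then show ?thesis using multilinear_linear[of n "app x" "app y" c d] assms by (simp add: C_iff)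
qed

lemma zero_mem_C: "0 \<in> C n"
  by (auto simp: C_def cochains_def hom_E_iff hom_AE_iff)

lemma scalar_times_mem: "x \<in> C n \<Longrightarrow> scalar c * x \<in> C n"
  using C_linear[of x n 0 c 0] by (simp add: zero_mem_C)

lemma add_mem_C: "x \<in> C n \<Longrightarrow> y \<in> C n \<Longrightarrow> x + y \<in> C n"
  using C_linear[of x n y 1 1] by (simp add: scalar_one_times)

lemma sum_mem_C: "(\<And>i. i \<in> S \<Longrightarrow> f i \<in> C n) \<Longrightarrow> (\<Sum>i\<in>S. f i) \<in> C n"
  by (induction S rule: infinite_finite_induct) (auto simp: zero_mem_C add_mem_C)

lemma minus_mem_C: "x \<in> C n \<Longrightarrow> - x \<in> C n"
  using scalar_times_mem[of x n "-1"] by (simp add: scalar_minus_one_times)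

lemma times_mem_C: "x \<in> C m \<Longrightarrow> y \<in> C n \<Longrightarrow> x * y \<in> C (m + n)"
  by (simp add: C_iff app_times multilinear_convolve)

lemma inner_op_mem_C: "bilinear_on_A B \<Longrightarrow> x \<in> C n \<Longrightarrow> inner_op B x \<in> C (n + 1)"
  using multilinear_inner_alternating[of B n "app x"] by (simp add: C_iff inner_op.rep_eq)

lemma scalar_mem_C: "scalar c \<in> C 0"
  by (simp add: C_iff app_scalar hom_E_iff kE.scale_right_distrib mult.commute)

definition mult_action :: "('a, 'e) cochain_ring" where
  "mult_action = Abs_cochain_ring (\<lambda>as e. case as of [a] \<Rightarrow> act a e | _ \<Rightarrow> 0)"

lemma app_mult_action: "app mult_action = (\<lambda>as e. case as of [a] \<Rightarrow> act a e | _ \<Rightarrow> 0)"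
  unfolding mult_action_def
  by (rule app_Abs) (auto simp: additive_map_def act.scale_right_distrib split: list.split)

lemma mult_action_mem: "mult_action \<in> C 1"
  unfolding C_iff One_nat_def multilinear.simps
  by (auto simp: app_mult_action hom_E_iff hom_AE_iff k_on_E_def k_on_A_def
      act.scale_right_distrib act.scale_left_distrib mult.commute split: list.split)

lemma inner_op_scalar_times: "inner_op B (scalar c * x) = scalar c * inner_op B x"
proof -
  have "additive_map (k_on_E \<iota> act c)" by (simp add: additive_map_def kE.scale_right_distrib)
  from inner_alternating_additive_left[OF this] show ?thesis
    by (intro cochain_ring_eqI) (simp add: inner_op.rep_eq scalar_times[abs_def] scalar_times)
qed

lemma grading_eq: "x \<in> C n \<Longrightarrow> grading x = sgn_power n x"
proof (rule cochain_ring_eqI)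
  fix as e assume "x \<in> C n"
  then show "app (grading x) as e = app (sgn_power n x) as e"
    by (cases "length as = n") (auto simp: grading.rep_eq sgn_power_def C_length)
qed

lemma inner_op_times_C: "x \<in> C n \<Longrightarrow> inner_op B (x * y) = inner_op B x * y + sgn_power n (x * inner_op B y)"
  by (simp add: inner_op_times grading_eq sgn_power_def)

text \<open>The inserted product ends up in a ring entry of x, so additivity in B rests on the
  multilinearity contained in \<open>C n\<close>.\<close>

lemma inner_op_add_left:
  assumes "x \<in> C n"
  shows "inner_op (B + B') x = inner_op B x + inner_op B' x"
proof -
  have "inner_alternating (B + B') \<alpha> as e = inner_alternating B \<alpha> as e + inner_alternating B' \<alpha> as e"
    if "multilinear n \<alpha>" for \<alpha> as e
    using that
  proof (induction as arbitrary: \<alpha> n e rule: induct_list012)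
    case (3 x y as)
    \<comment> \<open>For n = 0 the curried cochain is zero, which is multilinear of degree 0; the
      induction only asks for some degree.\<close>
    have "\<exists>k. multilinear k (\<lambda>as. \<alpha> (x # as))"
      using 3(3) by (cases n) (auto intro: exI[of _ 0] simp: hom_E_iff)
    moreover have "\<alpha> ((B x y + B' x y) # as) e = \<alpha> (B x y # as) e + \<alpha> (B' x y # as) e"
      using 3(3) by (cases n) (simp_all add: hom_AE_iff)
    ultimately show ?case using 3(2) by auto
  qed simp_all
  then show ?thesis
    using assms by (intro cochain_ring_eqI) (simp add: inner_op.rep_eq C_iff)
qed

lemma inner_op_zero_left: "x \<in> C n \<Longrightarrow> inner_op 0 x = 0"
  using inner_op_add_left[of x n 0 0] by simp

text \<open>This is D^2 = 0 at order M in \<epsilon>. The associators sum to zero by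
  \<open>assoc\<close>, disjoint contractions cancel in pairs when i and M - i are exchanged, and
  the remaining term is the same sum for the curried cochain.\<close>

lemma inner_op_square:
  fixes B :: "nat \<Rightarrow> 'a \<Rightarrow> 'a \<Rightarrow> 'a"
  assumes assoc: "\<And>x y z. (\<Sum>i\<le>M. B (M - i) (B i x y) z) = (\<Sum>i\<le>M. B i x (B (M - i) y z))"
    and x: "x \<in> C n"
  shows "(\<Sum>i\<le>M. inner_op (B i) (inner_op (B (M - i)) x)) = 0"
proof (rule cochain_ring_eqI)
  fix as e
  have "(\<Sum>i\<le>M. inner_alternating (B i) (inner_alternating (B (M - i)) \<alpha>) as e) = 0"
    if "multilinear n \<alpha>" for \<alpha>
    using that
  proof (induction as arbitrary: \<alpha> n e rule: induct_list012)
    case (3 x y as)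
    show ?case
    proof (cases as)
      case (Cons z bs)
      have add: "additive_map (\<lambda>u. \<alpha> (u # bs) e)"
        using 3(3) by (cases n) (simp_all add: additive_map_def hom_AE_iff)
      have tl: "\<exists>k. multilinear k (\<lambda>as. \<alpha> (x # as))"
        using 3(3) by (cases n) (auto intro: exI[of _ 0] simp: hom_E_iff)
      have "(\<Sum>i\<le>M. inner_alternating (B i) (inner_alternating (B (M - i)) (\<lambda>as. \<alpha> (x # as))) (y # as) e) = 0"
        using 3(2) tl by blast
      moreover have "(\<Sum>i\<le>M. \<alpha> (B (M - i) (B i x y) z # bs) e) = (\<Sum>i\<le>M. \<alpha> (B (M - i) x (B i y z) # bs) e)"
        using assoc[of x y z] sum_atMost_rev[of "\<lambda>i j. B i x (B j y z)" M]
        by (simp flip: additive_map_sum[OF add])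
      moreover have "(\<Sum>i\<le>M. inner_alternating (B (M - i)) (\<lambda>bs. \<alpha> (B i x y # bs)) as e) =
          (\<Sum>i\<le>M. inner_alternating (B i) (\<lambda>bs. \<alpha> (B (M - i) x y # bs)) as e)"
        by (rule sum_atMost_rev[symmetric])
      ultimately show ?thesis
        unfolding Cons
        by (simp add: inner_alternating_square sum.distrib sum_subtractf del: inner_alternating.simps)
    qed simp
  qed simp_all
  then show "app (\<Sum>i\<le>M. inner_op (B i) (inner_op (B (M - i)) x)) as e = app 0 as e"
    using x by (simp add: app_sum inner_op.rep_eq C_iff)
qed

lemma app_times_eq_circ:
  assumes "x \<in> C k" and "y \<in> C l"
  shows "app (x * y) = circ k l (app x) (app y)"
proof (intro ext)
  fix as e
  show "app (x * y) as e = circ k l (app x) (app y) as e"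
    using assms by (auto simp: app_times_homogeneous circ_def C_length)
qed

lemma gerst_app:
  assumes "x \<in> C k" and "y \<in> C l"
  shows "gerst \<iota> act k l (app x) (app y) = app (x * y - sgn_power (k * l) (y * x))"
  using assms
  by (auto simp: gerst_def k_on_cochain_def fun_eq_iff sgn_power_def app_times_eq_circ)

text \<open>Position j + 1 of a list is position j of its tail, which turns the indexed sum into the
  recursion with its alternating sign.\<close>

lemma inner_sum_app: 
  assumes "x \<in> C k"
  shows "inner_sum \<iota> act k B (app x) = app (inner_op B x)"
proof (intro ext)
  fix as e
  have *: "inner_alternating B \<alpha> as e = (\<Sum>j = 1..length as - 1. k_on_E \<iota> act ((- 1) ^ j) (\<alpha> (contract B j as) e))"
    for \<alpha>
  proof (induction B \<alpha> as arbitrary: e rule: inner_alternating.induct)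
    case (1 B \<alpha> x y as)
    have "contract B (Suc j) (x # y # as) = x # contract B j (y # as)" if "j \<ge> 1" for j
      using that by (cases j) (simp_all add: contract_def)
    then have "(\<Sum>j = Suc 1..Suc (length as). k_on_E \<iota> act ((- 1) ^ j) (\<alpha> (contract B j (x # y # as)) e)) =
       (\<Sum>j = 1..length as. - k_on_E \<iota> act ((- 1) ^ j) (\<alpha> (x # contract B j (y # as)) e))"
      by (subst sum.shift_bounds_cl_Suc_ivl) (auto intro!: sum.cong)
    moreover have "contract B 1 (x # y # as) = B x y # as" by (simp add: contract_def)
    moreover have "(\<Sum>j = 1..Suc (length as). k_on_E \<iota> act ((- 1) ^ j) (\<alpha> (contract B j (x # y # as)) e)) =
        k_on_E \<iota> act ((- 1) ^ 1) (\<alpha> (contract B 1 (x # y # as)) e) +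
        (\<Sum>j = Suc 1..Suc (length as). k_on_E \<iota> act ((- 1) ^ j) (\<alpha> (contract B j (x # y # as)) e))"
      by (rule sum.atLeast_Suc_atMost) simp
    ultimately show ?case using 1
      by (simp add: sum_negf del: sum.cl_ivl_Suc)
  qed simp_all
  show "inner_sum \<iota> act k B (app x) as e = app (inner_op B x) as e"
  proof (cases "length as = k + 1")
    case True
    then show ?thesis by (simp add: inner_sum_def inner_op.rep_eq *)
  next
    case False
    \<comment> \<open>A contraction shortens the list by exactly one, so a list of length other than
      k + 1 never yields one of length k.\<close>
    have "app x (contract B j as) e = 0" if "j \<in> {1..length as - 1}" for j
      using that False by (intro C_length[OF assms]) (auto simp: contract_def)
    with False show ?thesis
      by (auto simp: inner_sum_def inner_op.rep_eq * intro!: sum.neutral[symmetric])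
  qed
qed

text \<open>The first term of the Hochschild differential lets the head act after x, the last lets
  the last entry act before x; these are the two products with \<open>mult_action\<close>. The
  middle terms are contractions by the product of A.\<close>

lemma d_Hoch_app:
  assumes x: "x \<in> C k"
  shows "d_Hoch \<iota> act k (app x) = app (mult_action * x - sgn_power k (x * mult_action) + inner_op (*) x)"
proof (intro ext)
  fix as e
  have 1: "app (mult_action * x) as e = (if length as = k + 1 then act (hd as) (app x (tl as) e) else 0)"
    unfolding app_times_eq_circ[OF mult_action_mem x] circ_def
    by (cases as) (auto simp: app_mult_action)
  have "drop k as = [last as]" "take k as = butlast as" if "length as = k + 1"
  proof -
    have "as = butlast as @ [last as]" "length (butlast as) = k"
      using that by (auto simp: append_butlast_last_id simp flip: length_greater_0_conv)
    then show "drop k as = [last as]" "take k as = butlast as"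
      by (metis append_eq_conv_conj)+
  qed
  then have 2: "app (x * mult_action) as e = (if length as = k + 1 then app x (butlast as) (act (last as) e) else 0)"
    unfolding app_times_eq_circ[OF x mult_action_mem] circ_def
    by (auto simp: app_mult_action)
  have 3: "app (inner_op (*) x) as e = inner_sum \<iota> act k (*) (app x) as e"
    by (simp add: inner_sum_app x)
  show "d_Hoch \<iota> act k (app x) as e =
      app (mult_action * x - sgn_power k (x * mult_action) + inner_op (*) x) as e"
    unfolding app_simps 1 3
    by (auto simp: 2 d_Hoch_def sgn_power_def) (auto simp: inner_sum_def)
qed

lemma bilinear_mult: "bilinear_on_A (*)"
  by (auto simp: bilinear_on_A_def module_hom_iff module_k_on_A k_on_A_def algebra_simps)

lemma hochschild_model:
  "graded_ring_model (k_on_cochain \<iota> act) app C scalar (gerst \<iota> act) mult_action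
     (inner_op (*)) (d_Hoch \<iota> act)"
proof
  interpret K: module "k_on_cochain \<iota> act" by (rule module_k_on_cochain)
  fix c d :: 'k and u v :: "('a, 'e) cochain"
  show "k_on_cochain \<iota> act c (u + v) = k_on_cochain \<iota> act c u + k_on_cochain \<iota> act c v"
    "k_on_cochain \<iota> act (c + d) u = k_on_cochain \<iota> act c u + k_on_cochain \<iota> act d u"
    "k_on_cochain \<iota> act c (k_on_cochain \<iota> act d u) = k_on_cochain \<iota> act (c * d) u"
    "k_on_cochain \<iota> act 1 u = u"
    by (simp_all add: K.scale_right_distrib K.scale_left_distrib)
next
  fix x y :: "('a, 'e) cochain_ring"
  show "app (x + y) = app x + app y" by (simp add: fun_eq_iff)
  show "inner_op (*) (x + y) = inner_op (*) x + inner_op (*) y"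
    using additive_inner_op unfolding additive_map_def by blast
next
  fix x n c assume "x \<in> C n"
  then show "app (scalar c * x) = k_on_cochain \<iota> act c (app x)"
    by (simp add: fun_eq_iff scalar_times k_on_cochain_def)
next
  fix x n assume x: "x \<in> C n"
  \<comment> \<open>At M = 0 the constant family reduces the associativity condition to that of
    A.\<close>
  have "(\<Sum>i\<le>0::nat. inner_op ((\<lambda>_. (*)) i) (inner_op ((\<lambda>_. (*)) (0 - i)) x)) = 0"
    by (rule inner_op_square[OF _ x]) (simp add: mult.assoc)
  then show "inner_op (*) (inner_op (*) x) = 0" by simp
qed (simp_all add: zero_mem_C add_mem_C scalar_times_mem times_mem_C times_scalar scalar_minus_one_times
    gerst_app mult_action_mem[simplified] inner_op_mem_C[simplified] bilinear_mult inner_op_scalar_times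
    inner_op_times_C d_Hoch_app)

end

section \<open>Deformed cochains\<close>

lemma sum_fps_mult: "(x * y :: 'r::ring fps) $ n = (\<Sum>i\<le>n. x $ i * y $ (n - i))"
  by (simp add: fps_mult_nth atLeast0AtMost)

lemma eps_shift_minus: "eps_shift (- y) = - eps_shift y" for y :: "'y::ab_group_add fps"
  by (rule fps_ext) (simp add: eps_shift_def split: nat.split)

lemma eps_linear_sgn: "eps_linear T \<Longrightarrow> eps_linear (\<lambda>x. sgn_power n (T x))"
  by (simp add: eps_linear_def sgn_power_def eps_shift_minus)

context relative_cochains
begin

definition C_eps :: "nat \<Rightarrow> ('a, 'e) cochain_ring fps set" where
  "C_eps n = {x. \<forall>i. x $ i \<in> C n}"

definition app_eps :: "('a, 'e) cochain_ring fps \<Rightarrow> ('a, 'e) cochain fps" where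
  "app_eps x = Abs_fps (\<lambda>i. app (x $ i))"

definition scalar_eps :: "'k fps \<Rightarrow> ('a, 'e) cochain_ring fps" where
  "scalar_eps c = Abs_fps (\<lambda>i. scalar (c $ i))"

lemma app_eps_nth [simp]: "app_eps x $ i = app (x $ i)"
  by (simp add: app_eps_def)

lemma scalar_eps_nth [simp]: "scalar_eps c $ i = scalar (c $ i)"
  by (simp add: scalar_eps_def)

lemma C_epsD: "x \<in> C_eps n \<Longrightarrow> x $ i \<in> C n"
  by (simp add: C_eps_def)

lemma app_eps_inject: "app_eps x = app_eps y \<longleftrightarrow> x = y"
  by (simp add: fps_eq_iff app_inject)

lemma app_eps_C_eps: "app_eps ` C_eps n = eps_cochains \<iota> act n"
proof
  show "app_eps ` C_eps n \<subseteq> eps_cochains \<iota> act n" by (auto simp: C_eps_def C_def eps_cochains_def)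
  show "eps_cochains \<iota> act n \<subseteq> app_eps ` C_eps n"
  proof
    fix \<alpha> assume \<alpha>: "\<alpha> \<in> eps_cochains \<iota> act n"
    have "\<alpha> = app_eps (Abs_fps (\<lambda>i. Abs_cochain_ring (\<alpha> $ i)))"
      using \<alpha> by (intro fps_ext) (auto simp: eps_cochains_def app_Abs_cochain[of _ n])
    moreover have "Abs_fps (\<lambda>i. Abs_cochain_ring (\<alpha> $ i)) \<in> C_eps n"
      using \<alpha> by (auto simp: C_eps_def eps_cochains_def Abs_cochain_mem)
    ultimately show "\<alpha> \<in> app_eps ` C_eps n" by blast
  qed
qed

lemma scalar_zero: "scalar 0 = 0"
  by (rule additive_map_zero[OF additive_scalar])

lemma scalar_eps_const: "scalar_eps (fps_const c) = fps_const (scalar c)"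
  by (rule fps_ext) (simp add: scalar_zero)

lemma C_eps_times: "x \<in> C_eps m \<Longrightarrow> y \<in> C_eps n \<Longrightarrow> x * y \<in> C_eps (m + n)"
  by (auto simp: C_eps_def sum_fps_mult intro!: sum_mem_C times_mem_C)

lemma C_eps_add: "x \<in> C_eps n \<Longrightarrow> y \<in> C_eps n \<Longrightarrow> x + y \<in> C_eps n"
  by (auto simp: C_eps_def add_mem_C)

lemma C_eps_minus: "x \<in> C_eps n \<Longrightarrow> - x \<in> C_eps n"
  by (auto simp: C_eps_def minus_mem_C)

lemma C_eps_const: "x \<in> C n \<Longrightarrow> fps_const x \<in> C_eps n"
  by (auto simp: C_eps_def zero_mem_C)

lemma scalar_eps_mem: "scalar_eps c \<in> C_eps 0"
  by (simp add: C_eps_def scalar_mem_C)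

lemma times_scalar_eps: "x \<in> C_eps n \<Longrightarrow> x * scalar_eps c = scalar_eps c * x"
  using sum_atMost_rev[of "\<lambda>i j. x $ i * scalar (c $ j)"]
  by (intro fps_ext) (simp add: sum_fps_mult times_scalar[OF C_epsD])

lemma scalar_eps_minus_one_times: "scalar_eps (- 1) * x = - x"
proof -
  have "(- 1 :: 'k fps) = fps_const (- 1)" by (simp flip: fps_const_neg)
  then have "scalar_eps (- 1) = fps_const (scalar (- 1))" by (simp only: scalar_eps_const)
  then show ?thesis by (intro fps_ext) (simp add: scalar_minus_one_times)
qed

lemma app_scalar_eps_times: "app_eps (scalar_eps c * x) = eps_scale (k_on_cochain \<iota> act) c (app_eps x)"
  by (intro fps_ext)
    (simp add: sum_fps_mult eps_scale_nth fun_eq_iff app_sum scalar_times sum_fun_apply k_on_cochain_def)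

lemma inner_op_C0: "x \<in> C 0 \<Longrightarrow> inner_op B x = 0"
  by (intro cochain_ring_eqI) (simp add: inner_op.rep_eq inner_alternating_degree_0 C_length)

end

locale quantized_cochains = relative_cochains \<iota> act
  for \<iota> :: "'k::field_char_0 \<Rightarrow> 'a::comm_ring_1" and act :: "'a \<Rightarrow> 'e::ab_group_add \<Rightarrow> 'e" +
  fixes \<alpha>X :: "('a \<Rightarrow> 'a \<Rightarrow> 'a) fps"
  assumes \<alpha>X_zero: "\<alpha>X $ 0 = 0"
    and \<alpha>X_bilinear: "bilinear_on_A (\<alpha>X $ i)"
    and star_assoc: "star \<alpha>X (star \<alpha>X a b) c = star \<alpha>X a (star \<alpha>X b c)"
begin

text \<open>The product of A is the coefficient of order zero. It is the full star product that is
  associative, and so its contraction operator that has square zero.\<close>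

definition B :: "('a \<Rightarrow> 'a \<Rightarrow> 'a) fps" where
  "B = fps_const (*) + \<alpha>X"

lemma bilinear_B: "bilinear_on_A (B $ i)"
proof -
  have "B $ i = (if i = 0 then (*) else \<alpha>X $ i)"
    by (auto simp: B_def \<alpha>X_zero fun_eq_iff)
  then show ?thesis using \<alpha>X_bilinear[of i] bilinear_mult by simp
qed

lemma biadditive_B: "biadditive (B $ i)"
  using bilinear_B[of i]
  by (auto simp: bilinear_on_A_def biadditive_def additive_map_def module_hom_iff fun_eq_iff)

lemma star_eq: "star \<alpha>X a b = eps_app (eps_app B a) b"
proof -
  have "eps_app (eps_app (fps_const (*)) a) b = a * b"
    by (intro fps_ext) (simp add: eps_app_const2_nth fps_mult_nth atLeast0AtMost)
  then show ?thesis by (simp add: star_def B_def eps_app_add_left)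
qed

lemma star_const: "star \<alpha>X (fps_const a) (fps_const b) = Abs_fps (\<lambda>i. (B $ i) a b)"
  unfolding star_eq by (rule eps_app_bi_const) (rule biadditive_B)

lemma B_assoc: "(\<Sum>i\<le>M. (B $ (M - i)) ((B $ i) x y) z) = (\<Sum>i\<le>M. (B $ i) x ((B $ (M - i)) y z))"
proof -
  have add: "additive_map (B $ i)" "additive_map ((B $ i) u)" for i u
    using biadditive_B[of i] by (auto simp: biadditive_def)
  have "star \<alpha>X (Abs_fps f) (fps_const z) $ M = (\<Sum>i\<le>M. (B $ i) (f (M - i)) z)" for f
    unfolding star_eq
    by (subst eps_app_const_right)
      (use add in \<open>auto simp: eps_app_nth sum_fun_apply additive_map_def sum.distrib\<close>)
  moreover have "star \<alpha>X (fps_const x) v $ M = (\<Sum>i\<le>M. (B $ i) x (v $ (M - i)))" for v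
    unfolding star_eq by (subst eps_app_const_right) (auto simp: add eps_app_nth)
  ultimately have "(\<Sum>i\<le>M. (B $ i) ((B $ (M - i)) x y) z) = (\<Sum>i\<le>M. (B $ i) x ((B $ (M - i)) y z))"
    using arg_cong[OF star_assoc[of "fps_const x" "fps_const y" "fps_const z"], of "\<lambda>u. u $ M"]
    unfolding star_const by simp
  then show ?thesis using sum_atMost_rev[of "\<lambda>i j. (B $ i) ((B $ j) x y) z" M] by simp
qed

text \<open>
  With \<open>D\<close> the alternating inner sum for the star product instead of the product of \<open>A\<close>, the
  operation \<open>\<ell>\<^sub>1\<close> is the graded commutator with the undeformed action plus \<open>D\<close>.
\<close>

definition D :: "('a, 'e) cochain_ring fps \<Rightarrow> ('a, 'e) cochain_ring fps" where
  "D = eps_app (Abs_fps (\<lambda>i. inner_op (B $ i)))"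

lemma D_nth: "D x $ n = (\<Sum>i\<le>n. inner_op (B $ i) (x $ (n - i)))"
  by (simp add: D_def eps_app_nth)

lemma eps_linear_D: "eps_linear D"
  unfolding D_def by (rule eps_linear_eps_app) (simp add: additive_inner_op)

lemma D_const: "D (fps_const c) = Abs_fps (\<lambda>n. inner_op (B $ n) c)"
  unfolding D_def by (subst eps_app_const_right) (simp_all add: additive_inner_op)

lemma D_add: "D (x + y) = D x + D y"
  using eps_linear_D by (simp add: eps_linear_def)

lemma D_mem: "x \<in> C_eps n \<Longrightarrow> D x \<in> C_eps (n + 1)"
  unfolding C_eps_def mem_Collect_eq D_nth
  by (intro allI sum_mem_C inner_op_mem_C bilinear_B) simp

lemma D_D:
  assumes "x \<in> C_eps n"
  shows "D (D x) = 0"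
proof -
  have "D (D (fps_const (x $ i))) = 0" for i
  proof (rule fps_ext)
    fix M
    show "D (D (fps_const (x $ i))) $ M = 0 $ M"
      using inner_op_square[OF B_assoc C_epsD[OF assms]] unfolding D_const by (simp add: D_nth)
  qed
  then show ?thesis
    by (rule eps_linear_eqI[where x = x, OF eps_linear_compose[OF eps_linear_D eps_linear_D] eps_linear_zero])
qed

text \<open>For constants this is the Leibniz rule of each contraction operator
  \<open>inner_op (B $ n)\<close>; then y and finally x become arbitrary series. Every coefficient
  of x lies in \<open>C p\<close>, so the sign is the same throughout.\<close>

lemma D_mult:
  assumes x: "x \<in> C_eps p"
  shows "D (x * y) = D x * y + sgn_power p (x * D y)"
proof -
  note left = eps_linear_compose[OF eps_linear_D eps_linear_mult_left]
    eps_linear_add[OF eps_linear_compose[OF eps_linear_mult_left eps_linear_D]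
      eps_linear_sgn[OF eps_linear_mult_left]]
  note right = eps_linear_compose[OF eps_linear_D eps_linear_mult_right]
    eps_linear_add[OF eps_linear_mult_right
      eps_linear_sgn[OF eps_linear_compose[OF eps_linear_mult_right eps_linear_D]]]
  have 1: "D (fps_const (x $ i) * fps_const c) = D (fps_const (x $ i)) * fps_const c
      + sgn_power p (fps_const (x $ i) * D (fps_const c))" for c i
    using inner_op_times_C[OF C_epsD[OF x]]
    by (intro fps_ext) (simp add: D_const sgn_power_def)
  have 2: "D (fps_const (x $ i) * y) = D (fps_const (x $ i)) * y
      + sgn_power p (fps_const (x $ i) * D y)" for i
    by (rule eps_linear_eqI[where x = y, OF right]) (rule 1)
  show ?thesis
    by (rule eps_linear_eqI[where x = x, OF left]) (rule 2)
qed

lemma D_C0: "x \<in> C_eps 0 \<Longrightarrow> D x = 0"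
  by (intro fps_ext) (simp add: D_nth inner_op_C0[OF C_epsD])

definition mult_eps :: "('a, 'e) cochain_ring fps" where
  "mult_eps = fps_const mult_action"

lemma mult_eps_mem: "mult_eps \<in> C_eps 1"
  unfolding mult_eps_def by (rule C_eps_const[OF mult_action_mem])

lemma ell2_app_eps:
  assumes "x \<in> C_eps k" and "y \<in> C_eps l"
  shows "ell2 \<iota> act k l (app_eps x) (app_eps y) = app_eps (x * y - sgn_power (k * l) (y * x))"
proof (rule fps_ext)
  fix n
  have "ell2 \<iota> act k l (app_eps x) (app_eps y) $ n =
      (\<Sum>i\<le>n. app (x $ i * y $ (n - i) - sgn_power (k * l) (y $ (n - i) * x $ i)))"
    unfolding ell2_def eps_app_const2_nth using assms by (simp add: gerst_app C_epsD)
  also have "\<dots> = app (\<Sum>i\<le>n. x $ i * y $ (n - i) - sgn_power (k * l) (y $ (n - i) * x $ i))"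
    by (intro ext) (simp add: app_sum sum_fun_apply)
  also have "(\<Sum>i\<le>n. x $ i * y $ (n - i) - sgn_power (k * l) (y $ (n - i) * x $ i)) =
      (x * y - sgn_power (k * l) (y * x)) $ n"
    using sum_atMost_rev[of "\<lambda>i j. y $ i * x $ j" n]
    by (auto simp: sgn_power_def sum_subtractf sum.distrib sum_fps_mult sum_negf)
  finally show "ell2 \<iota> act k l (app_eps x) (app_eps y) $ n =
      app_eps (x * y - sgn_power (k * l) (y * x)) $ n" by (simp add: fun_eq_iff)
qed

lemma ell1_app_eps:
  assumes x: "x \<in> C_eps n"
  shows "ell1 \<iota> act \<alpha>X n (app_eps x) = app_eps (mult_eps * x - sgn_power n (x * mult_eps) + D x)"
proof (rule fps_ext)
  fix i
  have "inner_op (B $ j) y = inner_op (fps_const (*) $ j) y + inner_op (\<alpha>X $ j) y" if "y \<in> C n" for j y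
    unfolding B_def fps_add_nth by (rule inner_op_add_left[OF that])
  then have "D x $ i = (\<Sum>j\<le>i. inner_op (fps_const (*) $ j) (x $ (i - j)) + inner_op (\<alpha>X $ j) (x $ (i - j)))"
    unfolding D_nth using C_epsD[OF x] by simp
  also have "\<dots> = (\<Sum>j\<le>i. inner_op (fps_const (*) $ j) (x $ (i - j))) + (\<Sum>j\<le>i. inner_op (\<alpha>X $ j) (x $ (i - j)))"
    by (rule sum.distrib)
  also have "(\<Sum>j\<le>i. inner_op (fps_const (*) $ j) (x $ (i - j))) = (\<Sum>j\<le>i. if j = 0 then inner_op (*) (x $ i) else 0)"
    by (rule sum.cong) (auto simp: inner_op_zero_left[OF C_epsD[OF x]])
  finally have "D x $ i = inner_op (*) (x $ i) + (\<Sum>j\<le>i. inner_op (\<alpha>X $ j) (x $ (i - j)))" by simp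
  then show "ell1 \<iota> act \<alpha>X n (app_eps x) $ i =
      app_eps (mult_eps * x - sgn_power n (x * mult_eps) + D x) $ i"
    using C_epsD[OF x]
    by (auto simp: ell1_def eps_app_const_left eps_app_nth d_Hoch_app inner_sum_app sum_fun_apply
        fun_eq_iff app_sum mult_eps_def sgn_power_def)
qed

lemma deformed_model:
  "graded_ring_model (eps_scale (k_on_cochain \<iota> act)) app_eps C_eps scalar_eps (ell2 \<iota> act)
     mult_eps D (ell1 \<iota> act \<alpha>X)"
proof (intro graded_ring_model.intro)
  show "module (eps_scale (k_on_cochain \<iota> act))" by (rule module_eps_scale[OF module_k_on_cochain])
  fix x n and c :: "'k fps" assume x: "x \<in> C_eps n"
  \<comment> \<open>\<open>scalar_eps c\<close> has degree 0, where there is nothing to contract, so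
    only one term of the Leibniz rule remains.\<close>
  show "D (scalar_eps c * x) = scalar_eps c * D x"
    using D_mult[OF scalar_eps_mem] D_C0[OF scalar_eps_mem] by (simp add: sgn_power_def)
  show "scalar_eps c * x \<in> C_eps n" using C_eps_times[OF scalar_eps_mem x] by simp
qed (simp_all add: C_eps_add C_eps_times times_scalar_eps scalar_eps_minus_one_times ell2_app_eps
    ell1_app_eps mult_eps_mem[simplified] D_mem[simplified] D_add D_mult app_scalar_eps_times C_eps_const D_D
    fps_eq_iff fun_eq_iff, simp add: C_eps_def zero_mem_C)

text \<open>On a pair (a, b) the square of the action gives a(b e), and the order zero part of
  \<open>D mult_eps\<close> gives -(ab)e. They cancel because E is a module over A, and
  -\<alpha>X(a,b)e is left.\<close>

lemma ell0_app_eps: "ell0 act \<alpha>X = app_eps (mult_eps * mult_eps + D mult_eps)"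
proof (intro fps_ext ext)
  fix i as e
  show "(ell0 act \<alpha>X $ i) as e = (app_eps (mult_eps * mult_eps + D mult_eps) $ i) as e"
  proof (cases "length as = 2")
    case True
    then obtain a b where as: "as = [a, b]" by (auto simp: numeral_2_eq_2 length_Suc_conv)
    have "app (mult_action * mult_action) as e = act a (act b e)"
      by (subst app_times_homogeneous[OF mult_action_mem]) (simp add: as app_mult_action)
    moreover have "app (inner_op f mult_action) as e = - act (f a b) e" for f
      by (simp add: inner_op.rep_eq app_mult_action as)
    ultimately show ?thesis
      by (auto simp: ell0_def as mult_eps_def D_const B_def \<alpha>X_zero)
  next
    case False
    have "mult_eps * mult_eps + D mult_eps \<in> C_eps 2"
      using C_eps_add[OF C_eps_times[OF mult_eps_mem mult_eps_mem] D_mem[OF mult_eps_mem]]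
      by (simp add: numeral_2_eq_2)
    from C_length[OF C_epsD[OF this] False] False show ?thesis by (simp add: ell0_def)
  qed
qed

lemma curved_dg:
  "curved_dg_lie_algebra (eps_scale (k_on_cochain \<iota> act)) (eps_cochains \<iota> act)
     (ell2 \<iota> act) (ell1 \<iota> act \<alpha>X) (ell0 act \<alpha>X)"
  using graded_ring_model.curved[OF deformed_model] unfolding app_eps_C_eps ell0_app_eps .

text \<open>In degree 1 the bracket of x with itself is x x + x x, so the factor 1/2 leaves x x, the
  last term in the expansion of the square.\<close>

lemma maurer_cartan_iff:
  assumes x: "x \<in> C_eps 1"
  shows "maurer_cartan \<iota> act \<alpha>X (app_eps x) \<longleftrightarrow>
    (mult_eps + x) * (mult_eps + x) + D (mult_eps + x) = 0"
proof -
  have half: "scalar_eps (fps_const (1/2)) * (y + y) = y" for y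
  proof -
    have "scalar (1/2) + scalar (1/2) = scalar 1" by (simp flip: scalar_add)
    then have "scalar (1/2) * (z + z) = z" for z
      using scalar_one_times[of z] by (simp add: distrib_left flip: distrib_right)
    then show ?thesis by (intro fps_ext) (simp add: scalar_eps_const)
  qed
  have "eps_scale (k_on_cochain \<iota> act) (fps_const (1/2)) (ell2 \<iota> act 1 1 (app_eps x) (app_eps x)) =
      app_eps (x * x)"
    unfolding ell2_app_eps[OF x x] app_scalar_eps_times[symmetric] by (simp add: sgn_power_def half)
  moreover have "app_eps u + app_eps v = app_eps (u + v)" for u v
    by (simp add: fps_eq_iff fun_eq_iff)
  moreover have "app_eps u = 0 \<longleftrightarrow> u = 0" for u
    using app_eps_inject[of u 0] by (simp add: fps_eq_iff fun_eq_iff)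
  ultimately show ?thesis
    unfolding maurer_cartan_def ell0_app_eps ell1_app_eps[OF x]
    by (simp add: sgn_power_def D_add algebra_simps)
qed

section \<open>Actions on power series given by cochains of degree 1\<close>

definition cochain_action :: "('a, 'e) cochain_ring fps \<Rightarrow> 'a fps \<Rightarrow> 'e fps \<Rightarrow> 'e fps" where
  "cochain_action x a e = eps_app (eps_app (Abs_fps (\<lambda>i u. app (x $ i) [u])) a) e"

lemma biadditive_C1: "x \<in> C 1 \<Longrightarrow> biadditive (\<lambda>u. app x [u])"
  by (auto simp: C_iff biadditive_def additive_map_def fun_eq_iff hom_AE_iff hom_E_iff)

context
  fixes x assumes x: "x \<in> C_eps 1"
begin

lemma biadditive_cochain_action: "biadditive (Abs_fps (\<lambda>i u. app (x $ i) [u]) $ i)"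
  using biadditive_C1[OF C_epsD[OF x]] by simp

lemma eps_linear_cochain_action:
  "eps_linear (\<lambda>a. cochain_action x a e)" "eps_linear (cochain_action x a)"
  unfolding cochain_action_def
  by (rule eps_linear_bi_left eps_linear_bi_right, rule biadditive_cochain_action)+

lemma cochain_action_const:
  "cochain_action x (fps_const a) (fps_const e) = Abs_fps (\<lambda>n. app (x $ n) [a] e)"
  unfolding cochain_action_def by (subst eps_app_bi_const) (use biadditive_cochain_action in auto)

lemma cochain_action_nth:
  "cochain_action x (fps_const a) e $ n = (\<Sum>i\<le>n. app (x $ i) [a] (e $ (n - i)))"
  "cochain_action x b (fps_const f) $ n = (\<Sum>i\<le>n. app (x $ i) [b $ (n - i)] f)"
proof -
  have add: "additive_map (\<lambda>u. app (x $ i) [u])" for i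
    using biadditive_cochain_action[of i] by (simp add: biadditive_def)
  show "cochain_action x (fps_const a) e $ n = (\<Sum>i\<le>n. app (x $ i) [a] (e $ (n - i)))"
    unfolding cochain_action_def by (subst eps_app_const_right) (auto simp: add eps_app_nth)
  show "cochain_action x b (fps_const f) $ n = (\<Sum>i\<le>n. app (x $ i) [b $ (n - i)] f)"
    unfolding cochain_action_def
    by (subst eps_app_const_right)
      (auto simp: eps_app_nth sum_fun_apply additive_map_def sum.distrib app_add_arg)
qed

text \<open>Linearity over k[[\<epsilon>]] comes from the k-linearity of each coefficient of x on
  constants; the two arguments and the scalar are then freed one at a time.\<close>

lemma cochain_action_hom:
  "module_hom (eps_scale (k_on_E \<iota> act)) (eps_scale (k_on_E \<iota> act)) (cochain_action x a)"
  "module_hom (eps_scale (k_on_A \<iota>)) (eps_scale (k_on_E \<iota> act)) (\<lambda>a. cochain_action x a e)"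
proof -
  note lin = eps_linear_cochain_action
  note scE = eps_linear_eps_scale[OF module_k_on_E]
  note scA = eps_linear_eps_scale[OF module_k_on_A]
  have coeff: "app (x $ n) [b] (k_on_E \<iota> act d f) = k_on_E \<iota> act d (app (x $ n) [b] f)"
    "app (x $ n) [k_on_A \<iota> d b] f = k_on_E \<iota> act d (app (x $ n) [b] f)" for n b d f
    using C_epsD[OF x, of n] by (auto simp: C_iff hom_E_iff hom_AE_iff)
  have scn: "eps_scale (k_on_E \<iota> act) (fps_const d) v = Abs_fps (\<lambda>n. k_on_E \<iota> act d (v $ n))" for d v
  proof (rule fps_ext)
    fix n
    have "eps_scale (k_on_E \<iota> act) (fps_const d) v $ n = (\<Sum>i\<le>n. if i = 0 then k_on_E \<iota> act d (v $ n) else 0)"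
      unfolding eps_scale_nth by (rule sum.cong) auto
    then show "eps_scale (k_on_E \<iota> act) (fps_const d) v $ n = Abs_fps (\<lambda>n. k_on_E \<iota> act d (v $ n)) $ n"
      by simp
  qed
  have base: "cochain_action x (fps_const b) (eps_scale (k_on_E \<iota> act) (fps_const d) (fps_const f)) =
      eps_scale (k_on_E \<iota> act) (fps_const d) (cochain_action x (fps_const b) (fps_const f))"
    "cochain_action x (eps_scale (k_on_A \<iota>) (fps_const d) (fps_const b)) (fps_const f) =
      eps_scale (k_on_E \<iota> act) (fps_const d) (cochain_action x (fps_const b) (fps_const f))" for b d f
    unfolding eps_scale_const_const[OF module_k_on_E] eps_scale_const_const[OF module_k_on_A]
    unfolding cochain_action_const coeff scn
    by simp_all
  have E: "cochain_action x a (eps_scale (k_on_E \<iota> act) c e) = eps_scale (k_on_E \<iota> act) c (cochain_action x a e)" for a c e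
  proof -
    have 1: "cochain_action x (fps_const b) (eps_scale (k_on_E \<iota> act) (fps_const d) e) =
      eps_scale (k_on_E \<iota> act) (fps_const d) (cochain_action x (fps_const b) e)" for b d
      by (rule eps_linear_eqI[where x = e]) (intro eps_linear_compose[OF lin(2) scE(2)] eps_linear_compose[OF scE(2) lin(2)] base)+
    have 2: "cochain_action x a (eps_scale (k_on_E \<iota> act) (fps_const d) e) =
      eps_scale (k_on_E \<iota> act) (fps_const d) (cochain_action x a e)" for d
      by (rule eps_linear_eqI[where x = a]) (intro lin(1) eps_linear_compose[OF scE(2) lin(1)] 1)+
    show ?thesis
      by (rule eps_linear_eqI[where x = c]) (intro scE(1) eps_linear_compose[OF lin(2) scE(1)] 2)+
  qed
  have A: "cochain_action x (eps_scale (k_on_A \<iota>) c a) e = eps_scale (k_on_E \<iota> act) c (cochain_action x a e)" for a c e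
  proof -
    have 1: "cochain_action x (eps_scale (k_on_A \<iota>) (fps_const d) (fps_const b)) e =
      eps_scale (k_on_E \<iota> act) (fps_const d) (cochain_action x (fps_const b) e)" for b d
      by (rule eps_linear_eqI[where x = e]) (intro lin(2) eps_linear_compose[OF scE(2) lin(2)] base)+
    have 2: "cochain_action x (eps_scale (k_on_A \<iota>) (fps_const d) a) e =
      eps_scale (k_on_E \<iota> act) (fps_const d) (cochain_action x a e)" for d
      by (rule eps_linear_eqI[where x = a])
        (intro eps_linear_compose[OF lin(1) scA(2)] eps_linear_compose[OF scE(2) lin(1)] 1)+
    show ?thesis
      by (rule eps_linear_eqI[where x = c]) (intro scE(1) eps_linear_compose[OF lin(1) scA(1)] 2)+
  qed
  show "module_hom (eps_scale (k_on_E \<iota> act)) (eps_scale (k_on_E \<iota> act)) (cochain_action x a)"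
    using lin(2) E by (auto simp: module_hom_iff module_eps_scale module_k_on_E eps_linear_def)
  show "module_hom (eps_scale (k_on_A \<iota>)) (eps_scale (k_on_E \<iota> act)) (\<lambda>a. cochain_action x a e)"
    using lin(1) A by (auto simp: module_hom_iff module_eps_scale module_k_on_E module_k_on_A eps_linear_def)
qed

text \<open>On constants a, b, e the coefficients of x x + D x are those of a(b e) minus (a star
  b)e, the minus sign being that of a contraction in first position. The passage from constants to
  series uses that both sides are linear in each argument.\<close>

lemma cochain_action_assoc_iff:
  "(\<forall>a b e. cochain_action x (star \<alpha>X a b) e = cochain_action x a (cochain_action x b e)) \<longleftrightarrow>
   x * x + D x = 0"
proof -
  note lin = eps_linear_cochain_action
  have prod: "app ((x * x + D x) $ n) [a, b] e =
      cochain_action x (fps_const a) (cochain_action x (fps_const b) (fps_const e)) $ n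
      - cochain_action x (star \<alpha>X (fps_const a) (fps_const b)) (fps_const e) $ n" for a b e n
  proof -
    have "app (x $ i * x $ j) [a, b] e = app (x $ i) [a] (app (x $ j) [b] e)" for i j
      by (subst app_times_homogeneous[OF C_epsD[OF x]]) simp
    moreover have "app (inner_op f z) [a, b] e = - app z [f a b] e" for f z
      by (simp add: inner_op.rep_eq)
    ultimately show ?thesis
      using sum_atMost_rev[of "\<lambda>i j. app (x $ i) [(B $ j) a b] e" n]
      by (simp add: sum_fps_mult D_nth app_sum cochain_action_nth cochain_action_const star_const sum_negf)
  qed
  show ?thesis
  proof
    assume assoc: "\<forall>a b e. cochain_action x (star \<alpha>X a b) e = cochain_action x a (cochain_action x b e)"
    show "x * x + D x = 0"
    proof (intro fps_ext cochain_ring_eqI)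
      fix n as e
      \<comment> \<open>The element has degree 2, so it vanishes on every list that is not a
        pair.\<close>
      have mem: "x * x + D x \<in> C_eps 2"
        using C_eps_add[OF C_eps_times[OF x x] D_mem[OF x]] by (simp add: numeral_2_eq_2)
      show "app ((x * x + D x) $ n) as e = app (0 $ n) as e"
      proof (cases "length as = 2")
        case True
        then obtain a b where "as = [a, b]" by (auto simp: numeral_2_eq_2 length_Suc_conv)
        then show ?thesis using prod assoc by simp
      qed (simp add: C_length[OF C_epsD[OF mem]] del: fps_add_nth)
    qed
  next
    assume zero: "x * x + D x = 0"
    note star_lin = eps_linear_bi_left[OF biadditive_B, folded star_eq]
      eps_linear_bi_right[OF biadditive_B, folded star_eq]
    have 1: "cochain_action x (star \<alpha>X (fps_const a) (fps_const b)) (fps_const e) =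
        cochain_action x (fps_const a) (cochain_action x (fps_const b) (fps_const e))" for a b e
      using prod[of _ a b e] unfolding zero by (intro fps_ext) simp
    have 2: "cochain_action x (star \<alpha>X (fps_const a) (fps_const b)) e =
        cochain_action x (fps_const a) (cochain_action x (fps_const b) e)" for a b e
      by (rule eps_linear_eqI[where x = e]) (intro lin(2) eps_linear_compose[OF lin(2) lin(2)] 1)+
    have 3: "cochain_action x (star \<alpha>X (fps_const a) b) e =
        cochain_action x (fps_const a) (cochain_action x b e)" for a b e
      by (rule eps_linear_eqI[where x = b])
        (intro eps_linear_compose[OF lin(1) star_lin(2)] eps_linear_compose[OF lin(2) lin(1)] 2)+
    have "cochain_action x (star \<alpha>X a b) e = cochain_action x a (cochain_action x b e)" for a b e
      by (rule eps_linear_eqI[where x = a])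
        (intro eps_linear_compose[OF lin(1) star_lin(1)] lin(1) 3)+
    then show "\<forall>a b e. cochain_action x (star \<alpha>X a b) e = cochain_action x a (cochain_action x b e)"
      by blast
  qed
qed

end

lemma module_action_app_eps: "module_action act (app_eps x) = cochain_action (mult_eps + x)"
proof (intro ext)
  fix a e
  have "Abs_fps (\<lambda>i u. app ((mult_eps + x) $ i) [u]) = fps_const act + Abs_fps (\<lambda>i u. app (x $ i) [u])"
    by (intro fps_ext) (auto simp: mult_eps_def app_mult_action fun_eq_iff)
  then show "module_action act (app_eps x) a e = cochain_action (mult_eps + x) a e"
    by (simp add: module_action_def cochain_action_def eps_app_add_left)
qed

lemma assoc_module_action_iff:
  assumes x: "x \<in> C_eps 1"
  shows "assoc_module_action \<iota> act \<alpha>X (module_action act (app_eps x)) \<longleftrightarrow>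
    maurer_cartan \<iota> act \<alpha>X (app_eps x)"
proof -
  have mx: "mult_eps + x \<in> C_eps 1" by (rule C_eps_add[OF mult_eps_mem x])
  show ?thesis
    unfolding assoc_module_action_def module_action_app_eps maurer_cartan_iff[OF x]
    using cochain_action_hom[OF mx] cochain_action_assoc_iff[OF mx] by simp
qed

text \<open>An element \<phi> of degree 0 sees no ring entry, so in \<phi> x and y \<phi> the single
  entry goes to x or y; evaluated at [a] and e the two products are the two sides of the
  intertwining law.\<close>

lemma gauge_equiv_actions_iff:
  assumes x: "x \<in> C_eps 1" and y: "y \<in> C_eps 1"
  shows "gauge_equiv_actions \<iota> act (cochain_action x) (cochain_action y) \<longleftrightarrow>
    (\<exists>\<phi>\<in>C_eps 0. \<phi> $ 0 = scalar 1 \<and> \<phi> * x = y * \<phi>)"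
proof -
  have iff: "(\<forall>a e. eps_app (Abs_fps (\<lambda>i. app (\<phi> $ i) [])) (cochain_action x a e) =
      cochain_action y a (eps_app (Abs_fps (\<lambda>i. app (\<phi> $ i) [])) e)) \<longleftrightarrow> \<phi> * x = y * \<phi>"
    if \<phi>: "\<phi> \<in> C_eps 0" for \<phi>
  proof -
    define T where "T = eps_app (Abs_fps (\<lambda>i. app (\<phi> $ i) []))"
    have T: "eps_linear T" unfolding T_def by (rule eps_linear_eps_app) (simp add: additive_app)
    note linx = eps_linear_cochain_action[OF x] and liny = eps_linear_cochain_action[OF y]
    have Tc: "T (fps_const e) = Abs_fps (\<lambda>n. app (\<phi> $ n) [] e)" for e
      unfolding T_def by (subst eps_app_const_right) (auto simp: additive_app)
    have 1: "app ((\<phi> * x) $ n) [a] e = T (cochain_action x (fps_const a) (fps_const e)) $ n" for n a e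
      by (simp add: sum_fps_mult app_sum app_times_homogeneous[OF C_epsD[OF \<phi>]] T_def eps_app_nth
          cochain_action_const[OF x])
    have 2: "app ((y * \<phi>) $ n) [a] e = cochain_action y (fps_const a) (T (fps_const e)) $ n" for n a e
      by (simp add: sum_fps_mult app_sum app_times_homogeneous[OF C_epsD[OF y]]
          cochain_action_nth[OF y] Tc)
    show ?thesis unfolding T_def[symmetric]
    proof
      assume eq: "\<forall>a e. T (cochain_action x a e) = cochain_action y a (T e)"
      show "\<phi> * x = y * \<phi>"
      proof (intro fps_ext cochain_ring_eqI)
        fix n as e
        show "app ((\<phi> * x) $ n) as e = app ((y * \<phi>) $ n) as e"
        proof (cases "length as = 1")
          case True
          then obtain a where "as = [a]" by (auto simp: length_Suc_conv)
          then show ?thesis using 1 2 eq by simp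
        next
          case False
          then show ?thesis
            using C_length[OF C_epsD[OF C_eps_times[OF \<phi> x]]] C_length[OF C_epsD[OF C_eps_times[OF y \<phi>]]]
            by simp
        qed
      qed
    next
      assume eq: "\<phi> * x = y * \<phi>"
      have 3: "T (cochain_action x (fps_const a) (fps_const e)) = cochain_action y (fps_const a) (T (fps_const e))" for a e
        using 1[of _ a e] 2[of _ a e] eq by (intro fps_ext) simp
      have 4: "T (cochain_action x (fps_const a) e) = cochain_action y (fps_const a) (T e)" for a e
        by (rule eps_linear_eqI[where x = e])
          (intro eps_linear_compose[OF T linx(2)] eps_linear_compose[OF liny(2) T] 3)+
      have "T (cochain_action x a e) = cochain_action y a (T e)" for a e
        by (rule eps_linear_eqI[where x = a]) (intro eps_linear_compose[OF T linx(1)] liny(1) 4)+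
      then show "\<forall>a e. T (cochain_action x a e) = cochain_action y a (T e)" by blast
    qed
  qed
  have unit: "(\<forall>e. app (\<phi> $ 0) [] e = e) \<longleftrightarrow> \<phi> $ 0 = scalar 1" if \<phi>: "\<phi> \<in> C_eps 0" for \<phi>
  proof
    assume 1: "\<forall>e. app (\<phi> $ 0) [] e = e"
    show "\<phi> $ 0 = scalar 1"
    proof (rule cochain_ring_eqI)
      fix as e show "app (\<phi> $ 0) as e = app (scalar 1) as e"
        using 1 C_length[OF C_epsD[OF \<phi>]] by (cases as) (auto simp: app_scalar)
    qed
  qed (simp add: app_scalar)
  have "gauge_equiv_actions \<iota> act (cochain_action x) (cochain_action y) \<longleftrightarrow>
     (\<exists>\<phi>\<in>C_eps 0. (\<forall>e. app (\<phi> $ 0) [] e = e) \<and>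
        (\<forall>a e. eps_app (Abs_fps (\<lambda>i. app (\<phi> $ i) [])) (cochain_action x a e) =
          cochain_action y a (eps_app (Abs_fps (\<lambda>i. app (\<phi> $ i) [])) e)))"
    unfolding gauge_equiv_actions_def app_eps_C_eps[symmetric] by auto
  then show ?thesis using iff unit by blast
qed

end

section \<open>Polynomial paths of cochains\<close>

context relative_cochains
begin

section \<open>Polynomials in t with cochain coefficients\<close>

lemma scalar_cancel:
  assumes "c \<noteq> 0" and "scalar c * x = 0"
  shows "x = 0"
proof -
  have "x = scalar (inverse c * c) * x" using assms(1) by (simp add: scalar_one_times)
  also have "\<dots> = scalar (inverse c) * (scalar c * x)" by (simp add: mult.assoc flip: scalar_mult)
  finally show ?thesis using assms(2) by simp
qed

text \<open>Polynomials in t are power series of finite support, so the noncommutative product of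
  cochains carries over to them.\<close>

definition C_poly :: "nat \<Rightarrow> ('a, 'e) cochain_ring fps set" where
  "C_poly n = {y \<in> C_eps n. \<exists>N. \<forall>j>N. y $ j = 0}"

lemma C_poly_C: "y \<in> C_poly n \<Longrightarrow> y $ j \<in> C n"
  by (simp add: C_poly_def C_eps_def)

lemma C_poly_bound: "y \<in> C_poly n \<Longrightarrow> \<exists>N. \<forall>j>N. y $ j = 0"
  by (simp add: C_poly_def)

lemma C_polyI: "(\<And>j. y $ j \<in> C n) \<Longrightarrow> (\<And>j. j > N \<Longrightarrow> y $ j = 0) \<Longrightarrow> y \<in> C_poly n"
  by (auto simp: C_poly_def C_eps_def)

lemma C_poly_add:
  assumes "x \<in> C_poly n" and "y \<in> C_poly n"
  shows "x + y \<in> C_poly n"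
proof -
  obtain N N' where "\<forall>j>N. x $ j = 0" "\<forall>j>N'. y $ j = 0" using assms C_poly_bound by meson
  then show ?thesis
    using assms by (intro C_polyI[where N = "max N N'"]) (auto simp: add_mem_C C_poly_C)
qed

lemma C_poly_minus: "x \<in> C_poly n \<Longrightarrow> - x \<in> C_poly n"
  using C_poly_bound[of x n] by (auto intro!: C_polyI minus_mem_C simp: C_poly_C)

lemma C_poly_zero: "0 \<in> C_poly n"
  by (rule C_polyI) (simp_all add: zero_mem_C)

lemma C_poly_sum: "(\<And>i. i \<in> S \<Longrightarrow> f i \<in> C_poly n) \<Longrightarrow> (\<Sum>i\<in>S. f i) \<in> C_poly n"
  by (induction S rule: infinite_finite_induct) (auto simp: C_poly_zero C_poly_add)

lemma C_poly_const: "x \<in> C n \<Longrightarrow> fps_const x \<in> C_poly n"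
  by (rule C_polyI[where N = 0]) (simp_all add: zero_mem_C)

lemma fps_times_eq_0_beyond:
  fixes x y :: "'r::ring fps"
  assumes x: "\<forall>j>N. x $ j = 0" and y: "\<forall>j>N'. y $ j = 0" and j: "j > N + N'"
  shows "(x * y) $ j = 0"
  unfolding sum_fps_mult
proof (rule sum.neutral, safe)
  fix i
  show "x $ i * y $ (j - i) = 0"
  proof (cases "i > N")
    case False
    then have "j - i > N'" using j by auto
    then show ?thesis using y by simp
  qed (use x in simp)
qed

lemma C_poly_times:
  assumes "x \<in> C_poly m" and "y \<in> C_poly n"
  shows "x * y \<in> C_poly (m + n)"
proof -
  obtain N N' where b: "\<forall>j>N. x $ j = 0" "\<forall>j>N'. y $ j = 0" using assms C_poly_bound by meson
  show ?thesis
    using assms fps_times_eq_0_beyond[OF b]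
    by (intro C_polyI[where N = "N + N'"]) (auto simp: C_poly_C sum_fps_mult intro!: sum_mem_C times_mem_C)
qed

text \<open>Summing over the support avoids a choice of degree bound; for infinite support the sum
  is 0 by convention.\<close>

definition eval_poly :: "'k \<Rightarrow> ('a, 'e) cochain_ring fps \<Rightarrow> ('a, 'e) cochain_ring" where
  "eval_poly t y = (\<Sum>j\<in>{j. y $ j \<noteq> 0}. scalar (t ^ j) * y $ j)"

lemma eval_poly_eq:
  assumes "\<forall>j>N. y $ j = 0"
  shows "eval_poly t y = (\<Sum>j\<le>N. scalar (t ^ j) * y $ j)"
  unfolding eval_poly_def
  by (rule sum.mono_neutral_left) (use assms linorder_not_less in auto)

lemma eval_poly_mem: "y \<in> C_poly n \<Longrightarrow> eval_poly t y \<in> C n"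
  unfolding eval_poly_def by (auto intro!: sum_mem_C scalar_times_mem C_poly_C)

lemma eval_poly_add:
  assumes "x \<in> C_poly m" and "y \<in> C_poly n"
  shows "eval_poly t (x + y) = eval_poly t x + eval_poly t y"
proof -
  obtain N N' where "\<forall>j>N. x $ j = 0" "\<forall>j>N'. y $ j = 0" using assms C_poly_bound by meson
  then have "\<forall>j>max N N'. x $ j = 0" "\<forall>j>max N N'. y $ j = 0" "\<forall>j>max N N'. (x + y) $ j = 0"
    by auto
  from this[THEN eval_poly_eq] show ?thesis by (simp add: sum.distrib distrib_left)
qed

lemma eval_poly_minus: "eval_poly t (- x) = - eval_poly t x"
  by (simp add: eval_poly_def sum_negf)

lemma eval_poly_zero: "eval_poly t 0 = 0"
  by (simp add: eval_poly_def)

lemma eval_poly_sum: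
  assumes "finite S" and "\<And>i. i \<in> S \<Longrightarrow> f i \<in> C_poly n"
  shows "eval_poly t (\<Sum>i\<in>S. f i) = (\<Sum>i\<in>S. eval_poly t (f i))"
  using assms
  by (induction S rule: finite_induct)
    (auto simp: eval_poly_zero eval_poly_add[where m = n and n = n] C_poly_sum)

lemma eval_poly_const: "eval_poly t (fps_const x) = x"
  by (subst eval_poly_eq[where N = 0]) (simp_all add: scalar_one_times)

lemma eval_poly_at_0: "y \<in> C_poly n \<Longrightarrow> eval_poly 0 y = y $ 0"
proof -
  assume "y \<in> C_poly n"
  then obtain N where N: "\<forall>j>N. y $ j = 0" using C_poly_bound by meson
  have "eval_poly 0 y = (\<Sum>j\<le>N. if j = 0 then y $ 0 else 0)"
    unfolding eval_poly_eq[OF N]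
    by (intro sum.cong) (auto simp: scalar_zero scalar_one_times power_0_left)
  then show ?thesis by simp
qed

text \<open>Evaluation is multiplicative because the powers of t are scalars and commute with the
  homogeneous coefficients.\<close>

lemma eval_poly_times:
  assumes x: "x \<in> C_poly m" and y: "y \<in> C_poly n"
  shows "eval_poly t (x * y) = eval_poly t x * eval_poly t y"
proof -
  obtain N N' where b: "\<forall>j>N. x $ j = 0" "\<forall>j>N'. y $ j = 0" using assms C_poly_bound by meson
  define g where "g i j = (scalar (t ^ i) * x $ i) * (scalar (t ^ j) * y $ j)" for i j
  have g: "scalar (t ^ (i + j)) * (x $ i * y $ j) = g i j" for i j
  proof -
    have "g i j = scalar (t ^ i) * (x $ i * scalar (t ^ j)) * y $ j" by (simp add: g_def mult.assoc)
    also have "\<dots> = (scalar (t ^ i) * scalar (t ^ j)) * (x $ i * y $ j)"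
      unfolding times_scalar[OF C_poly_C[OF x]] by (simp add: mult.assoc)
    finally show ?thesis by (simp add: scalar_mult power_add)
  qed
  have g0: "g i j = 0" if "\<not> (i \<le> N \<and> j \<le> N')" for i j
    using b that by (cases "i \<le> N") (auto simp: g_def)
  have "eval_poly t (x * y) = (\<Sum>k\<le>N + N'. \<Sum>i\<le>k. scalar (t ^ k) * (x $ i * y $ (k - i)))"
    using fps_times_eq_0_beyond[OF b]
    by (subst eval_poly_eq[where N = "N + N'"]) (auto simp: sum_fps_mult sum_distrib_left)
  also have "\<dots> = (\<Sum>k\<le>N + N'. \<Sum>i\<le>k. g i (k - i))"
  proof (intro sum.cong refl)
    fix k i :: nat assume "i \<in> {..k}"
    then show "scalar (t ^ k) * (x $ i * y $ (k - i)) = g i (k - i)"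
      using g[of i "k - i"] by simp
  qed
  also have "\<dots> = (\<Sum>(i, j)\<in>{(i, j). i + j \<le> N + N'}. g i j)"
    by (rule sum.triangle_reindex_eq[symmetric])
  \<comment> \<open>The rectangle lies inside the triangle i + j \<le> N + N', and g vanishes
    outside the rectangle.\<close>
  also have "\<dots> = (\<Sum>(i, j)\<in>{..N} \<times> {..N'}. g i j)"
  proof (rule sum.mono_neutral_right)
    have "{(i, j). i + j \<le> N + N'} \<subseteq> {..N + N'} \<times> {..N + N'}" by auto
    then show "finite {(i, j). i + j \<le> N + N'}" by (rule finite_subset) simp
    show "\<forall>p\<in>{(i, j). i + j \<le> N + N'} - {..N} \<times> {..N'}. (case p of (i, j) \<Rightarrow> g i j) = 0"
      using g0 by auto
  qed auto
  also have "\<dots> = eval_poly t x * eval_poly t y"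
    by (simp add: eval_poly_eq[OF b(1)] eval_poly_eq[OF b(2)] sum_product sum.cartesian_product g_def)
  finally show ?thesis .
qed

text \<open>A polynomial with values in a vector space that vanishes at every point of k has zero
  coefficients. Instead of counting roots, the induction lowers the degree bound by comparing values
  at t and 2t.\<close>

lemma eval_poly_eq_0_imp:
  assumes y: "y \<in> C_poly n" and zero: "\<And>t. eval_poly t y = 0"
  shows "y = 0"
proof -
  have "y = 0" if "\<forall>j\<ge>N. y $ j = 0" "\<And>t. eval_poly t y = 0" for y and N
    using that
  proof (induction N arbitrary: y)
    case 0
    then show ?case by (simp add: fps_eq_iff)
  next
    case (Suc N)
    \<comment> \<open>z is y(2t) - 2^N y(t): the coefficient at N is removed, and each lower one is
      multiplied by 2^j - 2^N, which is nonzero in characteristic zero.\<close>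
    define z where "z = Abs_fps (\<lambda>j. scalar (2 ^ j - 2 ^ N) * y $ j)"
    have ev: "eval_poly t u = (\<Sum>j\<le>N. scalar (t ^ j) * u $ j)" if "\<forall>j\<ge>Suc N. u $ j = 0" for t u
      using that by (intro eval_poly_eq) auto
    have z0: "\<forall>j\<ge>N. z $ j = 0"
      using Suc.prems(1) by (auto simp: z_def scalar_zero) (metis le_antisym not_less_eq_eq scalar_zero mult_zero_left mult_zero_right diff_self)
    have "z = 0"
    proof (rule Suc.IH[OF z0])
      fix t
      have "scalar (t ^ j) * z $ j = scalar ((2 * t) ^ j) * y $ j - scalar (2 ^ N) * (scalar (t ^ j) * y $ j)" for j
      proof -
        have "scalar (t ^ j) * z $ j = scalar (t ^ j * (2 ^ j - 2 ^ N)) * y $ j"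
          by (simp add: z_def mult.assoc flip: scalar_mult)
        also have "t ^ j * (2 ^ j - 2 ^ N) = (2 * t) ^ j - 2 ^ N * t ^ j"
          by (simp add: algebra_simps)
        finally show ?thesis
          by (simp add: additive_map_diff[OF additive_scalar] left_diff_distrib mult.assoc flip: scalar_mult)
      qed
      then have "eval_poly t z = eval_poly (2 * t) y - scalar (2 ^ N) * eval_poly t y"
        using z0 Suc.prems(1) by (simp add: ev sum_subtractf sum_distrib_left)
      then show "eval_poly t z = 0" using Suc.prems(2) by simp
    qed
    have low: "y $ j = 0" if "j < N" for j
    proof (rule scalar_cancel)
      have "(of_nat (2 ^ j) :: 'k) \<noteq> of_nat (2 ^ N)" using that unfolding of_nat_eq_iff by simp
      then show "(2 ^ j - 2 ^ N :: 'k) \<noteq> 0" by simp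
      show "scalar (2 ^ j - 2 ^ N) * y $ j = 0"
        using \<open>z = 0\<close> by (auto simp: z_def fps_eq_iff)
    qed
    \<comment> \<open>With the lower coefficients gone, the value at t = 1 is the top
      coefficient.\<close>
    have "eval_poly 1 y = (\<Sum>j\<le>N. if j = N then y $ N else 0)"
      unfolding ev[OF Suc.prems(1)] using low by (intro sum.cong) (auto simp: scalar_one_times)
    then have "y $ N = 0" using Suc.prems(2)[of 1] by simp
    show ?case
    proof (rule fps_ext)
      fix j
      show "y $ j = 0 $ j"
        using low \<open>y $ N = 0\<close> Suc.prems(1) by (cases j N rule: linorder_cases) auto
    qed
  qed
  moreover obtain N where "\<forall>j>N. y $ j = 0" using y C_poly_bound by meson
  ultimately show ?thesis using zero by (metis Suc_le_eq)
qed

definition t_deriv :: "('a, 'e) cochain_ring fps \<Rightarrow> ('a, 'e) cochain_ring fps" where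
  "t_deriv y = Abs_fps (\<lambda>j. scalar (of_nat (Suc j)) * y $ Suc j)"

lemma t_deriv_add: "t_deriv (x + y) = t_deriv x + t_deriv y"
  by (simp add: t_deriv_def fps_eq_iff distrib_left)

lemma additive_t_deriv: "additive_map t_deriv"
  by (simp add: additive_map_def t_deriv_add)

lemma t_deriv_mem: "y \<in> C_poly n \<Longrightarrow> t_deriv y \<in> C_poly n"
proof -
  assume y: "y \<in> C_poly n"
  then obtain N where "\<forall>j>N. y $ j = 0" using C_poly_bound by meson
  then show ?thesis
    using y by (intro C_polyI[where N = N]) (auto intro!: scalar_times_mem simp: t_deriv_def C_poly_C)
qed

text \<open>The weight n + 1 of a coefficient is shared between the factors as i and n + 1 - i;
  homogeneity of x lets the second weight pass to y.\<close>

lemma t_deriv_times: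
  assumes x: "x \<in> C_poly m"
  shows "t_deriv (x * y) = t_deriv x * y + x * t_deriv y"
proof (rule fps_ext)
  fix n
  let ?s = "\<lambda>j. scalar (of_nat j)"
  have comm: "x $ i * (?s j * z) = ?s j * (x $ i * z)" for i j z
    using times_scalar[OF C_poly_C[OF x], of i "of_nat j"] by (simp flip: mult.assoc)
  have "t_deriv (x * y) $ n = (\<Sum>i\<le>Suc n. ?s (Suc n) * (x $ i * y $ (Suc n - i)))"
    by (simp only: t_deriv_def fps_nth_Abs_fps sum_fps_mult sum_distrib_left)
  also have "\<dots> = (\<Sum>i\<le>Suc n. ?s i * (x $ i * y $ (Suc n - i)) + ?s (Suc n - i) * (x $ i * y $ (Suc n - i)))"
  proof (intro sum.cong refl)
    fix i assume "i \<in> {..Suc n}"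
    then have "?s (Suc n) = ?s i + ?s (Suc n - i)" by (simp flip: scalar_add of_nat_add)
    then show "?s (Suc n) * (x $ i * y $ (Suc n - i)) =
        ?s i * (x $ i * y $ (Suc n - i)) + ?s (Suc n - i) * (x $ i * y $ (Suc n - i))"
      by (simp only: distrib_right)
  qed
  also have "\<dots> = (\<Sum>i\<le>Suc n. ?s i * (x $ i * y $ (Suc n - i))) + (\<Sum>i\<le>Suc n. ?s (Suc n - i) * (x $ i * y $ (Suc n - i)))"
    by (rule sum.distrib)
  also have "(\<Sum>i\<le>Suc n. ?s i * (x $ i * y $ (Suc n - i))) = (\<Sum>i\<le>n. ?s (Suc i) * (x $ Suc i * y $ (n - i)))"
    by (subst sum.atMost_Suc_shift) (simp add: scalar_zero)
  also have "\<dots> = (t_deriv x * y) $ n"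
    by (simp add: sum_fps_mult t_deriv_def mult.assoc)
  also have "(\<Sum>i\<le>Suc n. ?s (Suc n - i) * (x $ i * y $ (Suc n - i))) = (\<Sum>i\<le>n. ?s (Suc n - i) * (x $ i * y $ (Suc n - i)))"
    by (simp add: scalar_zero)
  also have "\<dots> = (x * t_deriv y) $ n"
    unfolding sum_fps_mult by (intro sum.cong) (auto simp: t_deriv_def comm Suc_diff_le simp del: of_nat_Suc)
  finally show "t_deriv (x * y) $ n = (t_deriv x * y + x * t_deriv y) $ n" by simp
qed

lemma t_deriv_const: "t_deriv (fps_const x) = 0"
  by (simp add: t_deriv_def fps_eq_iff)

lemma t_deriv_eq_0_imp:
  assumes "t_deriv y = 0" and "y $ 0 = 0"
  shows "y = 0"
proof (rule fps_ext)
  fix j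
  show "y $ j = 0 $ j"
  proof (cases j)
    case (Suc k)
    have "scalar (of_nat (Suc k)) * y $ Suc k = 0" using assms(1) by (simp add: t_deriv_def fps_eq_iff)
    then show ?thesis using scalar_cancel[of "of_nat (Suc k)"] Suc by (simp del: of_nat_Suc)
  qed (use assms in simp)
qed

text \<open>The primitive that vanishes at t = 0; the divisions are possible in characteristic
  zero.\<close>

definition t_integral :: "('a, 'e) cochain_ring fps \<Rightarrow> ('a, 'e) cochain_ring fps" where
  "t_integral y = Abs_fps (\<lambda>j. case j of 0 \<Rightarrow> 0 | Suc k \<Rightarrow> scalar (1 / of_nat (Suc k)) * y $ k)"

lemma t_integral_mem:
  assumes "y \<in> C_poly n"
  shows "t_integral y \<in> C_poly n"
proof -
  obtain N where "\<forall>j>N. y $ j = 0" using assms C_poly_bound by meson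
  then show ?thesis
    using assms by (intro C_polyI[where N = "Suc N"])
      (auto simp: t_integral_def zero_mem_C C_poly_C scalar_times_mem split: nat.split)
qed

lemma t_deriv_t_integral: "t_deriv (t_integral y) = y"
proof -
  have "scalar (of_nat (Suc k)) * (scalar (1 / of_nat (Suc k)) * z) = z" for k z
    by (simp add: scalar_mult scalar_one_times del: of_nat_Suc flip: mult.assoc)
  then show ?thesis by (simp add: t_deriv_def t_integral_def fps_eq_iff del: of_nat_Suc)
qed

lemma t_integral_0: "t_integral y $ 0 = 0"
  by (simp add: t_integral_def)

text \<open>In paths the outer series variable is \<open>\<epsilon>\<close> and the inner one is t.\<close>

definition Path :: "nat \<Rightarrow> ('a, 'e) cochain_ring fps fps set" where
  "Path n = {x. \<forall>i. x $ i \<in> C_poly n}"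

definition path_eval :: "'k \<Rightarrow> ('a, 'e) cochain_ring fps fps \<Rightarrow> ('a, 'e) cochain_ring fps" where
  "path_eval t x = Abs_fps (\<lambda>i. eval_poly t (x $ i))"

definition path_deriv :: "('a, 'e) cochain_ring fps fps \<Rightarrow> ('a, 'e) cochain_ring fps fps" where
  "path_deriv x = Abs_fps (\<lambda>i. t_deriv (x $ i))"

definition path_const :: "('a, 'e) cochain_ring fps \<Rightarrow> ('a, 'e) cochain_ring fps fps" where
  "path_const v = Abs_fps (\<lambda>i. fps_const (v $ i))"

lemma PathD: "x \<in> Path n \<Longrightarrow> x $ i \<in> C_poly n"
  by (simp add: Path_def)

lemma path_nth [simp]:
  "path_eval t x $ i = eval_poly t (x $ i)" "path_deriv x $ i = t_deriv (x $ i)"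
  "path_const v $ i = fps_const (v $ i)"
  by (simp_all add: path_eval_def path_deriv_def path_const_def)

lemma Path_add: "x \<in> Path n \<Longrightarrow> y \<in> Path n \<Longrightarrow> x + y \<in> Path n"
  by (simp add: Path_def C_poly_add)

lemma Path_minus: "x \<in> Path n \<Longrightarrow> - x \<in> Path n"
  by (simp add: Path_def C_poly_minus)

lemma Path_diff: "x \<in> Path n \<Longrightarrow> y \<in> Path n \<Longrightarrow> x - y \<in> Path n"
  using Path_add[of x n "- y"] by (simp add: Path_minus)

lemma Path_times: "x \<in> Path m \<Longrightarrow> y \<in> Path n \<Longrightarrow> x * y \<in> Path (m + n)"
  by (auto simp: Path_def sum_fps_mult intro!: C_poly_sum C_poly_times)

lemma Path_deriv: "x \<in> Path n \<Longrightarrow> path_deriv x \<in> Path n"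
  by (simp add: Path_def t_deriv_mem)

lemma Path_const: "v \<in> C_eps n \<Longrightarrow> path_const v \<in> Path n"
  by (simp add: Path_def C_eps_def C_poly_const)

lemma path_eval_mem: "x \<in> Path n \<Longrightarrow> path_eval t x \<in> C_eps n"
  by (simp add: Path_def C_eps_def eval_poly_mem)

lemma path_eval_add: "x \<in> Path n \<Longrightarrow> y \<in> Path n \<Longrightarrow> path_eval t (x + y) = path_eval t x + path_eval t y"
  by (simp add: fps_eq_iff eval_poly_add[OF PathD PathD])

lemma path_eval_minus: "path_eval t (- x) = - path_eval t x"
  by (simp add: fps_eq_iff eval_poly_minus)

lemma path_eval_diff: "x \<in> Path n \<Longrightarrow> y \<in> Path n \<Longrightarrow> path_eval t (x - y) = path_eval t x - path_eval t y"
  using path_eval_add[of x n "- y" t] by (simp add: Path_minus path_eval_minus)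

lemma path_eval_times:
  assumes "x \<in> Path m" and "y \<in> Path n"
  shows "path_eval t (x * y) = path_eval t x * path_eval t y"
proof (rule fps_ext)
  fix k
  have "eval_poly t (\<Sum>i\<le>k. x $ i * y $ (k - i)) = (\<Sum>i\<le>k. eval_poly t (x $ i * y $ (k - i)))"
    using assms by (intro eval_poly_sum[where n = "m + n"] C_poly_times PathD) auto
  also have "\<dots> = (\<Sum>i\<le>k. eval_poly t (x $ i) * eval_poly t (y $ (k - i)))"
    using eval_poly_times[OF PathD[OF assms(1)] PathD[OF assms(2)]] by simp
  finally show "path_eval t (x * y) $ k = (path_eval t x * path_eval t y) $ k"
    by (simp add: sum_fps_mult)
qed

lemma path_eval_const: "path_eval t (path_const v) = v"
  by (simp add: fps_eq_iff eval_poly_const)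

lemma path_eval_eq_0_imp: "x \<in> Path n \<Longrightarrow> (\<And>t. path_eval t x = 0) \<Longrightarrow> x = 0"
  using eval_poly_eq_0_imp[OF PathD] by (simp add: fps_eq_iff)

lemma path_deriv_add: "path_deriv (x + y) = path_deriv x + path_deriv y"
  by (simp add: fps_eq_iff t_deriv_add)

lemma path_deriv_diff: "path_deriv (x - y) = path_deriv x - path_deriv y"
  by (simp add: fps_eq_iff additive_map_diff[OF additive_t_deriv])

lemma path_deriv_times:
  assumes "x \<in> Path m"
  shows "path_deriv (x * y) = path_deriv x * y + x * path_deriv y"
  by (rule fps_ext)
    (simp add: sum_fps_mult additive_map_sum[OF additive_t_deriv] t_deriv_times[OF PathD[OF assms]] sum.distrib)

lemma path_deriv_const: "path_deriv (path_const v) = 0"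
  by (simp add: fps_eq_iff t_deriv_const)

text \<open>The class \<open>ring\<close> provides no 1, so the constant path at the identity of E
  takes its place.\<close>

abbreviation "path_unit \<equiv> path_const (fps_const (scalar 1))"

lemma path_unit_nth: "path_unit $ i = (if i = 0 then fps_const (scalar 1) else 0)"
  by (simp add: fps_eq_iff)

lemma unit_times: "fps_const (scalar 1) * x = x"
  by (simp add: fps_eq_iff scalar_one_times)

lemma times_unit: "x \<in> C_eps n \<Longrightarrow> x * fps_const (scalar 1) = x"
  using times_scalar_eps[of x n "fps_const 1"] unfolding scalar_eps_const by (simp add: unit_times)

lemma path_unit_eq: "path_unit = fps_const (fps_const (scalar 1))"
  by (rule fps_ext) (simp add: path_unit_nth)

lemma path_unit_times: "path_unit * x = x"
  by (simp add: path_unit_eq fps_eq_iff scalar_one_times)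

lemma times_path_unit: "x \<in> Path n \<Longrightarrow> x * path_unit = x"
proof (rule fps_ext)
  fix i assume "x \<in> Path n"
  then have "x $ i * fps_const (scalar 1) = x $ i" by (intro times_unit[of _ n]) (simp add: Path_def C_poly_def)
  then show "(x * path_unit) $ i = x $ i" by (simp add: path_unit_eq)
qed

text \<open>Course-of-values recursion, with \<open>f n\<close> carrying the list of the first n + 1
  coefficients. G is negation for inverses and \<open>t_integral\<close> for the flow
  equation.\<close>

lemma fps_recursion:
  fixes G :: "'r::ring \<Rightarrow> 'r"
  obtains Q where "Q $ 0 = a" "\<And>n. Q $ Suc n = G (\<Sum>i<Suc n. c $ (Suc n - i) * Q $ i)"
proof -
  define f where "f = rec_nat [a] (\<lambda>n qs. qs @ [G (\<Sum>i<Suc n. c $ (Suc n - i) * qs ! i)])"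
  have f_Suc: "f (Suc n) = f n @ [G (\<Sum>i<Suc n. c $ (Suc n - i) * f n ! i)]" for n
    by (simp add: f_def)
  have len: "length (f n) = Suc n" for n by (induction n) (simp_all add: f_def)
  define Q where "Q = Abs_fps (\<lambda>n. f n ! n)"
  have nth: "f n ! i = Q $ i" if "i \<le> n" for n i
    using that
  proof (induction n)
    case (Suc n)
    then show ?case
      by (cases "i = Suc n") (auto simp: Q_def f_Suc nth_append len simp del: sum.lessThan_Suc)
  qed (simp add: Q_def)
  have "Q $ Suc n = f (Suc n) ! Suc n" for n by (simp add: Q_def)
  then have "Q $ Suc n = G (\<Sum>i<Suc n. c $ (Suc n - i) * f n ! i)" for n
    by (simp add: f_Suc nth_append len)
  then have "Q $ Suc n = G (\<Sum>i<Suc n. c $ (Suc n - i) * Q $ i)" for n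
    using nth by simp
  moreover have "Q $ 0 = a" by (simp add: Q_def f_def)
  ultimately show ?thesis using that by blast
qed

text \<open>Since \<Phi> starts with the unit, coefficient n + 1 of \<Phi> Q contains the unknown
  coefficient of Q alone and otherwise earlier ones. Solving for it takes sums and products only, so
  it stays polynomial in t.\<close>

lemma path_right_inverse:
  assumes \<Phi>: "\<Phi> \<in> Path 0" and unit: "\<Phi> $ 0 = fps_const (scalar 1)"
  shows "\<exists>Q\<in>Path 0. Q $ 0 = fps_const (scalar 1) \<and> \<Phi> * Q = path_unit"
proof -
  obtain Q where Q0: "Q $ 0 = fps_const (scalar 1)"
    and QS: "\<And>n. Q $ Suc n = - (\<Sum>i<Suc n. \<Phi> $ (Suc n - i) * Q $ i)"
    using fps_recursion by blast
  have mem: "Q $ n \<in> C_poly 0" for n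
  proof (induction n rule: less_induct)
    case (less n)
    show ?case
    proof (cases n)
      case 0
      then show ?thesis by (simp add: Q0 C_poly_const scalar_mem_C)
    next
      case (Suc k)
      show ?thesis unfolding Suc QS
        using less C_poly_times[OF PathD[OF \<Phi>], of _ 0]
        by (auto intro!: C_poly_minus C_poly_sum simp: Suc simp del: sum.lessThan_Suc)
    qed
  qed
  have "(\<Phi> * Q) $ n = path_unit $ n" for n
  proof (cases n)
    case 0
    then show ?thesis by (simp add: unit Q0 scalar_mult)
  next
    case (Suc k)
    have "(\<Phi> * Q) $ Suc k = (\<Sum>i\<le>Suc k. \<Phi> $ (Suc k - i) * Q $ i)"
      unfolding sum_fps_mult by (rule sum_atMost_rev)
    also have "\<dots> = (\<Sum>i<Suc k. \<Phi> $ (Suc k - i) * Q $ i) + Q $ Suc k"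
      by (simp add: lessThan_Suc_atMost unit unit_times)
    finally show ?thesis by (simp add: Suc QS path_unit_nth)
  qed
  then show ?thesis using mem Q0 by (intro bexI[of _ Q]) (auto simp: Path_def fps_eq_iff)
qed

text \<open>The right inverse Q has itself a right inverse R, and \<Phi> = \<Phi> Q R = R makes Q
  two-sided.\<close>

lemma path_inverse:
  assumes \<Phi>: "\<Phi> \<in> Path 0" and unit: "\<Phi> $ 0 = fps_const (scalar 1)"
  obtains Q where "Q \<in> Path 0" "Q $ 0 = fps_const (scalar 1)" "\<Phi> * Q = path_unit" "Q * \<Phi> = path_unit"
proof -
  obtain Q where Q: "Q \<in> Path 0" "Q $ 0 = fps_const (scalar 1)" "\<Phi> * Q = path_unit"
    using path_right_inverse[OF assms] by blast
  obtain R where R: "R \<in> Path 0" "Q * R = path_unit"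
    using path_right_inverse[OF Q(1,2)] by blast
  have "\<Phi> = \<Phi> * Q * R" using R(2) times_path_unit[OF \<Phi>] by (simp add: mult.assoc)
  then have "\<Phi> = R" by (simp add: Q(3) path_unit_times)
  then show ?thesis using that Q R by simp
qed

text \<open>Because b has no term of order zero, the right-hand side at order n + 1 involves only
  lower orders of the solution: each step integrates a known polynomial. Integration from 0 keeps
  the initial value.\<close>

lemma path_linear_ode:
  assumes b: "b \<in> Path 0" and b0: "b $ 0 = 0"
  shows "\<exists>\<Phi>\<in>Path 0. \<Phi> $ 0 = fps_const (scalar 1) \<and> path_deriv \<Phi> = b * \<Phi> \<and>
    path_eval 0 \<Phi> = fps_const (scalar 1)"
proof -
  obtain Q where Q0: "Q $ 0 = fps_const (scalar 1)"
    and QS: "\<And>n. Q $ Suc n = t_integral (\<Sum>i<Suc n. b $ (Suc n - i) * Q $ i)"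
    using fps_recursion by blast
  have mem: "Q $ n \<in> C_poly 0" for n
  proof (induction n rule: less_induct)
    case (less n)
    show ?case
    proof (cases n)
      case 0
      then show ?thesis by (simp add: Q0 C_poly_const scalar_mem_C)
    next
      case (Suc k)
      show ?thesis unfolding Suc QS
        using less C_poly_times[OF PathD[OF b], of _ 0]
        by (auto intro!: t_integral_mem C_poly_sum simp: Suc simp del: sum.lessThan_Suc)
    qed
  qed
  have "t_deriv (Q $ n) = (b * Q) $ n" for n
  proof (cases n)
    case 0
    then show ?thesis by (simp add: b0 Q0 t_deriv_const)
  next
    case (Suc k)
    have "(b * Q) $ Suc k = (\<Sum>i\<le>Suc k. b $ (Suc k - i) * Q $ i)"
      unfolding sum_fps_mult by (rule sum_atMost_rev)
    also have "\<dots> = (\<Sum>i<Suc k. b $ (Suc k - i) * Q $ i)"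
      by (simp add: lessThan_Suc_atMost b0)
    finally show ?thesis by (simp add: Suc QS t_deriv_t_integral)
  qed
  moreover have "eval_poly 0 (Q $ n) = fps_const (scalar 1) $ n" for n
    unfolding eval_poly_at_0[OF mem] by (cases n) (simp_all add: Q0 QS t_integral_0)
  ultimately show ?thesis
    using mem Q0 by (intro bexI[of _ Q]) (auto simp: Path_def fps_eq_iff)
qed

text \<open>By induction the lower orders of W vanish and b has no term of order zero, so each
  coefficient has derivative zero and, by the initial value, is zero.\<close>

lemma path_ode_unique:
  assumes b0: "b $ 0 = 0" and W: "W \<in> Path n" and ode: "path_deriv W = b * W" and init: "path_eval 0 W = 0"
  shows "W = 0"
proof -
  have "W $ i = 0" for i
  proof (induction i rule: less_induct)
    case (less i)
    have "t_deriv (W $ i) = (b * W) $ i" using arg_cong[OF ode, of "\<lambda>u. u $ i"] by simp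
    also have "\<dots> = (\<Sum>j\<le>i. b $ j * W $ (i - j))" by (rule sum_fps_mult)
    also have "\<dots> = 0"
    proof (rule sum.neutral, safe)
      fix j assume "j \<le> i"
      then show "b $ j * W $ (i - j) = 0" using less[of "i - j"] b0 by (cases "j = 0") auto
    qed
    finally have "t_deriv (W $ i) = 0" .
    moreover have "W $ i $ 0 = 0"
      using arg_cong[OF init, of "\<lambda>u. u $ i"] eval_poly_at_0[OF PathD[OF W], of i] by simp
    ultimately show ?case by (rule t_deriv_eq_0_imp)
  qed
  then show ?thesis by (simp add: fps_eq_iff)
qed

end

section \<open>Gauge equivalence\<close>

context relative_cochains
begin

section \<open>Translation between paths and series of polynomials\<close>

lemma path_eval_zero: "path_eval t 0 = 0"
  by (rule fps_ext) (simp add: eval_poly_zero)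

text \<open>\<open>Abs_cochain_ring\<close> is meaningful on additive values only; the lemmas below
  assume that the coefficients are cochains.\<close>

definition path_of :: "('a, 'e) cochain poly fps \<Rightarrow> ('a, 'e) cochain_ring fps fps" where
  "path_of a = Abs_fps (\<lambda>i. Abs_fps (\<lambda>j. Abs_cochain_ring (coeff (a $ i) j)))"

lemma path_of_nth [simp]: "path_of a $ i $ j = Abs_cochain_ring (coeff (a $ i) j)"
  by (simp add: path_of_def)

lemma Abs_cochain_ring_0: "Abs_cochain_ring 0 = 0"
  by (rule cochain_ring_eqI) (subst app_Abs, simp_all add: additive_map_def)

context
  fixes a :: "('a, 'e) cochain poly fps" and n
  assumes a: "\<And>i j. coeff (a $ i) j \<in> cochains \<iota> act n"
begin

lemma app_path_of: "app (Abs_cochain_ring (coeff (a $ i) j)) = coeff (a $ i) j"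
  by (rule app_Abs_cochain[OF a])

lemma path_of_bound: "\<forall>j>degree (a $ i). path_of a $ i $ j = 0"
  by (simp add: coeff_eq_0 Abs_cochain_ring_0)

lemma path_of_mem: "path_of a \<in> Path n"
  unfolding Path_def mem_Collect_eq
proof
  fix i show "path_of a $ i \<in> C_poly n"
    by (rule C_polyI[where N = "degree (a $ i)"]) (use path_of_bound Abs_cochain_mem[OF a] in auto)
qed

lemma path_of_0_iff: "path_of a $ 0 = 0 \<longleftrightarrow> a $ 0 = 0"
proof
  assume 0: "path_of a $ 0 = 0"
  have "coeff (a $ 0) j = 0" for j
  proof -
    have "path_of a $ 0 $ j = 0" using 0 by simp
    then have "app (Abs_cochain_ring (coeff (a $ 0) j)) = app 0" by simp
    then show ?thesis unfolding app_path_of by (simp add: fun_eq_iff)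
  qed
  then show "a $ 0 = 0" by (simp add: poly_eq_iff)
qed (simp add: fps_eq_iff Abs_cochain_ring_0)

lemma value_at_eq: "value_at (k_on_cochain \<iota> act) a t = app_eps (path_eval t (path_of a))"
proof (intro fps_ext ext)
  fix i as e
  show "(value_at (k_on_cochain \<iota> act) a t $ i) as e = (app_eps (path_eval t (path_of a)) $ i) as e"
    by (simp add: value_at_def eval_poly_eq[OF path_of_bound] app_sum scalar_times app_path_of
        sum_fun_apply k_on_cochain_def)
qed

lemma deriv_at_eq: "deriv_at (k_on_cochain \<iota> act) a t = app_eps (path_eval t (path_deriv (path_of a)))"
proof (intro fps_ext ext)
  fix i as e
  let ?d = "degree (a $ i)"
  let ?y = "path_of a $ i"
  have "\<forall>j>?d. t_deriv ?y $ j = 0" using path_of_bound by (simp add: t_deriv_def)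
  then have "eval_poly t (t_deriv ?y) = (\<Sum>j\<le>?d. scalar (t ^ j) * t_deriv ?y $ j)"
    by (rule eval_poly_eq)
  \<comment> \<open>The term j = \<open>?d\<close> drops out: it carries coefficient
    \<open>?d\<close> + 1 of the path, beyond the degree.\<close>
  also have "\<dots> = (\<Sum>j<?d. scalar (t ^ j) * t_deriv ?y $ j)"
    using path_of_bound[of i] by (simp add: t_deriv_def flip: lessThan_Suc_atMost del: path_of_nth)
  also have "\<dots> = (\<Sum>j<?d. scalar (of_nat (Suc j) * t ^ j) * ?y $ Suc j)"
    by (simp add: t_deriv_def scalar_mult mult.commute del: of_nat_Suc path_of_nth flip: mult.assoc)
  also have "\<dots> = (\<Sum>j = 1..?d. scalar (of_nat j * t ^ (j - 1)) * ?y $ j)"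
    by (simp add: sum.atLeast1_atMost_eq)
  finally show "(deriv_at (k_on_cochain \<iota> act) a t $ i) as e =
      (app_eps (path_eval t (path_deriv (path_of a))) $ i) as e"
    by (simp add: deriv_at_def app_sum scalar_times app_path_of sum_fun_apply k_on_cochain_def)
qed

end

lemma Path_obtain:
  assumes x: "x \<in> Path n"
  obtains a where "\<And>i j. coeff (a $ i) j \<in> cochains \<iota> act n" "path_of a = x"
proof -
  define a where "a = Abs_fps (\<lambda>i. Abs_poly (\<lambda>j. app (x $ i $ j)))"
  have co: "coeff (a $ i) j = app (x $ i $ j)" for i j
  proof -
    obtain N where "\<forall>j>N. x $ i $ j = 0" using C_poly_bound[OF PathD[OF x]] by meson
    then have "coeff (Abs_poly (\<lambda>j. app (x $ i $ j))) = (\<lambda>j. app (x $ i $ j))"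
      by (intro coeff_Abs_poly[of N]) (simp add: fun_eq_iff)
    then show ?thesis by (simp add: a_def)
  qed
  show ?thesis
  proof (rule that[of a])
    show "coeff (a $ i) j \<in> cochains \<iota> act n" for i j
      using C_poly_C[OF PathD[OF x], of i j] by (simp add: C_def co)
    show "path_of a = x" by (simp add: fps_eq_iff co app_inverse)
  qed
qed

end

context quantized_cochains
begin

text \<open>For b of degree 0 the contraction part of \<open>ell1\<close> vanishes, so the gauge
  equation at t says that M = m + a satisfies M' = b M - M b, a Lax equation. Validity at all t
  turns into one identity of paths, in which derivatives can be taken.\<close>

lemma gauge_equiv_mc_iff:
  "gauge_equiv_mc \<iota> act \<alpha>X (app_eps x) (app_eps y) \<longleftrightarrow>
    (\<exists>a\<in>Path 1. \<exists>b\<in>Path 0. a $ 0 = 0 \<and> b $ 0 = 0 \<and> path_eval 0 a = x \<and> path_eval 1 a = y \<and>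
      (\<forall>t. maurer_cartan \<iota> act \<alpha>X (app_eps (path_eval t a))) \<and>
      path_deriv a + (path_const mult_eps + a) * b = b * (path_const mult_eps + a))"
  (is "?mc \<longleftrightarrow> (\<exists>a\<in>Path 1. \<exists>b\<in>Path 0. ?P a b)")
proof -
  let ?kc = "k_on_cochain \<iota> act"
  have m: "path_const mult_eps \<in> Path 1" by (rule Path_const[OF mult_eps_mem])
  have eq: "(\<forall>t. app_eps (path_eval t (path_deriv a)) + ell1 \<iota> act \<alpha>X 0 (app_eps (path_eval t b))
      + ell2 \<iota> act 1 0 (app_eps (path_eval t a)) (app_eps (path_eval t b)) = 0) \<longleftrightarrow>
     path_deriv a + (path_const mult_eps + a) * b = b * (path_const mult_eps + a)"
    if a: "a \<in> Path 1" and b: "b \<in> Path 0" for a b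
  proof -
    let ?Z = "path_deriv a + (path_const mult_eps + a) * b - b * (path_const mult_eps + a)"
    note ma = Path_add[OF m a] and da = Path_deriv[OF a]
    have mab: "(path_const mult_eps + a) * b \<in> Path 1" using Path_times[OF ma b] by simp
    have mem: "path_deriv a + (path_const mult_eps + a) * b \<in> Path 1" "b * (path_const mult_eps + a) \<in> Path 1"
      using Path_add[OF da mab] Path_times[OF b ma] by simp_all
    have "app_eps (path_eval t (path_deriv a)) + ell1 \<iota> act \<alpha>X 0 (app_eps (path_eval t b))
        + ell2 \<iota> act 1 0 (app_eps (path_eval t a)) (app_eps (path_eval t b)) = app_eps (path_eval t ?Z)" for t
    proof -
      have Z: "path_eval t ?Z = path_eval t (path_deriv a)
          + (mult_eps + path_eval t a) * path_eval t b - path_eval t b * (mult_eps + path_eval t a)"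
        unfolding path_eval_diff[OF mem] path_eval_add[OF da mab]
          path_eval_times[OF ma b] path_eval_times[OF b ma] path_eval_add[OF m a] path_eval_const
        by simp
      have "app_eps u + app_eps v = app_eps (u + v)" for u v
        by (simp add: fps_eq_iff fun_eq_iff)
      then show ?thesis
        unfolding Z ell1_app_eps[OF path_eval_mem[OF b]] ell2_app_eps[OF path_eval_mem[OF a] path_eval_mem[OF b]]
        by (simp add: sgn_power_def D_C0[OF path_eval_mem[OF b]] algebra_simps)
    qed
    moreover have "app_eps u = 0 \<longleftrightarrow> u = 0" for u
      using app_eps_inject[of u 0] by (simp add: fps_eq_iff fun_eq_iff)
    moreover have "(\<forall>t. path_eval t ?Z = 0) \<longleftrightarrow> ?Z = 0"
      using path_eval_eq_0_imp[OF Path_diff[OF mem]]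
      by (auto simp: path_eval_zero)
    ultimately show ?thesis by simp
  qed
  show ?thesis
  proof
    assume ?mc
    then obtain a b where ab: "a $ 0 = 0" "\<And>i j. coeff (a $ i) j \<in> cochains \<iota> act 1"
        "b $ 0 = 0" "\<And>i j. coeff (b $ i) j \<in> cochains \<iota> act 0"
        "value_at ?kc a 0 = app_eps x" "value_at ?kc a 1 = app_eps y"
        "\<forall>t. maurer_cartan \<iota> act \<alpha>X (value_at ?kc a t)"
        "\<forall>t. deriv_at ?kc a t + ell1 \<iota> act \<alpha>X 0 (value_at ?kc b t)
             + ell2 \<iota> act 1 0 (value_at ?kc a t) (value_at ?kc b t) = 0"
      unfolding gauge_equiv_mc_def by blast
    note a = path_of_mem[OF ab(2)] and b = path_of_mem[OF ab(4)]
    have "?P (path_of a) (path_of b)"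
      using ab eq[OF a b] path_of_0_iff[OF ab(2)] path_of_0_iff[OF ab(4)]
      by (simp add: value_at_eq[OF ab(2)] value_at_eq[OF ab(4)] deriv_at_eq[OF ab(2)] app_eps_inject)
    then show "\<exists>a\<in>Path 1. \<exists>b\<in>Path 0. ?P a b" using a b by blast
  next
    assume "\<exists>a\<in>Path 1. \<exists>b\<in>Path 0. ?P a b"
    then obtain u v where uv: "u \<in> Path 1" "v \<in> Path 0" "?P u v" by blast
    obtain a where a: "\<And>i j. coeff (a $ i) j \<in> cochains \<iota> act 1" "path_of a = u"
      using Path_obtain[OF uv(1)] by blast
    obtain b where b: "\<And>i j. coeff (b $ i) j \<in> cochains \<iota> act 0" "path_of b = v"
      using Path_obtain[OF uv(2)] by blast
    show ?mc unfolding gauge_equiv_mc_def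
      using uv(3) eq[OF uv(1,2)] a(1) b(1) path_of_0_iff[OF a(1)] path_of_0_iff[OF b(1)]
      by (intro exI[of _ a] exI[of _ b])
        (simp add: value_at_eq[OF a(1)] value_at_eq[OF b(1)] deriv_at_eq[OF a(1)] a(2) b(2))
  qed
qed

text \<open>At order zero \<Phi>, its inverse Q and hence M are constant in t, and M is
  \<open>mult_action\<close> there; this gives the vanishing of a and b at order zero. Conjugation
  preserves M M + D M = 0 because D kills elements of degree 0.\<close>

lemma gauge_actions_imp_mc:
  assumes X: "X \<in> C_eps 1" and MC: "X * X + D X = 0" and X0: "X $ 0 = mult_action"
    and Y: "Y \<in> C_eps 1"
    and \<phi>: "\<phi> \<in> C_eps 0" and \<phi>0: "\<phi> $ 0 = scalar 1" and gauge: "\<phi> * X = Y * \<phi>"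
  shows "gauge_equiv_mc \<iota> act \<alpha>X (app_eps (X - mult_eps)) (app_eps (Y - mult_eps))"
proof -
  txt \<open>The path \<open>1 + t (\<phi> - 1)\<close> of gauge transformations.\<close>
  define \<Phi> where "\<Phi> = Abs_fps (\<lambda>i. if i = 0 then fps_const (scalar 1)
    else Abs_fps (\<lambda>j. if j = 1 then \<phi> $ i else 0))"
  have \<Phi>: "\<Phi> \<in> Path 0"
    unfolding Path_def using C_epsD[OF \<phi>]
    by (auto simp: \<Phi>_def zero_mem_C scalar_mem_C intro!: C_polyI[where N = 1])
  have \<Phi>0: "\<Phi> $ 0 = fps_const (scalar 1)" by (simp add: \<Phi>_def)
  obtain Q where Q: "Q \<in> Path 0" and Q0: "Q $ 0 = fps_const (scalar 1)"
    and \<Phi>Q: "\<Phi> * Q = path_unit" and Q\<Phi>: "Q * \<Phi> = path_unit"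
    using path_inverse[OF \<Phi> \<Phi>0] by blast
  let ?X = "path_const X"
  have X': "?X \<in> Path 1" by (rule Path_const[OF X])
  define M where "M = \<Phi> * ?X * Q"
  have M: "M \<in> Path 1" using Path_times[OF Path_times[OF \<Phi> X'] Q] by (simp add: M_def)
  define b where "b = path_deriv \<Phi> * Q"
  have b: "b \<in> Path 0" using Path_times[OF Path_deriv[OF \<Phi>] Q] by (simp add: b_def)
  have d\<Phi>: "path_deriv \<Phi> = b * \<Phi>"
    using times_path_unit[OF Path_deriv[OF \<Phi>]] by (simp add: b_def mult.assoc Q\<Phi>)
  \<comment> \<open>Differentiate \<Phi> Q = 1 and multiply by Q from the left.\<close>
  have dQ: "path_deriv Q = - (Q * b)"
  proof -
    have "path_deriv \<Phi> * Q + \<Phi> * path_deriv Q = 0"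
      using path_deriv_times[OF \<Phi>, of Q] by (simp only: \<Phi>Q path_deriv_const)
    then have "Q * (\<Phi> * path_deriv Q) = - (Q * b)"
      by (simp add: b_def add_eq_0_iff)
    then show ?thesis by (simp add: Q\<Phi> path_unit_times flip: mult.assoc)
  qed
  have dM: "path_deriv M = b * M - M * b"
    unfolding M_def
    by (simp add: path_deriv_times[OF Path_times[OF \<Phi> X', simplified]] path_deriv_times[OF \<Phi>]
        path_deriv_times[OF X'] path_deriv_const d\<Phi> dQ mult.assoc)
  have ev0: "path_eval 0 \<Phi> = fps_const (scalar 1)"
    by (rule fps_ext) (simp add: eval_poly_at_0[OF PathD[OF \<Phi>]], simp add: \<Phi>_def)
  have ev1: "path_eval 1 \<Phi> = \<phi>"
  proof (rule fps_ext)
    fix i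
    have "eval_poly 1 (Abs_fps (\<lambda>j. if j = 1 then v else 0)) = v" for v
      by (subst eval_poly_eq[where N = 1]) (auto simp: scalar_one_times)
    then show "path_eval 1 \<Phi> $ i = \<phi> $ i" using \<phi>0 by (simp add: \<Phi>_def eval_poly_const)
  qed
  have evM: "path_eval t M = path_eval t \<Phi> * X * path_eval t Q" for t
    unfolding M_def path_eval_times[OF Path_times[OF \<Phi> X'] Q] path_eval_times[OF \<Phi> X'] path_eval_const ..
  have inv: "path_eval t \<Phi> * path_eval t Q = fps_const (scalar 1)"
    "path_eval t Q * path_eval t \<Phi> = fps_const (scalar 1)" for t
    using path_eval_times[OF \<Phi> Q, of t] path_eval_times[OF Q \<Phi>, of t]
    by (simp_all only: \<Phi>Q Q\<Phi> path_eval_const)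
  have M0: "path_eval 0 M = X"
    using inv(1)[of 0] times_unit[OF X] by (simp add: evM ev0 unit_times)
  have M1: "path_eval 1 M = Y"
    using inv(1)[of 1] times_unit[OF Y] by (simp add: evM ev1 gauge mult.assoc)
  have MC_M: "path_eval t M * path_eval t M + D (path_eval t M) = 0" for t
  proof -
    let ?F = "path_eval t \<Phi>" and ?G = "path_eval t Q"
    have F: "?F \<in> C_eps 0" and G: "?G \<in> C_eps 0" using \<Phi> Q by (auto intro: path_eval_mem)
    have "D (path_eval t M) = ?F * D X * ?G"
      unfolding evM using D_mult[OF F, of "X * ?G"] D_mult[OF X, of ?G] D_C0[OF F] D_C0[OF G]
      by (simp add: sgn_power_def mult.assoc)
    moreover have "path_eval t M * path_eval t M = ?F * (X * X) * ?G"
    proof -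
      have "path_eval t M * path_eval t M = ?F * X * (?G * ?F) * X * ?G"
        by (simp add: evM mult.assoc)
      then show ?thesis by (simp add: inv(2) unit_times mult.assoc)
    qed
    ultimately have "path_eval t M * path_eval t M + D (path_eval t M) = ?F * (X * X + D X) * ?G"
      by (simp add: algebra_simps)
    then show ?thesis by (simp add: MC)
  qed
  let ?m = "path_const mult_eps"
  have m: "?m \<in> Path 1" by (rule Path_const[OF mult_eps_mem])
  have a: "M - ?m \<in> Path 1" by (rule Path_diff[OF M m])
  have eva: "path_eval t (M - ?m) = path_eval t M - mult_eps" for t
    by (simp only: path_eval_diff[OF M m] path_eval_const)
  have "maurer_cartan \<iota> act \<alpha>X (app_eps (path_eval t (M - ?m)))" for t
    using MC_M[of t] maurer_cartan_iff[OF path_eval_mem[OF a]] by (simp add: eva)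
  moreover have "(M - ?m) $ 0 = 0"
    using X0 times_scalar[OF mult_action_mem, of 1]
    by (simp add: M_def \<Phi>0 Q0 mult_eps_def scalar_one_times)
  moreover have "b $ 0 = 0" by (simp add: b_def \<Phi>0 t_deriv_const)
  moreover have "path_deriv (M - ?m) + (?m + (M - ?m)) * b = b * (?m + (M - ?m))"
    by (simp add: path_deriv_diff path_deriv_const dM)
  ultimately show ?thesis
    unfolding gauge_equiv_mc_iff using a b
    by (intro bexI[of _ "M - ?m"] bexI[of _ b]) (simp_all only: eva M0 M1, simp_all)
qed

text \<open>The time-ordered exponential \<Phi> of b transports the initial action along the flow;
  its value at t = 1 is the gauge transformation.\<close>

lemma gauge_mc_imp_actions:
  assumes "gauge_equiv_mc \<iota> act \<alpha>X (app_eps x) (app_eps y)"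
  shows "\<exists>\<phi>\<in>C_eps 0. \<phi> $ 0 = scalar 1 \<and> \<phi> * (mult_eps + x) = (mult_eps + y) * \<phi>"
proof -
  let ?m = "path_const mult_eps"
  have m: "?m \<in> Path 1" by (rule Path_const[OF mult_eps_mem])
  obtain a b where a: "a \<in> Path 1" and b: "b \<in> Path 0" and b0: "b $ 0 = 0"
    and ends: "path_eval 0 a = x" "path_eval 1 a = y"
    and flow: "path_deriv a + (?m + a) * b = b * (?m + a)"
    using assms unfolding gauge_equiv_mc_iff by blast
  have x: "x \<in> C_eps 1" using path_eval_mem[OF a, of 0] ends by simp
  obtain \<Phi> where \<Phi>: "\<Phi> \<in> Path 0" and \<Phi>0: "\<Phi> $ 0 = fps_const (scalar 1)"
    and d\<Phi>: "path_deriv \<Phi> = b * \<Phi>" and init: "path_eval 0 \<Phi> = fps_const (scalar 1)"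
    using path_linear_ode[OF b b0] by blast
  let ?X = "path_const (mult_eps + x)" and ?M = "?m + a"
  have mx: "mult_eps + x \<in> C_eps 1" by (rule C_eps_add[OF mult_eps_mem x])
  have X: "?X \<in> Path 1" by (rule Path_const[OF mx])
  have M: "?M \<in> Path 1" by (rule Path_add[OF m a])
  have PX: "\<Phi> * ?X \<in> Path 1" and MP: "?M * \<Phi> \<in> Path 1"
    using Path_times[OF \<Phi> X] Path_times[OF M \<Phi>] by simp_all
  define W where "W = \<Phi> * ?X - ?M * \<Phi>"
  have W: "W \<in> Path 1" unfolding W_def by (rule Path_diff[OF PX MP])
  have evW: "path_eval t W = path_eval t \<Phi> * (mult_eps + x) - (mult_eps + path_eval t a) * path_eval t \<Phi>" for t
    unfolding W_def path_eval_diff[OF PX MP] path_eval_times[OF \<Phi> X] path_eval_times[OF M \<Phi>]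
      path_eval_add[OF m a] path_eval_const ..
  have "W = 0"
  proof (rule path_ode_unique[OF b0 W])
    \<comment> \<open>In the derivative of M \<Phi> the term -M b \<Phi> from M' cancels M b \<Phi>
      from \<Phi>', which leaves b M \<Phi> and so b W in total.\<close>
    have "path_deriv ?M = b * ?M - ?M * b"
      using flow by (simp add: path_deriv_add path_deriv_const eq_diff_eq)
    then show "path_deriv W = b * W"
      unfolding W_def path_deriv_diff path_deriv_times[OF \<Phi>] path_deriv_times[OF M] d\<Phi> path_deriv_const
      by (simp add: left_diff_distrib right_diff_distrib mult.assoc)
    show "path_eval 0 W = 0"
      unfolding evW init ends using times_unit[OF mx] by (simp add: unit_times)
  qed
  then have "path_eval 1 W = 0" by (simp add: path_eval_zero)
  then have "path_eval 1 \<Phi> * (mult_eps + x) = (mult_eps + y) * path_eval 1 \<Phi>"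
    unfolding evW ends by simp
  moreover have "path_eval 1 \<Phi> $ 0 = scalar 1" by (simp add: \<Phi>0 eval_poly_const)
  ultimately show ?thesis using path_eval_mem[OF \<Phi>] by blast
qed

lemma gauge_equiv_iff:
  assumes x: "x \<in> C_eps 1" and y: "y \<in> C_eps 1" and x0: "x $ 0 = 0"
    and MC: "maurer_cartan \<iota> act \<alpha>X (app_eps x)"
  shows "gauge_equiv_actions \<iota> act (module_action act (app_eps x)) (module_action act (app_eps y)) \<longleftrightarrow>
    gauge_equiv_mc \<iota> act \<alpha>X (app_eps x) (app_eps y)"
proof -
  have mx: "mult_eps + x \<in> C_eps 1" and my: "mult_eps + y \<in> C_eps 1"
    by (rule C_eps_add[OF mult_eps_mem x], rule C_eps_add[OF mult_eps_mem y])
  have "(mult_eps + x) $ 0 = mult_action" by (simp add: x0 mult_eps_def)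
  from gauge_actions_imp_mc[OF mx _ this my] MC
  have "gauge_equiv_mc \<iota> act \<alpha>X (app_eps x) (app_eps y)"
    if "\<phi> \<in> C_eps 0" "\<phi> $ 0 = scalar 1" "\<phi> * (mult_eps + x) = (mult_eps + y) * \<phi>" for \<phi>
    using that by (simp add: maurer_cartan_iff[OF x])
  then show ?thesis
    unfolding module_action_app_eps gauge_equiv_actions_iff[OF mx my]
    using gauge_mc_imp_actions by blast
qed

end

text \<open>For the undeformed product the curvature on (a, b) is a(b e) - (ab)e, which is zero
  because E is a module.\<close>

lemma (in relative_cochains) hochschild_dg:
  "dg_lie_algebra (k_on_cochain \<iota> act) (cochains \<iota> act) (gerst \<iota> act) (d_Hoch \<iota> act)"
proof -
  have "mult_action * mult_action + inner_op (*) mult_action = 0"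
  proof (rule cochain_ring_eqI)
    fix as e
    have mem: "mult_action * mult_action + inner_op (*) mult_action \<in> C 2"
      using add_mem_C[OF times_mem_C[OF mult_action_mem mult_action_mem]
          inner_op_mem_C[OF bilinear_mult mult_action_mem]] by (simp add: numeral_2_eq_2)
    show "app (mult_action * mult_action + inner_op (*) mult_action) as e = app 0 as e"
    proof (cases "length as = 2")
      case True
      then obtain a b where "as = [a, b]" by (auto simp: numeral_2_eq_2 length_Suc_conv)
      then show ?thesis
        using app_times_homogeneous[OF mult_action_mem, of mult_action as e]
        by (simp add: app_mult_action inner_op.rep_eq)
    next
      case False
      from C_length[OF mem this] show ?thesis by simp
    qed
  qed
  then have "curved_dg_lie_algebra (k_on_cochain \<iota> act) (cochains \<iota> act) (gerst \<iota> act) (d_Hoch \<iota> act) (app 0)"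
    using graded_ring_model.curved[OF hochschild_model] unfolding app_C by simp
  then show ?thesis
    by (rule curved_dg_lie_algebra.flat_imp_dg) (simp add: fun_eq_iff)
qed

text \<open>The reduction for a trivial Poisson structure has two clauses: a zero bracket determines
  \<alpha>X only up to order 1 in \<epsilon>, while for the trivial quantization \<alpha>X = 0 the
  whole structure becomes the Hochschild one.\<close>

theorem mainTheorem3:
  fixes \<iota> :: "'k::field_char_0 \<Rightarrow> 'a::comm_ring_1"
    and P :: "'a \<Rightarrow> 'a \<Rightarrow> 'a"
    and \<alpha>X :: "('a \<Rightarrow> 'a \<Rightarrow> 'a) fps"
    and I :: "'a set"
    and act :: "'a \<Rightarrow> 'e::ab_group_add \<Rightarrow> 'e"
  assumes X: "affine_poisson_variety \<iota> P"
    and quantization: "deformation_quantization \<iota> P \<alpha>X"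
    and Y: "closed_subvariety I"
    and E: "vector_bundle_on I act"
  shows "curved_dg_lie_algebra (eps_scale (k_on_cochain \<iota> act)) (eps_cochains \<iota> act)
           (ell2 \<iota> act) (ell1 \<iota> act \<alpha>X) (ell0 act \<alpha>X)
    \<and> dg_lie_algebra (k_on_cochain \<iota> act) (cochains \<iota> act) (gerst \<iota> act) (d_Hoch \<iota> act)
    \<and> (P = (\<lambda>a b. 0) \<longrightarrow>
         (\<forall>i<2. ell0 act \<alpha>X $ i = 0 \<and>
            (\<forall>n. \<forall>\<alpha>\<in>eps_cochains \<iota> act n. ell1 \<iota> act \<alpha>X n \<alpha> $ i = d_Hoch \<iota> act n (\<alpha> $ i))))
    \<and> (P = (\<lambda>a b. 0) \<and> \<alpha>X = 0 \<longrightarrow>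
         ell0 act \<alpha>X = 0 \<and>
         (\<forall>n. \<forall>\<alpha>\<in>eps_cochains \<iota> act n.
            ell1 \<iota> act \<alpha>X n \<alpha> = eps_app (fps_const (d_Hoch \<iota> act n)) \<alpha>) \<and>
         dg_lie_algebra (eps_scale (k_on_cochain \<iota> act)) (eps_cochains \<iota> act)
           (ell2 \<iota> act) (ell1 \<iota> act \<alpha>X))
    \<and> (\<forall>\<alpha>\<in>eps_cochains \<iota> act 1. \<alpha> $ 0 = 0 \<longrightarrow>
         (assoc_module_action \<iota> act \<alpha>X (module_action act \<alpha>) \<longleftrightarrow> maurer_cartan \<iota> act \<alpha>X \<alpha>))
    \<and> (\<forall>\<alpha>\<in>eps_cochains \<iota> act 1. \<forall>\<alpha>'\<in>eps_cochains \<iota> act 1.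
         \<alpha> $ 0 = 0 \<and> \<alpha>' $ 0 = 0 \<and>
         maurer_cartan \<iota> act \<alpha>X \<alpha> \<and> maurer_cartan \<iota> act \<alpha>X \<alpha>' \<longrightarrow>
         (gauge_equiv_actions \<iota> act (module_action act \<alpha>) (module_action act \<alpha>')
            \<longleftrightarrow> gauge_equiv_mc \<iota> act \<alpha>X \<alpha> \<alpha>'))"
proof -
  interpret affine_poisson_variety \<iota> P by (fact X)
  interpret relative_cochains \<iota> act
    using E by unfold_locales (simp_all add: hom_one hom_add hom_mult vector_bundle_on_def module_def)
  interpret quantized_cochains \<iota> act \<alpha>X
    using quantization
    by unfold_locales (auto simp: deformation_quantization_def bidiff_op_def bilinear_on_A_def)
  \<comment> \<open>Coefficient i of \<open>ell1\<close> only meets coefficients of \<alpha>X up to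
    i; a zero inserted product contributes nothing to a multilinear cochain.\<close>
  have low: "ell1 \<iota> act \<alpha>X n \<alpha> $ i = d_Hoch \<iota> act n (\<alpha> $ i)"
    if \<alpha>: "\<alpha> \<in> eps_cochains \<iota> act n" and "\<forall>j\<le>i. \<alpha>X $ j = 0" for i n \<alpha>
  proof -
    obtain x where x: "x \<in> C_eps n" "\<alpha> = app_eps x" using \<alpha> app_eps_C_eps by blast
    have "inner_sum \<iota> act n 0 (app (x $ j)) = 0" for j
      using inner_sum_app[OF C_epsD[OF x(1)], of 0] inner_op_zero_left[OF C_epsD[OF x(1)]]
      by (simp add: fun_eq_iff)
    then show ?thesis
      using that(2) by (simp add: ell1_def x(2) eps_app_const_left eps_app_nth)
  qed
  have flat: "ell0 act \<alpha>X $ i = 0" if "\<alpha>X $ i = 0" for i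
    using that by (simp add: ell0_def fun_eq_iff)
  have first_order: "\<alpha>X $ i = 0" if "P = (\<lambda>a b. 0)" "i < 2" for i
    using quantization that by (auto simp: deformation_quantization_def less_2_cases_iff fun_eq_iff)
  have dg: "dg_lie_algebra (eps_scale (k_on_cochain \<iota> act)) (eps_cochains \<iota> act)
      (ell2 \<iota> act) (ell1 \<iota> act \<alpha>X)" if "\<alpha>X = 0"
  proof (rule curved_dg_lie_algebra.flat_imp_dg[OF curved_dg])
    have "\<alpha>X $ i = 0" for i by (simp add: that)
    then show "ell0 act \<alpha>X = 0" using flat by (intro fps_ext) simp
  qed
  have assoc: "assoc_module_action \<iota> act \<alpha>X (module_action act \<alpha>) \<longleftrightarrow> maurer_cartan \<iota> act \<alpha>X \<alpha>"
    if "\<alpha> \<in> eps_cochains \<iota> act 1" for \<alpha>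
    using that assoc_module_action_iff unfolding app_eps_C_eps[symmetric] by blast
  have gauge: "gauge_equiv_actions \<iota> act (module_action act \<alpha>) (module_action act \<alpha>') \<longleftrightarrow>
      gauge_equiv_mc \<iota> act \<alpha>X \<alpha> \<alpha>'"
    if \<alpha>: "\<alpha> \<in> eps_cochains \<iota> act 1" "\<alpha> $ 0 = 0" "maurer_cartan \<iota> act \<alpha>X \<alpha>"
      and \<alpha>': "\<alpha>' \<in> eps_cochains \<iota> act 1" for \<alpha> \<alpha>'
  proof -
    obtain x where x: "x \<in> C_eps 1" "\<alpha> = app_eps x" using \<alpha>(1) app_eps_C_eps by blast
    obtain y where y: "y \<in> C_eps 1" "\<alpha>' = app_eps y" using \<alpha>' app_eps_C_eps by blast
    have "app (x $ 0) = app 0" using \<alpha>(2) x(2) by (simp add: fps_eq_iff fun_eq_iff flip: app_eps_nth)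
    then have "x $ 0 = 0" by (simp only: app_inject)
    then show ?thesis using gauge_equiv_iff[OF x(1) y(1)] \<alpha>(3) unfolding x(2) y(2) by blast
  qed
  show ?thesis
  proof (intro conjI impI allI ballI)
    fix n \<alpha> assume "P = (\<lambda>a b. 0) \<and> \<alpha>X = 0" "\<alpha> \<in> eps_cochains \<iota> act n"
    then show "ell1 \<iota> act \<alpha>X n \<alpha> = eps_app (fps_const (d_Hoch \<iota> act n)) \<alpha>"
      using low by (intro fps_ext) (simp add: eps_app_const_left)
  next
    assume "P = (\<lambda>a b. 0) \<and> \<alpha>X = 0"
    then have "\<alpha>X $ i = 0" for i by simp
    then show "ell0 act \<alpha>X = 0" using flat by (intro fps_ext) simp
  qed (use curved_dg hochschild_dg low flat first_order dg assoc gauge in auto)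
qed

end
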